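(* Let $(\Omega,m,\theta,\alpha)$ be a Markov fibred system with finite Markov partition $\alpha=\{a_i\mid i\in I\}$ and incidence matrix $A=(a_{ij})_{i,j\in I}$, such that the Radon--Nikodym derivative $\frac{dm\circ\theta}{dm}$ has a continuous version on the support of $m$. Let $\mathcal{R}_A(m)$ be the Radon--Nikodym representation of the Cuntz--Krieger algebra $\mathcal{O}_A$ induced by $(\Omega,m,\theta,\alpha)$, that is, the $C^*$-algebra of operators on the Hilbert space $L^2(\Omega,m)$ generated by the operators $\{s_i\mid i\in I\}$, $$s_i(f):=\mathbf{1}_{a_i}\cdot\left(\frac{dm\circ\theta}{dm}\right)^{1/2}\cdot f\circ\theta,\qquad f\in L^2(\Omega,m).$$ If the incidence matrix $A$ is irreducible, then $\mathcal{O}_A$ is $*$-isomorphic to $\mathcal{R}_A(m)$.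
   Context: Markov fibred system: $\Omega$ is a Polish space, $m$ a finite Borel measure on $\Omega$, $\theta:\Omega\to\Omega$ a locally invertible non-singular transformation, and $\alpha$ a countable partition of $\Omega$ (a Markov partition) such that $\theta:a\to\theta(a)$ is invertible for all $a\in\alpha$, $\theta(a)$ is contained in the $\sigma$-algebra generated by $\alpha$ for all $a\in\alpha$, and the $\sigma$-algebra generated by $\{\alpha^n:=\bigvee_{k=0}^{n-1}\theta^{-k}(\alpha)\mid n\in\mathbb{N}\}$ coincides with the Borel $\sigma$-algebra of $\Omega$ up to sets of measure zero. Here $\frac{dm\circ\theta}{dm}$ is the Radon--Nikodym derivative, computed on each $a\in\alpha$, of $E\mapsto m(\theta(E))$, $E\subset a$, with respect to $m$. Incidence matrix arising from $\theta$: $a_{ij}=1$ if $a_j\subset\theta(a_i)$ and $a_{ij}=0$ otherwise (up to null sets). The index set $I$ is finite with at least $2$ elements, and $A$ is a matrix with entries in $\{0,1\}$ having at least one entry equal to $1$ in each row and each column. Cuntz--Krieger algebra: $\mathcal{O}_A$ is the universal $C^*$-algebra generated by partial isometries $\{S_i\mid i\in I\}$ of a separable complex Hilbert space satisfying $\sum_{j\in I}S_jS_j^*=1$ and $S_i^*S_i=\sum_{j\in I}a_{ij}S_jS_j^*$ for all $i\in I$.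
   Formalization: The incidence matrix A is additionally assumed not to be a permutation matrix (and m nonzero); for irreducible permutation matrices the claim fails, e.g. the swap on two points gives M_2(C) instead of O_A = M_2(C(T)). *)

theory Defs
  imports "HOL-Analysis.Analysis" "HOL-Combinatorics.Permutations" "HOL-Algebra.QuotRing" "HOL-Algebra.Module"
begin

text \<open>
  C*-algebras are carrier-based records in the style of HOL-Algebra; scalars are complex numbers.
\<close>

record 'x cstar_alg = "(complex, 'x) module" +
  star :: "'x \<Rightarrow> 'x"
  cnorm :: "'x \<Rightarrow> real"

definition closed_star_subalgebra :: "('x, 'r) cstar_alg_scheme \<Rightarrow> 'x set \<Rightarrow> bool" where
  "closed_star_subalgebra B C \<longleftrightarrow>
     C \<subseteq> carrier B \<and> \<zero>\<^bsub>B\<^esub> \<in> C \<and>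
     (\<forall>x\<in>C. \<forall>y\<in>C. x \<oplus>\<^bsub>B\<^esub> y \<in> C \<and> x \<otimes>\<^bsub>B\<^esub> y \<in> C) \<and>
     (\<forall>c. \<forall>x\<in>C. c \<odot>\<^bsub>B\<^esub> x \<in> C) \<and>
     (\<forall>x\<in>C. star B x \<in> C) \<and>
     (\<forall>F x. (\<forall>n. F n \<in> C) \<and> x \<in> carrier B \<and>
        (\<lambda>n::nat. cnorm B (F n \<ominus>\<^bsub>B\<^esub> x)) \<longlonglongrightarrow> 0 \<longrightarrow> x \<in> C)"

definition generated_cstar_algebra ::
    "('x, 'r) cstar_alg_scheme \<Rightarrow> 'x set \<Rightarrow> ('x, 'r) cstar_alg_scheme" where
  "generated_cstar_algebra B X =
     B\<lparr>carrier := {x \<in> carrier B. \<forall>C. closed_star_subalgebra B C \<and> X \<subseteq> C \<longrightarrow> x \<in> C}\<rparr>"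

definition star_isomorphic ::
    "('x, 'r) cstar_alg_scheme \<Rightarrow> ('y, 's) cstar_alg_scheme \<Rightarrow> bool" where
  "star_isomorphic B C \<longleftrightarrow>
     (\<exists>h \<in> ring_iso B C.
        (\<forall>c. \<forall>x\<in>carrier B. h (c \<odot>\<^bsub>B\<^esub> x) = c \<odot>\<^bsub>C\<^esub> h x) \<and>
        (\<forall>x\<in>carrier B. h (star B x) = star C (h x)))"

definition bounded_product :: "'k set \<Rightarrow> 'x cstar_alg \<Rightarrow> ('k \<Rightarrow> 'x) cstar_alg" where
  "bounded_product K B =
     \<lparr>carrier = {F \<in> K \<rightarrow>\<^sub>E carrier B. bdd_above ((\<lambda>k. cnorm B (F k)) ` K)},
      mult = (\<lambda>F G. \<lambda>k\<in>K. F k \<otimes>\<^bsub>B\<^esub> G k),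
      one = (\<lambda>k\<in>K. \<one>\<^bsub>B\<^esub>),
      zero = (\<lambda>k\<in>K. \<zero>\<^bsub>B\<^esub>),
      add = (\<lambda>F G. \<lambda>k\<in>K. F k \<oplus>\<^bsub>B\<^esub> G k),
      smult = (\<lambda>c F. \<lambda>k\<in>K. c \<odot>\<^bsub>B\<^esub> F k),
      star = (\<lambda>F. \<lambda>k\<in>K. star B (F k)),
      cnorm = (\<lambda>F. SUP k\<in>K. cnorm B (F k))\<rparr>"


definition L2_class :: "'a measure \<Rightarrow> ('a \<Rightarrow> complex) \<Rightarrow> ('a \<Rightarrow> complex) set" where
  "L2_class M f = {g \<in> borel_measurable M. AE x in M. g x = f x}"

definition L2 :: "'a measure \<Rightarrow> ('a \<Rightarrow> complex) set set" where
  "L2 M = L2_class M ` {f \<in> borel_measurable M. integrable M (\<lambda>x. (norm (f x))\<^sup>2)}"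

definition L2_rep :: "('a \<Rightarrow> complex) set \<Rightarrow> 'a \<Rightarrow> complex" where
  "L2_rep X = (SOME f. f \<in> X)"

definition L2_add ::
    "'a measure \<Rightarrow> ('a \<Rightarrow> complex) set \<Rightarrow> ('a \<Rightarrow> complex) set \<Rightarrow> ('a \<Rightarrow> complex) set" where
  "L2_add M X Y = L2_class M (\<lambda>x. L2_rep X x + L2_rep Y x)"

definition L2_scale ::
    "'a measure \<Rightarrow> complex \<Rightarrow> ('a \<Rightarrow> complex) set \<Rightarrow> ('a \<Rightarrow> complex) set" where
  "L2_scale M c X = L2_class M (\<lambda>x. c * L2_rep X x)"

definition L2_inner ::
    "'a measure \<Rightarrow> ('a \<Rightarrow> complex) set \<Rightarrow> ('a \<Rightarrow> complex) set \<Rightarrow> complex" where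
  "L2_inner M X Y = (LINT x|M. L2_rep X x * cnj (L2_rep Y x))"

definition L2_norm :: "'a measure \<Rightarrow> ('a \<Rightarrow> complex) set \<Rightarrow> real" where
  "L2_norm M X = sqrt (Re (L2_inner M X X))"

type_synonym 'a L2_op = "('a \<Rightarrow> complex) set \<Rightarrow> ('a \<Rightarrow> complex) set"

definition bounded_ops :: "'a measure \<Rightarrow> 'a L2_op set" where
  "bounded_ops M = {T \<in> L2 M \<rightarrow>\<^sub>E L2 M.
     (\<forall>X\<in>L2 M. \<forall>Y\<in>L2 M. T (L2_add M X Y) = L2_add M (T X) (T Y)) \<and>
     (\<forall>c. \<forall>X\<in>L2 M. T (L2_scale M c X) = L2_scale M c (T X)) \<and>
     (\<exists>K. \<forall>X\<in>L2 M. L2_norm M (T X) \<le> K * L2_norm M X)}"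

definition op_adjoint :: "'a measure \<Rightarrow> 'a L2_op \<Rightarrow> 'a L2_op" where
  "op_adjoint M T = (THE S. S \<in> bounded_ops M \<and>
     (\<forall>X\<in>L2 M. \<forall>Y\<in>L2 M. L2_inner M (T X) Y = L2_inner M X (S Y)))"

definition op_norm :: "'a measure \<Rightarrow> 'a L2_op \<Rightarrow> real" where
  "op_norm M T = (SUP X\<in>{X \<in> L2 M. L2_norm M X \<le> 1}. L2_norm M (T X))"

definition op_algebra :: "'a measure \<Rightarrow> 'a L2_op cstar_alg" where
  "op_algebra M =
     \<lparr>carrier = bounded_ops M,
      mult = (\<lambda>S T. \<lambda>X\<in>L2 M. S (T X)),
      one = (\<lambda>X\<in>L2 M. X),
      zero = (\<lambda>X\<in>L2 M. L2_class M (\<lambda>_. 0)),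
      add = (\<lambda>S T. \<lambda>X\<in>L2 M. L2_add M (S X) (T X)),
      smult = (\<lambda>c T. \<lambda>X\<in>L2 M. L2_scale M c (T X)),
      star = op_adjoint M,
      cnorm = op_norm M\<rparr>"


definition zero_one_matrix :: "nat^'i^'i \<Rightarrow> bool" where
  "zero_one_matrix A \<longleftrightarrow>
     (\<forall>i j. A $ i $ j \<in> {0, 1}) \<and> (\<forall>i. \<exists>j. A $ i $ j = 1) \<and> (\<forall>j. \<exists>i. A $ i $ j = 1)"

definition irreducible_matrix :: "nat^'i::finite^'i \<Rightarrow> bool" where
  "irreducible_matrix A \<longleftrightarrow> (\<forall>i j. \<exists>n\<ge>1. (((**) A ^^ n) (mat 1)) $ i $ j > 0)"

text \<open>
  Irreducible matrices that are permutation matrices have to be excluded below: for them the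
  Cuntz--Krieger relations do not determine the generated algebra up to isomorphism. An irreducible
  finite matrix satisfies condition (I) of Cuntz and Krieger iff it is not a permutation matrix.
\<close>

definition permutation_matrix :: "nat^'i^'i \<Rightarrow> bool" where
  "permutation_matrix A \<longleftrightarrow>
     (\<exists>\<pi>. \<pi> permutes UNIV \<and> (\<forall>i j. A $ i $ j = (if j = \<pi> i then 1 else 0)))"

definition partial_isometry :: "('x, 'r) cstar_alg_scheme \<Rightarrow> 'x \<Rightarrow> bool" where
  "partial_isometry B x \<longleftrightarrow> x \<in> carrier B \<and> x \<otimes>\<^bsub>B\<^esub> star B x \<otimes>\<^bsub>B\<^esub> x = x"

definition cuntz_krieger_family ::
    "nat^'i::finite^'i \<Rightarrow> ('x, 'r) cstar_alg_scheme \<Rightarrow> ('i \<Rightarrow> 'x) \<Rightarrow> bool" where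
  "cuntz_krieger_family A B T \<longleftrightarrow>
     (\<forall>i. partial_isometry B (T i)) \<and>
     (\<Oplus>\<^bsub>B\<^esub>j\<in>UNIV. T j \<otimes>\<^bsub>B\<^esub> star B (T j)) = \<one>\<^bsub>B\<^esub> \<and>
     (\<forall>i. star B (T i) \<otimes>\<^bsub>B\<^esub> T i =
        (\<Oplus>\<^bsub>B\<^esub>j\<in>UNIV. of_nat (A $ i $ j) \<odot>\<^bsub>B\<^esub> (T j \<otimes>\<^bsub>B\<^esub> star B (T j))))"

abbreviation ell2_ops :: "nat L2_op cstar_alg" where
  "ell2_ops \<equiv> op_algebra (count_space (UNIV :: nat set))"

text \<open>
  The universal C*-algebra of the Cuntz--Krieger relations, by the usual direct sum construction:
  \<open>S\<^sub>i\<close> is the tuple \<open>(T\<^sub>i)\<^sub>T\<close>, where \<open>T\<close> runs over all families satisfying the relations on the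
  separable Hilbert space \<open>\<ell>\<^sup>2(\<nat>)\<close>, and the algebra is the C*-algebra generated by the \<open>S\<^sub>i\<close>. Every
  nonzero unital separable C*-algebra has a faithful unital representation on \<open>\<ell>\<^sup>2(\<nat>)\<close>, so no family in any
  other nonzero unital C*-algebra is lost.
\<close>

definition ck_families :: "nat^'i::finite^'i \<Rightarrow> ('i \<Rightarrow> nat L2_op) set" where
  "ck_families A = {T. cuntz_krieger_family A ell2_ops T}"

definition ck_generator :: "nat^'i::finite^'i \<Rightarrow> 'i \<Rightarrow> (('i \<Rightarrow> nat L2_op) \<Rightarrow> nat L2_op)" where
  "ck_generator A i = (\<lambda>T\<in>ck_families A. T i)"

definition cuntz_krieger_algebra ::
    "nat^'i::finite^'i \<Rightarrow> (('i \<Rightarrow> nat L2_op) \<Rightarrow> nat L2_op) cstar_alg" where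
  "cuntz_krieger_algebra A =
     generated_cstar_algebra (bounded_product (ck_families A) ell2_ops) (range (ck_generator A))"

lemma cuntz_krieger_algebra_universal:
  assumes "cuntz_krieger_family A ell2_ops T"
  shows "(\<lambda>F. F T) \<in> ring_hom (cuntz_krieger_algebra A) ell2_ops"
    and "F \<in> carrier (cuntz_krieger_algebra A) \<Longrightarrow>
           (c \<odot>\<^bsub>cuntz_krieger_algebra A\<^esub> F) T = c \<odot>\<^bsub>ell2_ops\<^esub> F T"
    and "F \<in> carrier (cuntz_krieger_algebra A) \<Longrightarrow>
           star (cuntz_krieger_algebra A) F T = star ell2_ops (F T)"
    and "ck_generator A i T = T i"
  using assms
  by (auto simp: cuntz_krieger_algebra_def generated_cstar_algebra_def bounded_product_def
      ck_families_def ck_generator_def ring_hom_def)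


text \<open>The partition \<open>\<alpha>\<^sup>n\<close>, possibly together with the empty set.\<close>

definition cylinders :: "('a \<Rightarrow> 'a) \<Rightarrow> ('i \<Rightarrow> 'a set) \<Rightarrow> nat \<Rightarrow> 'a set set" where
  "cylinders \<theta> a n = {\<Inter>k<n. (\<theta> ^^ k) -` a (w k) | w :: nat \<Rightarrow> 'i. True}"

text \<open>
  Sets are compared up to null sets in \<open>markov\<close> and \<open>generating\<close>. The assumption \<open>image_null\<close> is what
  makes the Radon--Nikodym derivative of \<open>E \<mapsto> m (\<theta> E)\<close> on a cell exist.
\<close>

locale markov_fibred_system = finite_measure m
  for m :: "'a::polish_space measure" and \<theta> :: "'a \<Rightarrow> 'a" and a :: "'i::countable \<Rightarrow> 'a set" +
  assumes borel_sets: "sets m = sets borel"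
    and nonzero: "emeasure m UNIV \<noteq> 0"
    and measurable_map: "\<theta> \<in> borel_measurable borel"
    and nonsingular: "\<And>B. B \<in> sets borel \<Longrightarrow> emeasure m (\<theta> -` B) = 0 \<longleftrightarrow> emeasure m B = 0"
    and cell_borel: "\<And>i. a i \<in> sets borel"
    and disjoint: "disjoint_family a"
    and covers: "(\<Union>i. a i) = UNIV"
    and injective: "\<And>i. inj_on \<theta> (a i)"
    and image_borel: "\<And>i E. E \<in> sets borel \<Longrightarrow> E \<subseteq> a i \<Longrightarrow> \<theta> ` E \<in> sets borel"
    and image_null: "\<And>i E. E \<in> sets borel \<Longrightarrow> E \<subseteq> a i \<Longrightarrow> emeasure m E = 0 \<Longrightarrow> emeasure m (\<theta> ` E) = 0"
    and markov: "\<And>i. \<exists>B \<in> sigma_sets UNIV (range a). AE x in m. x \<in> \<theta> ` a i \<longleftrightarrow> x \<in> B"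
    and generating: "\<And>B. B \<in> sets borel \<Longrightarrow>
      \<exists>C \<in> sigma_sets UNIV (\<Union>n. cylinders \<theta> a n). AE x in m. x \<in> B \<longleftrightarrow> x \<in> C"

definition incidence_matrix ::
    "'a measure \<Rightarrow> ('a \<Rightarrow> 'a) \<Rightarrow> ('i \<Rightarrow> 'a set) \<Rightarrow> nat^'i::finite^'i" where
  "incidence_matrix m \<theta> a = (\<chi> i j. if (AE x in m. x \<in> a j \<longrightarrow> x \<in> \<theta> ` a i) then 1 else 0)"

definition cell_image_measure :: "'a measure \<Rightarrow> ('a \<Rightarrow> 'a) \<Rightarrow> 'a set \<Rightarrow> 'a measure" where
  "cell_image_measure m \<theta> c = measure_of (space m) (sets m) (\<lambda>E. emeasure m (\<theta> ` (E \<inter> c)))"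

definition rn_derivative :: "'a measure \<Rightarrow> ('a \<Rightarrow> 'a) \<Rightarrow> ('i \<Rightarrow> 'a set) \<Rightarrow> 'a \<Rightarrow> real" where
  "rn_derivative m \<theta> a x =
     enn2real (RN_deriv m (cell_image_measure m \<theta> (a (THE i. x \<in> a i))) x)"

definition measure_support :: "'a::topological_space measure \<Rightarrow> 'a set" where
  "measure_support m = {x. \<forall>U. open U \<and> x \<in> U \<longrightarrow> emeasure m U \<noteq> 0}"

text \<open>
  The class below does not depend on the versions chosen by \<open>RN_deriv\<close> and \<open>L2_rep\<close>, the latter
  because \<open>\<theta>\<close> is nonsingular.
\<close>

definition rn_operator ::
    "'a measure \<Rightarrow> ('a \<Rightarrow> 'a) \<Rightarrow> ('i \<Rightarrow> 'a set) \<Rightarrow> 'i \<Rightarrow> 'a L2_op" where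
  "rn_operator m \<theta> a i = (\<lambda>X\<in>L2 m. L2_class m (\<lambda>x.
     indicator (a i) x * of_real (sqrt (rn_derivative m \<theta> a x)) * L2_rep X (\<theta> x)))"

definition rn_representation ::
    "'a measure \<Rightarrow> ('a \<Rightarrow> 'a) \<Rightarrow> ('i \<Rightarrow> 'a set) \<Rightarrow> 'a L2_op cstar_alg" where
  "rn_representation m \<theta> a = generated_cstar_algebra (op_algebra m) (range (rn_operator m \<theta> a))"

end

theory Submission
  imports Defs
begin

text \<open>
  Any two families satisfying the Cuntz--Krieger relations on nonzero \<open>L\<^sup>2\<close> spaces give the same norm to
  every noncommutative polynomial \<open>p\<close> in the generators and their adjoints; hence the generated
  C*-algebras are isomorphic. A monomial of degree at most \<open>D\<close> maps \<open>S\<^sub>\<nu> f\<close>, where \<open>\<nu>\<close> is a word of length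
  \<open>D + 1\<close>, to zero or to some \<open>S\<^sub>\<mu> f\<close>, and \<open>\<mu>\<close> depends only on the matrix. So \<open>p\<close> is described by scalar
  matrices \<open>C\<close>, one for each length of \<open>\<mu>\<close> and each common last letter of \<open>\<mu>\<close> and \<open>\<nu>\<close>, and \<open>\<parallel>p\<parallel>\<close> is at
  most their number of lengths times their largest norm. Conversely, each of these norms is at most
  \<open>\<parallel>p\<parallel>\<close>: evaluate \<open>p\<close> on the vectors \<open>S\<^sub>\<nu> S\<^sub>\<gamma> f\<close> for a word \<open>\<gamma>\<close> without short periods, which exists since
  the matrix is irreducible and not a permutation matrix; the absence of periods makes contributions
  of different lengths orthogonal. The norms of \<open>p\<close> in two families thus agree up to a factor
  \<open>2 D + 2\<close>, and the iterated squares \<open>p\<^sub>0 = p\<close>, \<open>p\<^sub>n\<^sub>+\<^sub>1 = p\<^sub>n\<^sup>* p\<^sub>n\<close> remove the factor: their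
  degrees grow linearly in \<open>2\<^sup>n\<close>, while their norms are the \<open>2\<^sup>n\<close>-th powers of \<open>\<parallel>p\<parallel>\<close>.

  The Radon--Nikodym operators are such a family by change of variables, and weighted composition
  operators on \<open>\<ell>\<^sup>2(\<nat>)\<close> show that the relations can be satisfied there.
\<close>

section \<open>The Hilbert space of square integrable functions\<close>

text \<open>A word of length \<open>D + 1\<close> cannot be exhausted by a monomial of degree at
  most \<open>D\<close>: two letters remain before each generator or adjoint acts, enough to decide
  whether the result vanishes, and the last letter is never touched. Hence the scalar matrices split
  into blocks by last letter. The lower bound uses this splitting too: \<open>\<gamma>\<close> must
  start with a successor of the last letter \<open>r\<close>, so the vector on which
  \<open>p\<close> is evaluated is chosen anew for each \<open>r\<close>. Image words have length at
  most \<open>2 D + 1\<close>, whence \<open>2 D + 2\<close> lengths. For a general vector the parts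
  of different length are not orthogonal and are added by the triangle inequality, which is the
  source of the factor; the lower bound excludes periods up to \<open>2 D + 1\<close>, which exceeds
  every difference of lengths. Isometry is compared on polynomials because it extends to closures by
  completeness alone; no kernel of a homomorphism has to be computed. The universal algebra sits in
  a product over all families on the sequence space, where the norm of a polynomial is the supremum
  of a constant. This makes sense only if some family exists there, which is why one is
  constructed.\<close>

definition sq_int :: "'a measure \<Rightarrow> ('a \<Rightarrow> complex) set" where
  "sq_int M = {f \<in> borel_measurable M. integrable M (\<lambda>x. (norm (f x))\<^sup>2)}"

lemma sq_int_measurable [measurable_dest]: "f \<in> sq_int M \<Longrightarrow> f \<in> borel_measurable M"
  and sq_int_integrable: "f \<in> sq_int M \<Longrightarrow> integrable M (\<lambda>x. (norm (f x))\<^sup>2)"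
  by (auto simp: sq_int_def)

lemma borel_measurable_cnj' [measurable (raw)]:
  "f \<in> borel_measurable M \<Longrightarrow> (\<lambda>x. cnj (f x)) \<in> borel_measurable M"
  by (rule borel_measurable_continuous_on[OF continuous_on_cnj[OF continuous_on_id]])

lemma norm_add_sq_le: "(norm (x + y :: complex))\<^sup>2 \<le> 2 * (norm x)\<^sup>2 + 2 * (norm y)\<^sup>2"
proof -
  have "(norm (x + y))\<^sup>2 \<le> (norm x + norm y)\<^sup>2"
    by (simp add: norm_triangle_ineq)
  also have "\<dots> \<le> 2 * (norm x)\<^sup>2 + 2 * (norm y)\<^sup>2"
    using sum_squares_bound[of "norm x" "norm y"] by (simp add: power2_sum)
  finally show ?thesis .
qed

lemma sq_int_dominated:
  assumes "f \<in> borel_measurable M" "integrable M g" "AE x in M. (norm (f x))\<^sup>2 \<le> g x"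
  shows "f \<in> sq_int M"
proof -
  have [measurable]: "f \<in> borel_measurable M" by fact
  have "integrable M (\<lambda>x. (norm (f x))\<^sup>2)"
    by (rule Bochner_Integration.integrable_bound[OF assms(2)])
      (use assms(3) in \<open>auto elim!: eventually_mono\<close>)
  then show ?thesis using assms by (auto simp: sq_int_def)
qed

lemma sq_int_add:
  assumes "f \<in> sq_int M" "g \<in> sq_int M"
  shows "(\<lambda>x. f x + g x) \<in> sq_int M"
proof (rule sq_int_dominated)
  show "integrable M (\<lambda>x. 2 * (norm (f x))\<^sup>2 + 2 * (norm (g x))\<^sup>2)"
    using assms by (intro Bochner_Integration.integrable_add integrable_mult_right)
      (auto dest: sq_int_integrable)
qed (use assms norm_add_sq_le in \<open>auto dest: sq_int_measurable\<close>)

lemma sq_int_scale: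
  assumes "f \<in> sq_int M"
  shows "(\<lambda>x. c * f x) \<in> sq_int M"
proof (rule sq_int_dominated)
  show "integrable M (\<lambda>x. (norm c)\<^sup>2 * (norm (f x))\<^sup>2)"
    using assms by (intro integrable_mult_right) (auto dest: sq_int_integrable)
qed (use assms in \<open>auto dest: sq_int_measurable simp: norm_mult power_mult_distrib\<close>)

lemma sq_int_zero [simp]: "(\<lambda>x. 0) \<in> sq_int M"
  by (auto simp: sq_int_def)

lemma sq_int_sum:
  assumes "finite S" "\<And>i. i \<in> S \<Longrightarrow> f i \<in> sq_int M"
  shows "(\<lambda>x. \<Sum>i\<in>S. f i x) \<in> sq_int M"
  using assms by (induction S) (auto intro: sq_int_add)

lemma sq_int_diff:
  assumes "f \<in> sq_int M" "g \<in> sq_int M"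
  shows "(\<lambda>x. f x - g x) \<in> sq_int M"
  using sq_int_add[OF assms(1) sq_int_scale[OF assms(2), of "-1"]] by simp

lemma sq_int_mult_integrable:
  assumes "f \<in> sq_int M" "g \<in> sq_int M"
  shows "integrable M (\<lambda>x. f x * cnj (g x))"
proof (rule Bochner_Integration.integrable_bound)
  show "integrable M (\<lambda>x. (norm (f x))\<^sup>2 + (norm (g x))\<^sup>2)"
    using assms by (intro Bochner_Integration.integrable_add) (auto dest: sq_int_integrable)
  have [measurable]: "f \<in> borel_measurable M" "g \<in> borel_measurable M"
    using assms by (auto dest: sq_int_measurable)
  show "(\<lambda>x. f x * cnj (g x)) \<in> borel_measurable M" by measurable
  have "norm (a * cnj b) \<le> norm ((norm a)\<^sup>2 + (norm b)\<^sup>2)" for a b :: complex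
  proof -
    have "2 * (norm a * norm b) \<le> (norm a)\<^sup>2 + (norm b)\<^sup>2"
      using sum_squares_bound[of "norm a" "norm b"] by (simp add: mult.assoc)
    moreover have "0 \<le> norm a * norm b" by simp
    ultimately show ?thesis unfolding norm_mult complex_mod_cnj real_norm_def by linarith
  qed
  then show "AE x in M. norm (f x * cnj (g x)) \<le> norm ((norm (f x))\<^sup>2 + (norm (g x))\<^sup>2)"
    by simp
qed

lemma L2_class_eq_iff:
  assumes "f \<in> borel_measurable M" "g \<in> borel_measurable M"
  shows "L2_class M f = L2_class M g \<longleftrightarrow> (AE x in M. f x = g x)"
proof
  assume "L2_class M f = L2_class M g"
  moreover have "f \<in> L2_class M f" using assms by (simp add: L2_class_def)
  ultimately have "f \<in> L2_class M g" by simp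
  then show "AE x in M. f x = g x" by (simp add: L2_class_def)
next
  assume ae: "AE x in M. f x = g x"
  have "(AE x in M. h x = f x) \<longleftrightarrow> (AE x in M. h x = g x)" for h
    using ae by (auto elim: AE_mp)
  then show "L2_class M f = L2_class M g" by (simp add: L2_class_def)
qed

lemma L2_eq: "L2 M = L2_class M ` sq_int M"
  by (simp add: L2_def sq_int_def)

lemma L2_class_in [simp]: "f \<in> sq_int M \<Longrightarrow> L2_class M f \<in> L2 M"
  by (simp add: L2_eq)

lemma L2_rep_class:
  assumes "f \<in> borel_measurable M"
  shows "L2_rep (L2_class M f) \<in> borel_measurable M"
    and "AE x in M. L2_rep (L2_class M f) x = f x"
proof -
  have "f \<in> L2_class M f" using assms by (simp add: L2_class_def)
  then have "L2_rep (L2_class M f) \<in> L2_class M f"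
    unfolding L2_rep_def by (rule someI[of "\<lambda>g. g \<in> L2_class M f"])
  then show "L2_rep (L2_class M f) \<in> borel_measurable M"
    and "AE x in M. L2_rep (L2_class M f) x = f x"
    by (auto simp: L2_class_def)
qed

lemma L2_rep_sq_int:
  assumes "X \<in> L2 M"
  shows "L2_rep X \<in> sq_int M"
proof -
  obtain f where f: "f \<in> sq_int M" "X = L2_class M f" using assms by (auto simp: L2_eq)
  have m: "f \<in> borel_measurable M" using f by (simp add: sq_int_measurable)
  show ?thesis
  proof (rule sq_int_dominated)
    show "integrable M (\<lambda>x. (norm (f x))\<^sup>2)" using f by (simp add: sq_int_integrable)
  qed (use L2_rep_class[OF m] f in \<open>auto elim!: eventually_mono\<close>)
qed

lemma L2_class_rep [simp]:
  assumes "X \<in> L2 M"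
  shows "L2_class M (L2_rep X) = X"
proof -
  obtain f where f: "f \<in> sq_int M" "X = L2_class M f" using assms by (auto simp: L2_eq)
  have m: "f \<in> borel_measurable M" using f by (simp add: sq_int_measurable)
  show ?thesis using L2_rep_class[OF m] L2_class_eq_iff[of "L2_rep X" M f] f m by auto
qed

lemma L2_inner_class:
  assumes "f \<in> sq_int M" "g \<in> sq_int M"
  shows "L2_inner M (L2_class M f) (L2_class M g) = (LINT x|M. f x * cnj (g x))"
proof -
  have f [measurable]: "f \<in> borel_measurable M" and g [measurable]: "g \<in> borel_measurable M"
    using assms by (auto dest: sq_int_measurable)
  note r = L2_rep_class[OF f] L2_rep_class[OF g]
  have [measurable]: "L2_rep (L2_class M f) \<in> borel_measurable M" 
    "L2_rep (L2_class M g) \<in> borel_measurable M" using r by auto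
  show ?thesis unfolding L2_inner_def
  proof (rule integral_cong_AE)
    show "AE x in M. L2_rep (L2_class M f) x * cnj (L2_rep (L2_class M g) x) = f x * cnj (g x)"
      using r(2,4) by eventually_elim simp
  qed measurable
qed

text \<open>The sum is formed on representatives instead of iterating \<open>L2_add\<close>:
  \<open>L2_matrix_amplification\<close> integrates this pointwise formula.\<close>

definition L2_lincomb where
  "L2_lincomb M S c X = L2_class M (\<lambda>x. \<Sum>i\<in>S. c i * L2_rep (X i) x)"

abbreviation L2_zero where "L2_zero M \<equiv> L2_class M (\<lambda>_. 0)"

lemma L2_add_in [simp]: "X \<in> L2 M \<Longrightarrow> Y \<in> L2 M \<Longrightarrow> L2_add M X Y \<in> L2 M"
  by (simp add: L2_add_def L2_rep_sq_int sq_int_add)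

lemma L2_scale_in [simp]: "X \<in> L2 M \<Longrightarrow> L2_scale M c X \<in> L2 M"
  by (simp add: L2_scale_def L2_rep_sq_int sq_int_scale)

lemma L2_zero_in [simp]: "L2_zero M \<in> L2 M"
  by simp

lemma L2_lincomb_in [simp]:
  "finite S \<Longrightarrow> (\<And>i. i \<in> S \<Longrightarrow> X i \<in> L2 M) \<Longrightarrow> L2_lincomb M S c X \<in> L2 M"
  by (simp add: L2_lincomb_def L2_rep_sq_int sq_int_scale sq_int_sum)

lemma L2_inner_add_left [simp]:
  assumes "X \<in> L2 M" "Y \<in> L2 M" "Z \<in> L2 M"
  shows "L2_inner M (L2_add M X Y) Z = L2_inner M X Z + L2_inner M Y Z"
proof -
  note s = assms[THEN L2_rep_sq_int]
  have "L2_inner M (L2_add M X Y) Z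
      = (LINT x|M. (L2_rep X x + L2_rep Y x) * cnj (L2_rep Z x))"
    using L2_inner_class[OF sq_int_add[OF s(1,2)] s(3)] assms by (simp add: L2_add_def)
  also have "\<dots> = (LINT x|M. L2_rep X x * cnj (L2_rep Z x) + L2_rep Y x * cnj (L2_rep Z x))"
    by (simp add: distrib_right)
  also have "\<dots> = L2_inner M X Z + L2_inner M Y Z"
    unfolding L2_inner_def using s by (intro Bochner_Integration.integral_add sq_int_mult_integrable)
  finally show ?thesis .
qed

lemma L2_inner_scale_left [simp]:
  assumes "X \<in> L2 M" "Z \<in> L2 M"
  shows "L2_inner M (L2_scale M c X) Z = c * L2_inner M X Z"
proof -
  note s = assms[THEN L2_rep_sq_int]
  have "L2_inner M (L2_scale M c X) Z = (LINT x|M. (c * L2_rep X x) * cnj (L2_rep Z x))"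
    using L2_inner_class[OF sq_int_scale[OF s(1)] s(2)] assms by (simp add: L2_scale_def)
  then show ?thesis by (simp add: L2_inner_def mult.assoc)
qed

lemma L2_inner_zero_left [simp]:
  assumes "Z \<in> L2 M"
  shows "L2_inner M (L2_zero M) Z = 0"
  using L2_inner_class[OF sq_int_zero L2_rep_sq_int[OF assms]] assms by simp

lemma L2_inner_lincomb_left [simp]:
  assumes "finite S" "\<And>i. i \<in> S \<Longrightarrow> X i \<in> L2 M" "Z \<in> L2 M"
  shows "L2_inner M (L2_lincomb M S c X) Z = (\<Sum>i\<in>S. c i * L2_inner M (X i) Z)"
proof -
  have s: "\<And>i. i \<in> S \<Longrightarrow> L2_rep (X i) \<in> sq_int M" "L2_rep Z \<in> sq_int M"
    using assms by (auto simp: L2_rep_sq_int)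
  have "L2_inner M (L2_lincomb M S c X) Z
      = (LINT x|M. (\<Sum>i\<in>S. c i * L2_rep (X i) x) * cnj (L2_rep Z x))"
    using L2_inner_class[OF sq_int_sum[OF assms(1) sq_int_scale[OF s(1)]] s(2)] assms
    by (simp add: L2_lincomb_def)
  also have "\<dots> = (LINT x|M. (\<Sum>i\<in>S. c i * (L2_rep (X i) x * cnj (L2_rep Z x))))"
    by (simp add: sum_distrib_right mult.assoc)
  also have "\<dots> = (\<Sum>i\<in>S. c i * L2_inner M (X i) Z)"
    unfolding L2_inner_def using s
    by (subst Bochner_Integration.integral_sum)
      (auto intro!: integrable_mult_right sq_int_mult_integrable)
  finally show ?thesis .
qed

lemma L2_inner_commute:
  "L2_inner M X Y = cnj (L2_inner M Y X)"
  unfolding L2_inner_def Bochner_Integration.integral_cnj[symmetric] by (simp add: mult.commute)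

lemma L2_inner_add_right [simp]:
  assumes "X \<in> L2 M" "Y \<in> L2 M" "Z \<in> L2 M"
  shows "L2_inner M Z (L2_add M X Y) = L2_inner M Z X + L2_inner M Z Y"
  using assms by (subst (1 2 3) L2_inner_commute) simp

lemma L2_inner_scale_right [simp]:
  assumes "X \<in> L2 M" "Z \<in> L2 M"
  shows "L2_inner M Z (L2_scale M c X) = cnj c * L2_inner M Z X"
  using assms by (subst (1 2) L2_inner_commute) simp

lemma L2_inner_zero_right [simp]:
  assumes "Z \<in> L2 M"
  shows "L2_inner M Z (L2_zero M) = 0"
  using assms by (subst L2_inner_commute) simp

lemma L2_inner_lincomb_right [simp]:
  assumes "finite S" "\<And>i. i \<in> S \<Longrightarrow> X i \<in> L2 M" "Z \<in> L2 M"
  shows "L2_inner M Z (L2_lincomb M S c X) = (\<Sum>i\<in>S. cnj (c i) * L2_inner M Z (X i))"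
proof -
  have "L2_inner M Z (L2_lincomb M S c X) = cnj (\<Sum>i\<in>S. c i * L2_inner M (X i) Z)"
    using assms by (subst L2_inner_commute) simp
  also have "\<dots> = (\<Sum>i\<in>S. cnj (c i) * L2_inner M Z (X i))"
    by (simp add: L2_inner_commute[of M Z])
  finally show ?thesis .
qed

lemma L2_inner_self:
  "L2_inner M X X = of_real (LINT x|M. (norm (L2_rep X x))\<^sup>2)"
proof -
  have "L2_inner M X X = (LINT x|M. of_real ((norm (L2_rep X x))\<^sup>2))"
    by (simp only: L2_inner_def complex_norm_square)
  then show ?thesis by (simp only: integral_complex_of_real)
qed

lemma L2_norm_sq: "(L2_norm M X)\<^sup>2 = (LINT x|M. (norm (L2_rep X x))\<^sup>2)"
  by (simp add: L2_norm_def L2_inner_self)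

lemma L2_inner_self_norm: "L2_inner M X X = of_real ((L2_norm M X)\<^sup>2)"
  by (simp add: L2_inner_self L2_norm_sq)

lemma L2_norm_nonneg [simp]: "0 \<le> L2_norm M X"
  by (simp add: L2_norm_def L2_inner_self)

lemma L2_norm_sqI: "L2_inner M X X = of_real r \<Longrightarrow> (L2_norm M X)\<^sup>2 = r"
  by (simp only: L2_inner_self_norm of_real_eq_iff)

lemma L2_norm_zero [simp]: "L2_norm M (L2_zero M) = 0"
  by (simp add: L2_norm_def)

text \<open>Cancels one factor of \<open>L2_norm M X\<close> from the square. Duality arguments,
  which estimate \<open>L2_inner M X X\<close> by Cauchy-Schwarz, end in this form.\<close>

lemma L2_norm_leI:
  assumes "c \<ge> 0" "norm (L2_inner M X X) \<le> c * L2_norm M X"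
  shows "L2_norm M X \<le> c"
proof (cases "L2_norm M X = 0")
  case False
  have "norm (L2_inner M X X) = L2_norm M X * L2_norm M X"
    unfolding L2_inner_self_norm norm_of_real by (simp add: power2_eq_square)
  then show ?thesis using False assms(2) by (simp add: mult_le_cancel_right less_le)
qed (use assms in simp)

lemma L2_norm_zero_iff:
  assumes "X \<in> L2 M"
  shows "L2_norm M X = 0 \<longleftrightarrow> X = L2_zero M"
proof
  note s = L2_rep_sq_int[OF assms]
  assume "L2_norm M X = 0"
  then have "(LINT x|M. (norm (L2_rep X x))\<^sup>2) = 0" using L2_norm_sq[of M X] by simp
  then have "AE x in M. (norm (L2_rep X x))\<^sup>2 = 0"
    using integral_nonneg_eq_0_iff_AE[OF sq_int_integrable[OF s]] by simp
  then have "L2_class M (L2_rep X) = L2_zero M"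
    using s by (subst L2_class_eq_iff) (auto dest: sq_int_measurable)
  then show "X = L2_zero M" using assms by simp
next
  assume "X = L2_zero M"
  then show "L2_norm M X = 0" by (simp add: L2_norm_def)
qed

definition L2_diff where "L2_diff M X Y = L2_add M X (L2_scale M (-1) Y)"

lemma L2_diff_in [simp]: "X \<in> L2 M \<Longrightarrow> Y \<in> L2 M \<Longrightarrow> L2_diff M X Y \<in> L2 M"
  by (simp add: L2_diff_def)

lemma L2_inner_diff_left [simp]:
  "X \<in> L2 M \<Longrightarrow> Y \<in> L2 M \<Longrightarrow> Z \<in> L2 M \<Longrightarrow>
    L2_inner M (L2_diff M X Y) Z = L2_inner M X Z - L2_inner M Y Z"
  by (simp add: L2_diff_def)

lemma L2_inner_diff_right [simp]:
  "X \<in> L2 M \<Longrightarrow> Y \<in> L2 M \<Longrightarrow> Z \<in> L2 M \<Longrightarrow>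
    L2_inner M Z (L2_diff M X Y) = L2_inner M Z X - L2_inner M Z Y"
  by (simp add: L2_diff_def)

lemma L2_diff_class:
  assumes "f \<in> sq_int M" "g \<in> sq_int M"
  shows "L2_diff M (L2_class M f) (L2_class M g) = L2_class M (\<lambda>x. f x - g x)"
proof -
  have "f \<in> borel_measurable M" "g \<in> borel_measurable M"
    using assms by (auto dest: sq_int_measurable)
  note [measurable] = this
  let ?h = "\<lambda>x. - 1 * L2_rep (L2_class M g) x"
  note f = L2_rep_class[OF \<open>f \<in> borel_measurable M\<close>]
    and g = L2_rep_class[OF \<open>g \<in> borel_measurable M\<close>]
  have [measurable]: "L2_rep (L2_class M f) \<in> borel_measurable M"
    "L2_rep (L2_class M g) \<in> borel_measurable M" by fact+
  have h: "?h \<in> borel_measurable M" by measurable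
  have [measurable]: "L2_rep (L2_class M ?h) \<in> borel_measurable M"
    by (rule L2_rep_class[OF h])
  have m: "(\<lambda>x. L2_rep (L2_class M f) x + L2_rep (L2_class M ?h) x) \<in> borel_measurable M"
    "(\<lambda>x. f x - g x) \<in> borel_measurable M" by measurable
  have "AE x in M. L2_rep (L2_class M f) x + L2_rep (L2_class M ?h) x = f x - g x"
    using f(2) g(2) L2_rep_class(2)[OF h] by eventually_elim simp
  then show ?thesis unfolding L2_diff_def L2_add_def L2_scale_def
    by (rule L2_class_eq_iff[OF m, THEN iffD2])
qed

text \<open>Testing against the difference of the two sides gives norm zero. Most vector identities
  below are proved this way, since inner products turn them into identities of complex
  numbers.\<close>

lemma L2_eqI:
  assumes "X \<in> L2 M" "Y \<in> L2 M"
    and "\<And>Z. Z \<in> L2 M \<Longrightarrow> L2_inner M X Z = L2_inner M Y Z"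
  shows "X = Y"
proof -
  have "L2_inner M (L2_diff M X Y) (L2_diff M X Y) = 0"
    using assms by simp
  then have "L2_norm M (L2_diff M X Y) = 0" by (simp add: L2_norm_def)
  then have "L2_diff M X Y = L2_zero M" using assms by (subst (asm) L2_norm_zero_iff) auto
  then have "L2_class M (\<lambda>x. L2_rep X x - L2_rep Y x) = L2_zero M"
    using L2_diff_class[OF assms(1,2)[THEN L2_rep_sq_int]] assms by simp
  moreover note m[measurable] = assms(1,2)[THEN L2_rep_sq_int, THEN sq_int_measurable]
  ultimately have "AE x in M. L2_rep X x - L2_rep Y x = 0"
    by (subst (asm) L2_class_eq_iff) auto
  then have "L2_class M (L2_rep X) = L2_class M (L2_rep Y)"
    by (subst L2_class_eq_iff) auto
  then show ?thesis using assms by simp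
qed

section \<open>Cauchy-Schwarz and the geometry of the norm\<close>

lemma Re_L2_inner_self: "Re (L2_inner M X X) = (L2_norm M X)\<^sup>2"
  by (simp add: L2_inner_self_norm)

lemma L2_cauchy_schwarz:
  assumes X: "X \<in> L2 M" and Y: "Y \<in> L2 M"
  shows "norm (L2_inner M X Y) \<le> L2_norm M X * L2_norm M Y"
proof (cases "L2_norm M Y = 0")
  case True
  then show ?thesis using X Y by (simp add: L2_norm_zero_iff)
next
  case False
  define s where "s = (L2_norm M Y)\<^sup>2"
  have s: "s > 0" using False by (simp add: s_def)
  define w where "w = L2_inner M X Y"
  \<comment> \<open>The component of \<open>X\<close> orthogonal to \<open>Y\<close>; its squared
    norm is nonnegative.\<close>
  define Z where "Z = L2_diff M X (L2_scale M (w / of_real s) Y)"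
  have yy: "L2_inner M Y Y = of_real s" "L2_inner M Y X = cnj w"
    unfolding s_def w_def by (rule L2_inner_self_norm, rule L2_inner_commute)
  have "L2_inner M Z Z = L2_inner M X X - w * cnj w / of_real s"
    using X Y s unfolding Z_def by (simp add: yy w_def[symmetric])
  then have "L2_inner M Z Z = of_real ((L2_norm M X)\<^sup>2) - w * cnj w / of_real s"
    by (simp only: L2_inner_self_norm)
  then have "Re (L2_inner M Z Z) = (L2_norm M X)\<^sup>2 - (norm w)\<^sup>2 / s"
    by (simp flip: complex_norm_square of_real_power of_real_divide of_real_diff)
  then have "(norm w)\<^sup>2 / s \<le> (L2_norm M X)\<^sup>2"
    by (simp add: Re_L2_inner_self) (metis diff_ge_0_iff_ge zero_le_power2)
  then have "(norm w)\<^sup>2 \<le> (L2_norm M X * L2_norm M Y)\<^sup>2"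
    using s by (simp add: pos_divide_le_eq power_mult_distrib s_def)
  then show ?thesis unfolding w_def by (rule power2_le_imp_le) simp
qed

lemma L2_norm_scale [simp]:
  assumes "X \<in> L2 M"
  shows "L2_norm M (L2_scale M c X) = norm c * L2_norm M X"
proof -
  have "L2_inner M (L2_scale M c X) (L2_scale M c X) = (c * cnj c) * L2_inner M X X"
    using assms by (simp add: mult.assoc)
  also have "\<dots> = of_real ((norm c * L2_norm M X)\<^sup>2)"
    by (simp only: complex_norm_square[symmetric] L2_inner_self_norm power_mult_distrib of_real_mult)
  finally have "(L2_norm M (L2_scale M c X))\<^sup>2 = (norm c * L2_norm M X)\<^sup>2"
    by (rule L2_norm_sqI)
  then show ?thesis by simp
qed

lemma L2_norm_add_sq:
  assumes "X \<in> L2 M" "Y \<in> L2 M"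
  shows "(L2_norm M (L2_add M X Y))\<^sup>2 = (L2_norm M X)\<^sup>2 + (L2_norm M Y)\<^sup>2 + 2 * Re (L2_inner M X Y)"
  using assms by (simp flip: Re_L2_inner_self add: L2_inner_commute[of M Y X])

lemma L2_norm_diff_sq:
  assumes "X \<in> L2 M" "Y \<in> L2 M"
  shows "(L2_norm M (L2_diff M X Y))\<^sup>2 = (L2_norm M X)\<^sup>2 + (L2_norm M Y)\<^sup>2 - 2 * Re (L2_inner M X Y)"
  using assms by (simp flip: Re_L2_inner_self add: L2_inner_commute[of M Y X])

lemma L2_triangle:
  assumes "X \<in> L2 M" "Y \<in> L2 M"
  shows "L2_norm M (L2_add M X Y) \<le> L2_norm M X + L2_norm M Y"
proof (rule power2_le_imp_le)
  have "Re (L2_inner M X Y) \<le> L2_norm M X * L2_norm M Y"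
    using L2_cauchy_schwarz[OF assms] complex_Re_le_cmod[of "L2_inner M X Y"] by linarith
  then show "(L2_norm M (L2_add M X Y))\<^sup>2 \<le> (L2_norm M X + L2_norm M Y)\<^sup>2"
    using assms by (simp add: L2_norm_add_sq power2_sum)
qed simp

lemma L2_diff_triangle:
  assumes "X \<in> L2 M" "Y \<in> L2 M" "Z \<in> L2 M"
  shows "L2_norm M (L2_diff M X Z) \<le> L2_norm M (L2_diff M X Y) + L2_norm M (L2_diff M Y Z)"
proof -
  have "L2_diff M X Z = L2_add M (L2_diff M X Y) (L2_diff M Y Z)"
    using assms by (intro L2_eqI[where M = M]) auto
  then show ?thesis
    using L2_triangle[of "L2_diff M X Y" M "L2_diff M Y Z"] assms by simp
qed

lemma L2_norm_diff_commute:
  assumes "X \<in> L2 M" "Y \<in> L2 M"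
  shows "L2_norm M (L2_diff M X Y) = L2_norm M (L2_diff M Y X)"
proof -
  have "(L2_norm M (L2_diff M X Y))\<^sup>2 = (L2_norm M (L2_diff M Y X))\<^sup>2"
    using assms by (simp add: L2_norm_diff_sq L2_inner_commute[of M Y X])
  then show ?thesis by simp
qed

lemma L2_norm_class:
  assumes "f \<in> sq_int M"
  shows "(L2_norm M (L2_class M f))\<^sup>2 = (LINT x|M. (norm (f x))\<^sup>2)"
proof (rule L2_norm_sqI)
  have "L2_inner M (L2_class M f) (L2_class M f) = (LINT x|M. f x * cnj (f x))"
    by (rule L2_inner_class[OF assms assms])
  also have "\<dots> = of_real (LINT x|M. (norm (f x))\<^sup>2)"
    by (simp only: complex_norm_square[symmetric] integral_complex_of_real)
  finally show "L2_inner M (L2_class M f) (L2_class M f) = of_real (LINT x|M. (norm (f x))\<^sup>2)" .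
qed

section \<open>Completeness\<close>

lemma L2_norm_class_nn:
  assumes "f \<in> sq_int M"
  shows "(\<integral>\<^sup>+x. ennreal ((norm (f x))\<^sup>2) \<partial>M) = ennreal ((L2_norm M (L2_class M f))\<^sup>2)"
  unfolding L2_norm_class[OF assms]
  by (rule nn_integral_eq_integral) (use assms in \<open>auto dest: sq_int_integrable\<close>)

lemma sq_int_iff_nn:
  "f \<in> sq_int M \<longleftrightarrow> f \<in> borel_measurable M \<and> (\<integral>\<^sup>+x. ennreal ((norm (f x))\<^sup>2) \<partial>M) < \<infinity>"
  unfolding sq_int_def by (auto simp: integrable_iff_bounded)

lemma L2_norm_class_le:
  assumes "f \<in> borel_measurable M" "(\<integral>\<^sup>+x. ennreal ((norm (f x))\<^sup>2) \<partial>M) \<le> ennreal (e\<^sup>2)" "e \<ge> 0"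
  shows "f \<in> sq_int M" "L2_norm M (L2_class M f) \<le> e"
proof -
  show f: "f \<in> sq_int M"
    unfolding sq_int_iff_nn using assms by (auto intro: le_less_trans)
  have "(L2_norm M (L2_class M f))\<^sup>2 \<le> e\<^sup>2"
    using assms(2) unfolding L2_norm_class_nn[OF f] by simp
  then show "L2_norm M (L2_class M f) \<le> e" using assms(3) by (rule power2_le_imp_le)
qed

text \<open>Each weighted term is at most the total \<open>C\<close>, so the increments are at most
  \<open>sqrt C * (1/2) ^ k\<close> and the telescoping series converges absolutely.\<close>

lemma convergent_of_weighted_sum_finite:
  fixes f :: "nat \<Rightarrow> complex"
  assumes "(\<Sum>k. ennreal (4 ^ k * (norm (f (Suc k) - f k))\<^sup>2)) \<noteq> \<infinity>"
  shows "convergent f"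
proof -
  define u where "u k = ennreal (4 ^ k * (norm (f (Suc k) - f k))\<^sup>2)" for k
  have "suminf u \<noteq> \<infinity>" using assms unfolding u_def .
  then obtain C where C': "suminf u = ennreal C" "C \<ge> 0"
    by (cases "suminf u") auto
  have C: "4 ^ k * (norm (f (Suc k) - f k))\<^sup>2 \<le> C" for k
  proof -
    have "u k \<le> suminf u"
      using sum_le_suminf[of u "{k}"] by simp
    then show ?thesis unfolding C'(1) unfolding u_def using C'(2) by (simp only: ennreal_le_iff)
  qed
  have *: "norm (f (Suc k) - f k) \<le> sqrt C * (1/2) ^ k" for k
  proof -
    have "(2 ^ k * norm (f (Suc k) - f k))\<^sup>2 = ((2 ^ k)\<^sup>2) * (norm (f (Suc k) - f k))\<^sup>2"
      by (rule power_mult_distrib)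
    also have "(2 ^ k)\<^sup>2 = (4 ^ k :: real)"
      by (metis power_mult mult.commute power2_eq_square numeral_Bit0 numeral_times_numeral
          mult_2 numeral_One)
    finally have "(2 ^ k * norm (f (Suc k) - f k))\<^sup>2 \<le> C" using C[of k] by simp
    then have "2 ^ k * norm (f (Suc k) - f k) \<le> sqrt C" by (simp add: real_le_rsqrt)
    then show ?thesis by (simp add: field_simps)
  qed
  have "summable (\<lambda>k. sqrt C * (1/2) ^ k)"
    by (rule summable_mult) (rule summable_geometric, simp)
  then have "summable (\<lambda>k. f (Suc k) - f k)"
    by (rule summable_comparison_test'[where N = 0]) (rule *)
  then have "(\<lambda>n. \<Sum>k<n. f (Suc k) - f k) \<longlonglongrightarrow> (\<Sum>k. f (Suc k) - f k)"
    by (rule summable_LIMSEQ)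
  then have "(\<lambda>n. (f n - f 0) + f 0) \<longlonglongrightarrow> (\<Sum>k. f (Suc k) - f k) + f 0"
    by (intro tendsto_add) (auto simp: sum_lessThan_telescope)
  then show ?thesis by (auto simp: convergent_def)
qed

text \<open>The Riesz-Fischer argument: a fast subsequence converges almost everywhere, and Fatou's
  lemma turns the Cauchy estimate into an estimate of the distance to the pointwise limit.\<close>

lemma L2_complete:
  assumes X: "\<And>n. X n \<in> L2 M"
    and cauchy: "\<And>e. e > 0 \<Longrightarrow> \<exists>N. \<forall>m\<ge>N. \<forall>n\<ge>N. L2_norm M (L2_diff M (X m) (X n)) \<le> e"
  shows "\<exists>Y\<in>L2 M. (\<lambda>n. L2_norm M (L2_diff M (X n) Y)) \<longlonglongrightarrow> 0"
proof -
  \<comment> \<open>Distances \<open>(1/4) ^ k\<close> have squares \<open>(1/16) ^ k\<close>, which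
    remain summable after multiplication by the weight \<open>4 ^ k\<close>.\<close>
  have "\<forall>k. \<exists>N. \<forall>m\<ge>N. \<forall>n\<ge>N. L2_norm M (L2_diff M (X m) (X n)) \<le> (1/4) ^ k"
    using cauchy by simp
  then obtain N where N: "\<And>k m n. m \<ge> N k \<Longrightarrow> n \<ge> N k \<Longrightarrow>
      L2_norm M (L2_diff M (X m) (X n)) \<le> (1/4) ^ k"
    by metis
  \<comment> \<open>The sum makes \<open>r k\<close> and \<open>r (Suc k)\<close> both at least
    \<open>N k\<close>; the summand \<open>k\<close> makes the indices unbounded, as the use of
    Fatou's lemma below requires.\<close>
  define r where "r k = k + (\<Sum>j\<le>k. N j)" for k
  have r: "r k \<ge> N k" "r (Suc k) \<ge> N k" "r k \<ge> k" for k
  proof -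
    show "r k \<ge> N k" unfolding r_def using member_le_sum[of k "{..k}" N] by simp
    then show "r (Suc k) \<ge> N k" unfolding r_def by simp
    show "r k \<ge> k" by (simp add: r_def)
  qed
  define f where "f k = L2_rep (X (r k))" for k
  have f: "f k \<in> sq_int M" "L2_class M (f k) = X (r k)" for k
    using X by (auto simp: f_def L2_rep_sq_int)
  then have [measurable]: "f k \<in> borel_measurable M" for k by (simp add: sq_int_measurable)
  have d: "(\<integral>\<^sup>+x. ennreal ((norm (f (Suc k) x - f k x))\<^sup>2) \<partial>M) \<le> ennreal ((1/16) ^ k)" for k
  proof -
    have "L2_norm M (L2_class M (\<lambda>x. f (Suc k) x - f k x)) \<le> (1/4) ^ k"
      using N[OF r(2,1)] f by (simp flip: L2_diff_class)
    then have "(L2_norm M (L2_class M (\<lambda>x. f (Suc k) x - f k x)))\<^sup>2 \<le> ((1/4) ^ k)\<^sup>2"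
      by (intro power_mono) auto
    also have "((1/4) ^ k)\<^sup>2 = ((1/16) ^ k :: real)"
      using power_mult[of "1/4::real" 2 k] power_mult[of "1/4::real" k 2]
      by (simp add: mult.commute power2_eq_square)
    finally show ?thesis
      using f by (simp add: L2_norm_class_nn sq_int_diff ennreal_leI)
  qed
  have "(\<integral>\<^sup>+x. (\<Sum>k. ennreal (4 ^ k * (norm (f (Suc k) x - f k x))\<^sup>2)) \<partial>M)
      = (\<Sum>k. \<integral>\<^sup>+x. ennreal (4 ^ k * (norm (f (Suc k) x - f k x))\<^sup>2) \<partial>M)"
    by (rule nn_integral_suminf) measurable
  also have "\<dots> \<le> (\<Sum>k. ennreal ((1/4) ^ k))"
  proof (rule suminf_le)
    fix k
    have "(\<integral>\<^sup>+x. ennreal (4 ^ k * (norm (f (Suc k) x - f k x))\<^sup>2) \<partial>M)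
        = ennreal (4 ^ k) * (\<integral>\<^sup>+x. ennreal ((norm (f (Suc k) x - f k x))\<^sup>2) \<partial>M)"
      by (subst nn_integral_cmult[symmetric]) (auto simp: ennreal_mult)
    also have "\<dots> \<le> ennreal (4 ^ k) * ennreal ((1/16) ^ k)"
      using d by (rule mult_left_mono) simp
    also have "\<dots> = ennreal ((1/4) ^ k)"
      by (subst ennreal_mult[symmetric]) (auto simp flip: power_mult_distrib)
    finally show "(\<integral>\<^sup>+x. ennreal (4 ^ k * (norm (f (Suc k) x - f k x))\<^sup>2) \<partial>M) \<le> ennreal ((1/4) ^ k)" .
  qed auto
  also have "\<dots> < \<infinity>"
    using summable_geometric[of "1/4::real"] by (subst suminf_ennreal2) auto
  finally have "AE x in M. (\<Sum>k. ennreal (4 ^ k * (norm (f (Suc k) x - f k x))\<^sup>2)) \<noteq> \<infinity>"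
    by (intro nn_integral_PInf_AE) auto
  then have conv: "AE x in M. convergent (\<lambda>k. f k x)"
    by eventually_elim (rule convergent_of_weighted_sum_finite)
  define g where "g x = lim (\<lambda>k. f k x)" for x
  have [measurable]: "g \<in> borel_measurable M"
    unfolding g_def by (rule borel_measurable_lim_metric) simp
  have lim: "AE x in M. (\<lambda>k. f k x) \<longlonglongrightarrow> g x"
    using conv by eventually_elim (simp add: g_def convergent_LIMSEQ_iff)
  have fatou: "(\<lambda>x. L2_rep (X n) x - g x) \<in> sq_int M \<and>
      L2_norm M (L2_class M (\<lambda>x. L2_rep (X n) x - g x)) \<le> e"
    if n: "n \<ge> K" and K: "\<And>m n. m \<ge> K \<Longrightarrow> n \<ge> K \<Longrightarrow> L2_norm M (L2_diff M (X m) (X n)) \<le> e"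
    for n K e
  proof -
    let ?h = "L2_rep (X n)"
    have h: "?h \<in> sq_int M" using X by (simp add: L2_rep_sq_int)
    have [measurable]: "?h \<in> borel_measurable M" using h by (simp add: sq_int_measurable)
    have e: "e \<ge> 0" using K[OF n n] L2_norm_nonneg order_trans by blast
    have "(\<integral>\<^sup>+x. ennreal ((norm (?h x - g x))\<^sup>2) \<partial>M)
        = (\<integral>\<^sup>+x. liminf (\<lambda>k. ennreal ((norm (?h x - f k x))\<^sup>2)) \<partial>M)"
    proof (rule nn_integral_cong_AE)
      show "AE x in M. ennreal ((norm (?h x - g x))\<^sup>2)
          = liminf (\<lambda>k. ennreal ((norm (?h x - f k x))\<^sup>2))"
        using lim
      proof eventually_elim
        case (elim x)
        then have "(\<lambda>k. ennreal ((norm (?h x - f k x))\<^sup>2)) \<longlonglongrightarrow> ennreal ((norm (?h x - g x))\<^sup>2)"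
          by (intro tendsto_intros)
        from lim_imp_Liminf[OF _ this] show ?case by simp
      qed
    qed
    also have "\<dots> \<le> liminf (\<lambda>k. \<integral>\<^sup>+x. ennreal ((norm (?h x - f k x))\<^sup>2) \<partial>M)"
      by (rule nn_integral_liminf) measurable
    also have "\<dots> \<le> liminf (\<lambda>k. ennreal (e\<^sup>2))"
    proof (rule Liminf_mono)
      show "\<forall>\<^sub>F k in sequentially. (\<integral>\<^sup>+x. ennreal ((norm (?h x - f k x))\<^sup>2) \<partial>M) \<le> ennreal (e\<^sup>2)"
        using eventually_ge_at_top[of K]
      proof eventually_elim
        case (elim k)
        then have "L2_norm M (L2_diff M (X n) (X (r k))) \<le> e"
          using r(3)[of k] n by (intro K) auto
        then have "L2_norm M (L2_class M (\<lambda>x. ?h x - f k x)) \<le> e"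
          using L2_diff_class[OF h f(1)[of k]] f(2)[of k] X[of n] by simp
        then have "(L2_norm M (L2_class M (\<lambda>x. ?h x - f k x)))\<^sup>2 \<le> e\<^sup>2"
          by (intro power_mono) auto
        then show ?case using h f by (simp add: L2_norm_class_nn sq_int_diff ennreal_leI)
      qed
    qed
    also have "\<dots> = ennreal (e\<^sup>2)" by (simp add: Liminf_const)
    finally show ?thesis using e by (intro conjI L2_norm_class_le) auto
  qed
  obtain K0 where K0: "\<And>m n. m \<ge> K0 \<Longrightarrow> n \<ge> K0 \<Longrightarrow> L2_norm M (L2_diff M (X m) (X n)) \<le> 1"
    using cauchy[of 1] by auto
  \<comment> \<open>Fatou yields square integrability only of differences with \<open>g\<close>;
    that of \<open>g\<close> follows by subtracting one of them from a member of the
    sequence.\<close>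
  have "(\<lambda>x. L2_rep (X K0) x - (L2_rep (X K0) x - g x)) \<in> sq_int M"
    using sq_int_diff[OF L2_rep_sq_int[OF X]] fatou[of K0 K0 1, OF order_refl K0] by blast
  then have g: "g \<in> sq_int M" by simp
  have diff: "L2_diff M (X n) (L2_class M g) = L2_class M (\<lambda>x. L2_rep (X n) x - g x)" for n
    using L2_diff_class[OF L2_rep_sq_int[OF X] g] X by simp
  have "(\<lambda>n. L2_norm M (L2_diff M (X n) (L2_class M g))) \<longlonglongrightarrow> 0"
  proof (rule LIMSEQ_I)
    fix e :: real assume "e > 0"
    then obtain K where "\<And>m n. m \<ge> K \<Longrightarrow> n \<ge> K \<Longrightarrow> L2_norm M (L2_diff M (X m) (X n)) \<le> e / 2"
      using cauchy[of "e/2"] by auto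
    then have *: "L2_norm M (L2_diff M (X n) (L2_class M g)) \<le> e / 2" if "n \<ge> K" for n
      using fatou[OF that, of "e / 2"] diff by auto
    have "norm (L2_norm M (L2_diff M (X n) (L2_class M g)) - 0) < e" if "n \<ge> K" for n
      using *[OF that] \<open>e > 0\<close> by simp
    then show "\<exists>no. \<forall>n\<ge>no. norm (L2_norm M (L2_diff M (X n) (L2_class M g)) - 0) < e"
      by blast
  qed
  then show ?thesis using g by (intro bexI[of _ "L2_class M g"]) auto
qed

text \<open>The vector of least norm in the affine hyperplane where \<phi> equals 1 is orthogonal to
  the kernel of \<phi>; rescaled, it represents \<phi>.\<close>

lemma L2_riesz:
  assumes add: "\<And>X Y. X \<in> L2 M \<Longrightarrow> Y \<in> L2 M \<Longrightarrow> \<phi> (L2_add M X Y) = \<phi> X + \<phi> Y"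
    and scale: "\<And>c X. X \<in> L2 M \<Longrightarrow> \<phi> (L2_scale M c X) = c * \<phi> X"
    and bound: "\<And>X. X \<in> L2 M \<Longrightarrow> norm (\<phi> X) \<le> K * L2_norm M X"
  shows "\<exists>Y\<in>L2 M. \<forall>X\<in>L2 M. \<phi> X = L2_inner M X Y"
proof (cases "\<forall>X\<in>L2 M. \<phi> X = 0")
  case True
  then show ?thesis by (intro bexI[of _ "L2_zero M"]) auto
next
  case False
  then obtain X0 where X0: "X0 \<in> L2 M" "\<phi> X0 \<noteq> 0" by auto
  define S where "S = {X \<in> L2 M. \<phi> X = 1}"
  have S0: "L2_scale M (1 / \<phi> X0) X0 \<in> S"
    using X0 by (simp add: S_def scale)
  have \<phi>diff: "\<phi> (L2_diff M X Y) = \<phi> X - \<phi> Y" if "X \<in> L2 M" "Y \<in> L2 M" for X Y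
    using that by (simp add: L2_diff_def add scale)
  define d where "d = (INF X\<in>S. (L2_norm M X)\<^sup>2)"
  have bdd: "bdd_below ((\<lambda>X. (L2_norm M X)\<^sup>2) ` S)" by (rule bdd_belowI2[of _ 0]) simp
  have d: "d \<le> (L2_norm M X)\<^sup>2" if "X \<in> S" for X
    unfolding d_def using bdd that by (rule cINF_lower)
  have "\<exists>X\<in>S. (L2_norm M X)\<^sup>2 < d + 1 / real (Suc n)" for n
    using cINF_less_iff[OF _ bdd, of "d + 1 / real (Suc n)"] S0 by (auto simp: d_def[symmetric])
  then obtain X where X: "\<And>n. X n \<in> S" "\<And>n. (L2_norm M (X n))\<^sup>2 < d + 1 / real (Suc n)"
    by metis
  then have XL: "X n \<in> L2 M" "\<phi> (X n) = 1" for n by (auto simp: S_def)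
  \<comment> \<open>The midpoint of \<open>X m\<close> and \<open>X n\<close> again lies in
    \<open>S\<close>, so its squared norm is at least \<open>d\<close>. By the parallelogram law a
    minimizing sequence is therefore Cauchy.\<close>
  have parallelogram: "(L2_norm M (L2_diff M (X m) (X n)))\<^sup>2 \<le> 2 / real (Suc m) + 2 / real (Suc n)" for m n
  proof -
    let ?W = "L2_scale M (1/2) (L2_add M (X m) (X n))"
    have "?W \<in> S" using XL by (simp add: S_def add scale)
    then have "d \<le> (L2_norm M ?W)\<^sup>2" by (rule d)
    then have "4 * d \<le> (L2_norm M (L2_add M (X m) (X n)))\<^sup>2"
      using XL by (simp add: power_divide)
    then show ?thesis using X(2)[of m] X(2)[of n] XL
      by (simp add: L2_norm_add_sq L2_norm_diff_sq)
  qed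
  have "\<exists>Y\<in>L2 M. (\<lambda>n. L2_norm M (L2_diff M (X n) Y)) \<longlonglongrightarrow> 0"
  proof (rule L2_complete[OF XL(1)])
    fix e :: real assume e: "e > 0"
    obtain N where N: "4 / real (Suc N) < e\<^sup>2"
      using reals_Archimedean[of "e\<^sup>2 / 4"] e by (auto simp: field_simps)
    show "\<exists>N. \<forall>m\<ge>N. \<forall>n\<ge>N. L2_norm M (L2_diff M (X m) (X n)) \<le> e"
    proof (intro exI[of _ N] allI impI)
      fix m n assume "N \<le> m" "N \<le> n"
      then have "2 / real (Suc m) \<le> 2 / real (Suc N)" "2 / real (Suc n) \<le> 2 / real (Suc N)"
        by (auto intro!: divide_left_mono)
      then have "(L2_norm M (L2_diff M (X m) (X n)))\<^sup>2 \<le> e\<^sup>2"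
        using parallelogram[of m n] N by linarith
      then show "L2_norm M (L2_diff M (X m) (X n)) \<le> e" using e by (rule power2_le_imp_le[OF _ less_imp_le])
    qed
  qed
  then obtain Y where Y: "Y \<in> L2 M" and lim: "(\<lambda>n. L2_norm M (L2_diff M (X n) Y)) \<longlonglongrightarrow> 0" by auto
  have "norm (1 - \<phi> Y) \<le> K * L2_norm M (L2_diff M (X n) Y)" for n
    using bound[of "L2_diff M (X n) Y"] XL Y by (simp add: \<phi>diff)
  moreover have "(\<lambda>n. K * L2_norm M (L2_diff M (X n) Y)) \<longlonglongrightarrow> K * 0"
    by (intro tendsto_intros lim)
  ultimately have "norm (1 - \<phi> Y) \<le> 0"
    by (intro LIMSEQ_le_const[of "\<lambda>n. K * L2_norm M (L2_diff M (X n) Y)"]) auto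
  then have \<phi>Y: "\<phi> Y = 1" by simp
  have "L2_norm M Y \<le> L2_norm M (X n) + L2_norm M (L2_diff M (X n) Y)" for n
  proof -
    have "Y = L2_add M (X n) (L2_diff M Y (X n))"
      using XL Y by (intro L2_eqI[where M = M]) auto
    then have "L2_norm M Y \<le> L2_norm M (X n) + L2_norm M (L2_diff M Y (X n))"
      using L2_triangle[of "X n" M "L2_diff M Y (X n)"] XL Y by simp
    then show ?thesis using L2_norm_diff_commute[of Y M "X n"] XL Y by simp
  qed
  moreover have "L2_norm M (X n) \<le> sqrt (d + 1 / real (Suc n))" for n
    using X(2)[of n] by (intro real_le_rsqrt) simp
  ultimately have "L2_norm M Y \<le> sqrt (d + 1 / real (Suc n)) + L2_norm M (L2_diff M (X n) Y)" for n
    by (meson add_right_mono order_trans)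
  moreover have "(\<lambda>n. sqrt (d + 1 / real (Suc n)) + L2_norm M (L2_diff M (X n) Y)) \<longlonglongrightarrow> sqrt (d + 0) + 0"
    by (intro tendsto_intros lim LIMSEQ_Suc lim_1_over_n)
  ultimately have "L2_norm M Y \<le> sqrt d"
    by (intro LIMSEQ_le_const[of "\<lambda>n. sqrt (d + 1 / real (Suc n)) + L2_norm M (L2_diff M (X n) Y)"]) auto
  moreover have d0: "d \<ge> 0" unfolding d_def using S0 by (intro cINF_greatest) auto
  ultimately have Yd: "(L2_norm M Y)\<^sup>2 \<le> d"
    using power_mono[of "L2_norm M Y" "sqrt d" 2] by simp
  have orth: "L2_inner M Z Y = 0" if Z: "Z \<in> L2 M" "\<phi> Z = 0" for Z
  proof -
    define w where "w = L2_inner M Z Y"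
    \<comment> \<open>First variation: adding a kernel vector to \<open>Y\<close> stays in
      \<open>S\<close> and cannot decrease the norm. The factor \<open>cnj w\<close> makes the first
      order term the real number \<open>t * (norm w)\<^sup>2\<close>.\<close>
    have *: "2 * t * (norm w)\<^sup>2 \<le> t\<^sup>2 * (norm w)\<^sup>2 * (L2_norm M Z)\<^sup>2" for t :: real
    proof -
      let ?W = "L2_diff M Y (L2_scale M (of_real t * cnj w) Z)"
      have "?W \<in> S" using Z Y \<phi>Y by (simp add: S_def \<phi>diff scale)
      then have "d \<le> (L2_norm M ?W)\<^sup>2" by (rule d)
      also have "\<dots> = (L2_norm M Y)\<^sup>2 + (\<bar>t\<bar> * norm w * L2_norm M Z)\<^sup>2
          - 2 * Re (L2_inner M Y (L2_scale M (of_real t * cnj w) Z))"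
        using Z Y by (simp add: L2_norm_diff_sq norm_mult)
      also have "L2_inner M Y (L2_scale M (of_real t * cnj w) Z) = of_real (t * (norm w)\<^sup>2)"
      proof -
        have "L2_inner M Y Z = cnj w" unfolding w_def by (rule L2_inner_commute)
        then have "L2_inner M Y (L2_scale M (of_real t * cnj w) Z) = of_real t * (w * cnj w)"
          using Z Y by simp
        then show ?thesis by (simp only: complex_norm_square[symmetric] of_real_mult)
      qed
      finally show ?thesis using Yd by (simp add: power_mult_distrib)
    qed
    show ?thesis
    proof (rule ccontr)
      assume "L2_inner M Z Y \<noteq> 0"
      then have w: "(norm w)\<^sup>2 > 0" by (simp add: w_def)
      define z where "z = (L2_norm M Z)\<^sup>2"
      \<comment> \<open>Small enough that the quadratic term cannot compensate the linear one:
        \<open>t * z\<close> is at most 1, whereas the variation demands at least 2.\<close>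
      define t where "t = 1 / (z + 1)"
      have z: "z \<ge> 0" by (simp add: z_def)
      then have t: "t > 0" "t * z \<le> 1" by (auto simp: t_def field_simps)
      have "t * (norm w)\<^sup>2 * 2 \<le> t * (norm w)\<^sup>2 * (t * z)"
        using *[of t] by (simp add: z_def power2_eq_square algebra_simps)
      then have "2 \<le> t * z" using t w by (simp add: mult_le_cancel_left)
      then show False using t by simp
    qed
  qed
  have Y0: "L2_norm M Y \<noteq> 0"
    using bound[OF Y] \<phi>Y by auto
  have "\<phi> W = L2_inner M W (L2_scale M (of_real (1 / (L2_norm M Y)\<^sup>2)) Y)" if W: "W \<in> L2 M" for W
  proof -
    \<comment> \<open>The vector \<open>W\<close> minus \<phi> of \<open>W\<close> times
      \<open>Y\<close> is in the kernel.\<close>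
    have "L2_inner M (L2_diff M W (L2_scale M (\<phi> W) Y)) Y = 0"
      using W Y \<phi>Y by (intro orth) (auto simp: \<phi>diff scale)
    then have "L2_inner M W Y = \<phi> W * L2_inner M Y Y" using W Y by simp
    also have "L2_inner M Y Y = of_real ((L2_norm M Y)\<^sup>2)" by (rule L2_inner_self_norm)
    finally show ?thesis using W Y Y0 by (simp add: field_simps)
  qed
  then show ?thesis using Y by (intro bexI[of _ "L2_scale M (of_real (1 / (L2_norm M Y)\<^sup>2)) Y"]) auto
qed

section \<open>Bounded operators\<close>

lemma L2_add_assoc:
  "X \<in> L2 M \<Longrightarrow> Y \<in> L2 M \<Longrightarrow> Z \<in> L2 M \<Longrightarrow>
    L2_add M (L2_add M X Y) Z = L2_add M X (L2_add M Y Z)"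
  by (rule L2_eqI[where M = M]) auto

lemma L2_add_commute: "L2_add M X Y = L2_add M Y X"
  by (simp add: L2_add_def add.commute)

lemma L2_add_zero [simp]: "X \<in> L2 M \<Longrightarrow> L2_add M (L2_zero M) X = X"
  by (rule L2_eqI[where M = M]) auto

lemma L2_add_minus [simp]: "X \<in> L2 M \<Longrightarrow> L2_add M (L2_scale M (- 1) X) X = L2_zero M"
  by (rule L2_eqI[where M = M]) auto

lemma bounded_ops_in: "T \<in> bounded_ops M \<Longrightarrow> X \<in> L2 M \<Longrightarrow> T X \<in> L2 M"
  and bounded_ops_add: "T \<in> bounded_ops M \<Longrightarrow> X \<in> L2 M \<Longrightarrow> Y \<in> L2 M \<Longrightarrow>
    T (L2_add M X Y) = L2_add M (T X) (T Y)"
  and bounded_ops_scale: "T \<in> bounded_ops M \<Longrightarrow> X \<in> L2 M \<Longrightarrow>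
    T (L2_scale M c X) = L2_scale M c (T X)"
  and bounded_ops_extensional: "T \<in> bounded_ops M \<Longrightarrow> T \<in> extensional (L2 M)"
  by (auto simp: bounded_ops_def PiE_def)

lemma bounded_opsE:
  assumes "T \<in> bounded_ops M"
  obtains K where "K \<ge> 0" "\<And>X. X \<in> L2 M \<Longrightarrow> L2_norm M (T X) \<le> K * L2_norm M X"
proof -
  obtain K where K: "\<forall>X\<in>L2 M. L2_norm M (T X) \<le> K * L2_norm M X"
    using assms by (auto simp: bounded_ops_def)
  have "L2_norm M (T X) \<le> \<bar>K\<bar> * L2_norm M X" if "X \<in> L2 M" for X
    using K that by (meson L2_norm_nonneg abs_ge_self mult_right_mono order_trans)
  then show ?thesis using that[of "\<bar>K\<bar>"] by simp
qed

text \<open>A map with a formal adjoint is automatically linear.\<close>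

lemma bounded_opsI:
  assumes "\<And>X. X \<in> L2 M \<Longrightarrow> S X \<in> L2 M" "\<And>X. X \<in> L2 M \<Longrightarrow> T X \<in> L2 M" "S \<in> extensional (L2 M)"
    and adj: "\<And>X Y. X \<in> L2 M \<Longrightarrow> Y \<in> L2 M \<Longrightarrow> L2_inner M (S X) Y = L2_inner M X (T Y)"
    and bound: "\<And>X. X \<in> L2 M \<Longrightarrow> L2_norm M (S X) \<le> K * L2_norm M X"
  shows "S \<in> bounded_ops M"
proof -
  have "S (L2_add M X Y) = L2_add M (S X) (S Y)" if "X \<in> L2 M" "Y \<in> L2 M" for X Y
    using that assms by (intro L2_eqI[where M = M]) auto
  moreover have "S (L2_scale M c X) = L2_scale M c (S X)" if "X \<in> L2 M" for X c
    using that assms by (intro L2_eqI[where M = M]) auto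
  moreover have "\<exists>K. \<forall>X\<in>L2 M. L2_norm M (S X) \<le> K * L2_norm M X"
    by (intro exI[of _ K] ballI bound)
  ultimately show ?thesis using assms(1,3) by (simp add: bounded_ops_def PiE_def)
qed

lemma bounded_ops_eqI:
  assumes "S \<in> bounded_ops M" "T \<in> bounded_ops M"
    and "\<And>X Y. X \<in> L2 M \<Longrightarrow> Y \<in> L2 M \<Longrightarrow> L2_inner M (S X) Y = L2_inner M (T X) Y"
  shows "S = T"
proof (rule extensionalityI)
  note [simp] = assms(1,2)[THEN bounded_ops_in]
  show "S \<in> extensional (L2 M)" "T \<in> extensional (L2 M)"
    using assms by (auto simp: bounded_ops_extensional)
  show "S X = T X" if "X \<in> L2 M" for X
    using assms that by (intro L2_eqI[where M = M]) auto
qed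

text \<open>The squared norm of \<open>S X\<close> is the inner product of \<open>T (S X)\<close>
  with \<open>X\<close>. Stated for plain maps, because it is applied to an adjoint not yet known to
  be bounded and to \<open>poly_op\<close>, which is not restricted to \<open>L2 M\<close>.\<close>

lemma adjoint_bound:
  assumes "\<And>X. X \<in> L2 M \<Longrightarrow> T X \<in> L2 M" "\<And>X. X \<in> L2 M \<Longrightarrow> S X \<in> L2 M"
    and adj: "\<And>X Y. X \<in> L2 M \<Longrightarrow> Y \<in> L2 M \<Longrightarrow> L2_inner M (T X) Y = L2_inner M X (S Y)"
    and K: "K \<ge> 0" "\<And>X. X \<in> L2 M \<Longrightarrow> L2_norm M (T X) \<le> K * L2_norm M X" and X: "X \<in> L2 M"
  shows "L2_norm M (S X) \<le> K * L2_norm M X"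
proof (rule L2_norm_leI)
  have "norm (L2_inner M (S X) (S X)) = norm (L2_inner M (T (S X)) X)"
    using assms by simp
  also have "\<dots> \<le> L2_norm M (T (S X)) * L2_norm M X"
    using assms by (intro L2_cauchy_schwarz) auto
  also have "\<dots> \<le> (K * L2_norm M (S X)) * L2_norm M X"
    using assms by (intro mult_right_mono) auto
  finally show "norm (L2_inner M (S X) (S X)) \<le> K * L2_norm M X * L2_norm M (S X)"
    by (simp add: mult_ac)
qed (use K in simp)

text \<open>Riesz representation of the functional that sends \<open>X\<close> to
  \<open>L2_inner M (T X) Y\<close>. Restriction to \<open>L2 M\<close> makes the map extensional,
  and without extensionality uniqueness would fail.\<close>

lemma adjoint_exists:
  assumes T: "T \<in> bounded_ops M"
  shows "\<exists>!S. S \<in> bounded_ops M \<and>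
    (\<forall>X\<in>L2 M. \<forall>Y\<in>L2 M. L2_inner M (T X) Y = L2_inner M X (S Y))"
proof (rule ex_ex1I)
  note [simp] = bounded_ops_in[OF T]
  obtain K where K: "K \<ge> 0" "\<And>X. X \<in> L2 M \<Longrightarrow> L2_norm M (T X) \<le> K * L2_norm M X"
    by (rule bounded_opsE[OF T]) blast
  have le: "norm (L2_inner M (T X) Y) \<le> K * L2_norm M X * L2_norm M Y"
    if "X \<in> L2 M" "Y \<in> L2 M" for X Y
    using L2_cauchy_schwarz[of "T X" M Y] T K(2)[OF that(1)] that
    by (meson L2_norm_nonneg bounded_ops_in mult_right_mono order_trans)
  have "\<exists>Z\<in>L2 M. \<forall>X\<in>L2 M. L2_inner M (T X) Y = L2_inner M X Z" if "Y \<in> L2 M" for Y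
  proof (rule L2_riesz[where K = "K * L2_norm M Y"])
    show "norm (L2_inner M (T X) Y) \<le> K * L2_norm M Y * L2_norm M X" if "X \<in> L2 M" for X
      using le[OF that \<open>Y \<in> _\<close>] by (simp add: mult_ac)
  qed (use T that in \<open>auto simp: bounded_ops_add bounded_ops_scale\<close>)
  then obtain S0 where S0: "\<And>Y. Y \<in> L2 M \<Longrightarrow> S0 Y \<in> L2 M"
    "\<And>X Y. X \<in> L2 M \<Longrightarrow> Y \<in> L2 M \<Longrightarrow> L2_inner M (T X) Y = L2_inner M X (S0 Y)"
    by metis
  define S where "S = restrict S0 (L2 M)"
  have S: "S Y \<in> L2 M" "X \<in> L2 M \<Longrightarrow> L2_inner M (T X) Y = L2_inner M X (S Y)"
    if "Y \<in> L2 M" for X Y using S0 that by (auto simp: S_def)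
  have "S \<in> bounded_ops M"
  proof (rule bounded_opsI[where T = T and K = K])
    show "L2_inner M (S X) Y = L2_inner M X (T Y)" if "X \<in> L2 M" "Y \<in> L2 M" for X Y
      using S(2)[OF that] by (metis L2_inner_commute)
    show "L2_norm M (S X) \<le> K * L2_norm M X" if "X \<in> L2 M" for X
      by (rule adjoint_bound[of M T S, OF _ S(1) S(2) K that]) simp_all
  qed (use S T in \<open>auto simp: S_def\<close>)
  then show "\<exists>S. S \<in> bounded_ops M \<and> (\<forall>X\<in>L2 M. \<forall>Y\<in>L2 M. L2_inner M (T X) Y = L2_inner M X (S Y))"
    using S by auto
next
  fix S S'
  assume *: "S \<in> bounded_ops M \<and> (\<forall>X\<in>L2 M. \<forall>Y\<in>L2 M. L2_inner M (T X) Y = L2_inner M X (S Y))"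
    "S' \<in> bounded_ops M \<and> (\<forall>X\<in>L2 M. \<forall>Y\<in>L2 M. L2_inner M (T X) Y = L2_inner M X (S' Y))"
  show "S = S'"
  proof (rule bounded_ops_eqI)
    fix X Y assume "X \<in> L2 M" "Y \<in> L2 M"
    then show "L2_inner M (S X) Y = L2_inner M (S' X) Y"
      using * by (metis L2_inner_commute)
  qed (use * in auto)
qed

lemma op_adjoint_in [simp]: "T \<in> bounded_ops M \<Longrightarrow> op_adjoint M T \<in> bounded_ops M"
  and op_adjoint_right: "T \<in> bounded_ops M \<Longrightarrow> X \<in> L2 M \<Longrightarrow> Y \<in> L2 M \<Longrightarrow>
    L2_inner M X (op_adjoint M T Y) = L2_inner M (T X) Y"
  using theI'[OF adjoint_exists[of T M]] unfolding op_adjoint_def by auto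

lemma op_adjoint_L2 [simp]: "T \<in> bounded_ops M \<Longrightarrow> X \<in> L2 M \<Longrightarrow> op_adjoint M T X \<in> L2 M"
  by (rule bounded_ops_in[OF op_adjoint_in])

lemma op_adjoint_left: "T \<in> bounded_ops M \<Longrightarrow> X \<in> L2 M \<Longrightarrow> Y \<in> L2 M \<Longrightarrow>
    L2_inner M (op_adjoint M T X) Y = L2_inner M X (T Y)"
  using op_adjoint_right bounded_ops_in by (metis L2_inner_commute)

lemma op_adjoint_eqI:
  assumes "T \<in> bounded_ops M" "S \<in> bounded_ops M"
    and "\<And>X Y. X \<in> L2 M \<Longrightarrow> Y \<in> L2 M \<Longrightarrow> L2_inner M (T X) Y = L2_inner M X (S Y)"
  shows "op_adjoint M T = S"
  using the1_equality[OF adjoint_exists[OF assms(1)]] assms unfolding op_adjoint_def by auto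

lemma
  assumes T: "T \<in> bounded_ops M"
  shows op_norm_bound: "\<And>X. X \<in> L2 M \<Longrightarrow> L2_norm M (T X) \<le> op_norm M T * L2_norm M X"
    and op_norm_nonneg: "0 \<le> op_norm M T"
proof -
  note [simp] = bounded_ops_in[OF T]
  obtain K where K: "K \<ge> 0" "\<And>X. X \<in> L2 M \<Longrightarrow> L2_norm M (T X) \<le> K * L2_norm M X"
    by (rule bounded_opsE[OF T]) blast
  have bdd: "bdd_above ((\<lambda>X. L2_norm M (T X)) ` {X \<in> L2 M. L2_norm M X \<le> 1})"
    using K by (intro bdd_aboveI2[of _ _ K]) (auto intro: order_trans mult_left_le)
  have le: "L2_norm M (T X) \<le> op_norm M T" if "X \<in> L2 M" "L2_norm M X \<le> 1" for X
    unfolding op_norm_def using that by (intro cSUP_upper bdd) auto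
  show "0 \<le> op_norm M T"
    by (rule order_trans[OF L2_norm_nonneg le[of "L2_zero M"]]) auto
  show "L2_norm M (T X) \<le> op_norm M T * L2_norm M X" if X: "X \<in> L2 M" for X
  proof (cases "L2_norm M X = 0")
    \<comment> \<open>A vector of norm zero cannot be normalized; the crude bound \<open>K\<close>
      shows that its image has norm zero as well.\<close>
    case True
    then show ?thesis using K(2)[OF X] by simp
  next
    case False
    then have "norm (complex_of_real (1 / L2_norm M X)) = 1 / L2_norm M X"
      unfolding norm_of_real by simp
    then have "L2_norm M (T (L2_scale M (of_real (1 / L2_norm M X)) X)) \<le> op_norm M T"
      using X False by (intro le) (auto simp del: of_real_divide)
    then show ?thesis
      using X T False by (simp add: bounded_ops_scale norm_divide field_simps less_le)
  qed
qed

lemma op_norm_le: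
  assumes "K \<ge> 0" "\<And>X. X \<in> L2 M \<Longrightarrow> L2_norm M (T X) \<le> K * L2_norm M X"
  shows "op_norm M T \<le> K"
  unfolding op_norm_def
proof (rule cSUP_least)
  show "{X \<in> L2 M. L2_norm M X \<le> 1} \<noteq> {}"
    by (auto intro!: exI[of _ "L2_zero M"])
  show "L2_norm M (T X) \<le> K" if "X \<in> {X \<in> L2 M. L2_norm M X \<le> 1}" for X
    using that assms(2)[of X] mult_left_le[OF _ assms(1), of "L2_norm M X"] by auto
qed

lemma op_norm_adjoint_le:
  assumes T: "T \<in> bounded_ops M"
  shows "op_norm M (op_adjoint M T) \<le> op_norm M T"
proof (rule op_norm_le[OF op_norm_nonneg[OF T]])
  show "L2_norm M (op_adjoint M T X) \<le> op_norm M T * L2_norm M X" if "X \<in> L2 M" for X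
    by (rule adjoint_bound[of M T "op_adjoint M T", OF _ _ _ op_norm_nonneg[OF T] op_norm_bound[OF T] that])
      (use T in \<open>simp_all add: bounded_ops_in[OF T] op_adjoint_right\<close>)
qed

section \<open>The ring of bounded operators\<close>

lemma op_algebra_simps [simp]:
  "carrier (op_algebra M) = bounded_ops M"
  "mult (op_algebra M) = (\<lambda>S T. \<lambda>X\<in>L2 M. S (T X))"
  "one (op_algebra M) = (\<lambda>X\<in>L2 M. X)"
  "zero (op_algebra M) = (\<lambda>X\<in>L2 M. L2_zero M)"
  "add (op_algebra M) = (\<lambda>S T. \<lambda>X\<in>L2 M. L2_add M (S X) (T X))"
  "smult (op_algebra M) = (\<lambda>c T. \<lambda>X\<in>L2 M. L2_scale M c (T X))"
  "star (op_algebra M) = op_adjoint M"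
  "cnorm (op_algebra M) = op_norm M"
  by (simp_all add: op_algebra_def)

lemma op_add_in:
  assumes "S \<in> bounded_ops M" "T \<in> bounded_ops M"
  shows "(\<lambda>X\<in>L2 M. L2_add M (S X) (T X)) \<in> bounded_ops M"
proof (rule bounded_opsI)
  note [simp] = assms[THEN bounded_ops_in]
  show "L2_inner M ((\<lambda>X\<in>L2 M. L2_add M (S X) (T X)) X) Y
      = L2_inner M X (L2_add M (op_adjoint M S Y) (op_adjoint M T Y))"
    if "X \<in> L2 M" "Y \<in> L2 M" for X Y
    using assms that by (simp add: op_adjoint_right)
  show "L2_norm M ((\<lambda>X\<in>L2 M. L2_add M (S X) (T X)) X) \<le> (op_norm M S + op_norm M T) * L2_norm M X"
    if "X \<in> L2 M" for X
    using assms that L2_triangle[of "S X" M "T X"] op_norm_bound[of S M X] op_norm_bound[of T M X]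
    by (simp add: distrib_right)
qed (simp_all add: assms assms[THEN bounded_ops_in])

lemma op_mult_in:
  assumes "S \<in> bounded_ops M" "T \<in> bounded_ops M"
  shows "(\<lambda>X\<in>L2 M. S (T X)) \<in> bounded_ops M"
proof (rule bounded_opsI[where T = "\<lambda>Y. op_adjoint M T (op_adjoint M S Y)"
      and K = "op_norm M S * op_norm M T"])
  note [simp] = assms[THEN bounded_ops_in]
  show "L2_inner M ((\<lambda>X\<in>L2 M. S (T X)) X) Y = L2_inner M X (op_adjoint M T (op_adjoint M S Y))"
    if "X \<in> L2 M" "Y \<in> L2 M" for X Y
    using assms that by (simp add: op_adjoint_right)
  show "L2_norm M ((\<lambda>X\<in>L2 M. S (T X)) X) \<le> (op_norm M S * op_norm M T) * L2_norm M X"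
    if "X \<in> L2 M" for X
  proof -
    have "L2_norm M (S (T X)) \<le> op_norm M S * L2_norm M (T X)"
      using assms that by (intro op_norm_bound) auto
    also have "\<dots> \<le> op_norm M S * (op_norm M T * L2_norm M X)"
      using assms that by (intro mult_left_mono op_norm_bound op_norm_nonneg) auto
    finally show ?thesis using that by (simp add: mult_ac)
  qed
qed (simp_all add: assms assms[THEN bounded_ops_in])

lemma op_scale_in:
  assumes "T \<in> bounded_ops M"
  shows "(\<lambda>X\<in>L2 M. L2_scale M c (T X)) \<in> bounded_ops M"
proof (rule bounded_opsI)
  note [simp] = assms[THEN bounded_ops_in]
  show "L2_inner M ((\<lambda>X\<in>L2 M. L2_scale M c (T X)) X) Y
      = L2_inner M X (L2_scale M (cnj c) (op_adjoint M T Y))"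
    if "X \<in> L2 M" "Y \<in> L2 M" for X Y
    using assms that by (simp add: op_adjoint_right)
  show "L2_norm M ((\<lambda>X\<in>L2 M. L2_scale M c (T X)) X) \<le> (norm c * op_norm M T) * L2_norm M X"
    if "X \<in> L2 M" for X
    using assms that op_norm_bound[of T M X] by (simp add: mult.assoc mult_left_mono)
qed (simp_all add: assms assms[THEN bounded_ops_in])

lemma op_one_in: "(\<lambda>X\<in>L2 M. X) \<in> bounded_ops M"
  by (rule bounded_opsI[where T = "\<lambda>X. X" and K = 1]) auto

lemma op_zero_in: "(\<lambda>X\<in>L2 M. L2_zero M) \<in> bounded_ops M"
  by (rule bounded_opsI[where T = "\<lambda>X. L2_zero M" and K = 0])
    auto

lemma op_add_scale_minus:
  assumes "T \<in> bounded_ops M"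
  shows "(\<lambda>X\<in>L2 M. L2_add M ((\<lambda>X\<in>L2 M. L2_scale M (-1) (T X)) X) (T X)) = (\<lambda>X\<in>L2 M. L2_zero M)"
  using bounded_ops_in[OF assms] by (intro restrict_ext) simp

lemma ring_op_algebra: "ring (op_algebra M)"
proof (rule ringI)
  show "abelian_group (op_algebra M)"
  proof (rule abelian_groupI, unfold op_algebra_simps)
    fix S T U assume *: "S \<in> bounded_ops M" "T \<in> bounded_ops M" "U \<in> bounded_ops M"
    note [simp] = *[THEN bounded_ops_in]
    show "(\<lambda>X\<in>L2 M. L2_add M ((\<lambda>X\<in>L2 M. L2_add M (S X) (T X)) X) (U X))
        = (\<lambda>X\<in>L2 M. L2_add M (S X) ((\<lambda>X\<in>L2 M. L2_add M (T X) (U X)) X))"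
      using * by (intro restrict_ext) (simp add: L2_add_assoc)
  next
    fix S T assume *: "S \<in> bounded_ops M" "T \<in> bounded_ops M"
    note [simp] = *[THEN bounded_ops_in]
    show "(\<lambda>X\<in>L2 M. L2_add M (S X) (T X)) \<in> bounded_ops M"
      using * by (rule op_add_in)
    show "(\<lambda>X\<in>L2 M. L2_add M (S X) (T X)) = (\<lambda>X\<in>L2 M. L2_add M (T X) (S X))"
      using * by (intro restrict_ext) (simp add: L2_add_commute)
  next
    show "(\<lambda>X\<in>L2 M. L2_zero M) \<in> bounded_ops M" by (rule op_zero_in)
  next
    fix T assume T: "T \<in> bounded_ops M"
    note [simp] = bounded_ops_in[OF T]
    show "(\<lambda>X\<in>L2 M. L2_add M ((\<lambda>X\<in>L2 M. L2_zero M) X) (T X)) = T"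
      using T by (intro extensionalityI[of _ "L2 M"]) (simp_all add: bounded_ops_extensional)
    show "\<exists>S\<in>bounded_ops M. (\<lambda>X\<in>L2 M. L2_add M (S X) (T X)) = (\<lambda>X\<in>L2 M. L2_zero M)"
      using op_add_scale_minus[OF T] op_scale_in[OF T] by blast
  qed
  show "monoid (op_algebra M)"
  proof (rule monoidI, unfold op_algebra_simps)
    fix S T U assume *: "S \<in> bounded_ops M" "T \<in> bounded_ops M" "U \<in> bounded_ops M"
    note [simp] = *[THEN bounded_ops_in]
    show "(\<lambda>X\<in>L2 M. (\<lambda>X\<in>L2 M. S (T X)) (U X)) = (\<lambda>X\<in>L2 M. S ((\<lambda>X\<in>L2 M. T (U X)) X))"
      by (intro restrict_ext) simp
  next
    fix S T assume "S \<in> bounded_ops M" "T \<in> bounded_ops M"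
    then show "(\<lambda>X\<in>L2 M. S (T X)) \<in> bounded_ops M" by (rule op_mult_in)
  next
    fix T assume T: "T \<in> bounded_ops M"
    note [simp] = bounded_ops_in[OF T]
    show "(\<lambda>X\<in>L2 M. (\<lambda>X\<in>L2 M. X) (T X)) = T" "(\<lambda>X\<in>L2 M. T ((\<lambda>X\<in>L2 M. X) X)) = T"
      using T by (intro extensionalityI[of _ "L2 M"]; simp add: bounded_ops_extensional)+
  qed (rule op_one_in)
next
  fix S T U
  assume "S \<in> carrier (op_algebra M)" "T \<in> carrier (op_algebra M)" "U \<in> carrier (op_algebra M)"
  then have *: "S \<in> bounded_ops M" "T \<in> bounded_ops M" "U \<in> bounded_ops M"
    by simp_all
  note [simp] = *[THEN bounded_ops_in]
  show "(S \<oplus>\<^bsub>op_algebra M\<^esub> T) \<otimes>\<^bsub>op_algebra M\<^esub> U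
      = S \<otimes>\<^bsub>op_algebra M\<^esub> U \<oplus>\<^bsub>op_algebra M\<^esub> T \<otimes>\<^bsub>op_algebra M\<^esub> U"
    "U \<otimes>\<^bsub>op_algebra M\<^esub> (S \<oplus>\<^bsub>op_algebra M\<^esub> T)
      = U \<otimes>\<^bsub>op_algebra M\<^esub> S \<oplus>\<^bsub>op_algebra M\<^esub> U \<otimes>\<^bsub>op_algebra M\<^esub> T"
    unfolding op_algebra_simps by (intro restrict_ext; simp add: bounded_ops_add *)+
qed

lemma op_minus:
  assumes "T \<in> bounded_ops M"
  shows "\<ominus>\<^bsub>op_algebra M\<^esub> T = (\<lambda>X\<in>L2 M. L2_scale M (-1) (T X))"
proof -
  interpret ring "op_algebra M" by (rule ring_op_algebra)
  have "(\<lambda>X\<in>L2 M. L2_scale M (-1) (T X)) \<oplus>\<^bsub>op_algebra M\<^esub> T = \<zero>\<^bsub>op_algebra M\<^esub>"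
    using op_add_scale_minus[OF assms] by (simp only: op_algebra_simps)
  then show ?thesis using assms by (intro minus_equality) (simp_all only: op_algebra_simps op_scale_in)
qed

lemma op_diff:
  assumes "S \<in> bounded_ops M" "T \<in> bounded_ops M" "X \<in> L2 M"
  shows "(S \<ominus>\<^bsub>op_algebra M\<^esub> T) X = L2_diff M (S X) (T X)"
  using bounded_ops_in[OF assms(2)] assms by (simp add: a_minus_def op_minus L2_diff_def)

lemma op_finsum_inner:
  assumes "finite S" "\<And>i. i \<in> S \<Longrightarrow> f i \<in> bounded_ops M" "X \<in> L2 M" "Y \<in> L2 M"
  shows "L2_inner M ((\<Oplus>\<^bsub>op_algebra M\<^esub>i\<in>S. f i) X) Y = (\<Sum>i\<in>S. L2_inner M (f i X) Y)"
proof -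
  interpret ring "op_algebra M" by (rule ring_op_algebra)
  show ?thesis using assms(1,2)
  proof (induction S rule: finite_induct)
    case empty
    then show ?case using assms by simp
  next
    case (insert i S)
    have "(\<Oplus>\<^bsub>op_algebra M\<^esub>i\<in>S. f i) \<in> carrier (op_algebra M)"
      using insert by (intro finsum_closed) auto
    then show ?case using insert assms(3,4)
      by (subst finsum_insert) (auto simp: bounded_ops_in[where T = "f i" for i]
          bounded_ops_in[where T = "finsum A f S" for A])
  qed
qed

section \<open>Banach star algebras\<close>

text \<open>The estimates that make the operations continuous, together with completeness: this is
  what extends an isometric correspondence from polynomials to their limits. The C*-identity enters
  elsewhere, through \<open>star_square_bound_converse\<close>.\<close>

locale banach_star_algebra = ring B for B :: "('x, 'r) cstar_alg_scheme" (structure) +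
  assumes smult_closed [simp]: "x \<in> carrier B \<Longrightarrow> c \<odot> x \<in> carrier B"
    and star_closed [simp]: "x \<in> carrier B \<Longrightarrow> star B x \<in> carrier B"
    and smult_add: "x \<in> carrier B \<Longrightarrow> y \<in> carrier B \<Longrightarrow> c \<odot> (x \<oplus> y) = c \<odot> x \<oplus> c \<odot> y"
    and smult_minus_one: "x \<in> carrier B \<Longrightarrow> (-1) \<odot> x = \<ominus> x"
    and star_add: "x \<in> carrier B \<Longrightarrow> y \<in> carrier B \<Longrightarrow> star B (x \<oplus> y) = star B x \<oplus> star B y"
    and norm_nonneg: "x \<in> carrier B \<Longrightarrow> 0 \<le> cnorm B x"
    and norm_zeroD: "x \<in> carrier B \<Longrightarrow> cnorm B x = 0 \<Longrightarrow> x = \<zero>"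
    and norm_zero [simp]: "cnorm B \<zero> = 0"
    and norm_add: "x \<in> carrier B \<Longrightarrow> y \<in> carrier B \<Longrightarrow> cnorm B (x \<oplus> y) \<le> cnorm B x + cnorm B y"
    and norm_mult: "x \<in> carrier B \<Longrightarrow> y \<in> carrier B \<Longrightarrow> cnorm B (x \<otimes> y) \<le> cnorm B x * cnorm B y"
    and norm_smult: "x \<in> carrier B \<Longrightarrow> cnorm B (c \<odot> x) \<le> norm c * cnorm B x"
    and norm_star: "x \<in> carrier B \<Longrightarrow> cnorm B (star B x) \<le> cnorm B x"
    and complete: "(\<And>n. F n \<in> carrier B) \<Longrightarrow>
      (\<And>e. e > 0 \<Longrightarrow> \<exists>N. \<forall>m\<ge>N. \<forall>n\<ge>N. cnorm B (F m \<ominus> F n) \<le> e) \<Longrightarrow>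
      \<exists>x\<in>carrier B. (\<lambda>n::nat. cnorm B (F n \<ominus> x)) \<longlonglongrightarrow> 0"
begin

lemma norm_minus:
  assumes "x \<in> carrier B"
  shows "cnorm B (\<ominus> x) = cnorm B x"
proof -
  have *: "cnorm B (\<ominus> x) \<le> cnorm B x" if "x \<in> carrier B" for x
    using norm_smult[OF that, of "-1"] that by (simp add: smult_minus_one)
  show ?thesis using *[of x] *[of "\<ominus> x"] assms by simp
qed

lemma eq_of_dist_zero:
  assumes "x \<in> carrier B" "y \<in> carrier B" "cnorm B (x \<ominus> y) = 0"
  shows "x = y"
proof -
  have "x \<ominus> y = \<zero>" using assms by (intro norm_zeroD) auto
  moreover have "(x \<ominus> y) \<oplus> y = x" using assms by (simp add: a_minus_def a_assoc l_neg)
  ultimately show ?thesis using assms by simp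
qed

lemma dist_commute:
  assumes "x \<in> carrier B" "y \<in> carrier B"
  shows "cnorm B (x \<ominus> y) = cnorm B (y \<ominus> x)"
proof -
  have "\<ominus> (y \<ominus> x) = x \<ominus> y"
    using assms by (simp add: a_minus_def minus_add a_comm)
  then show ?thesis using assms norm_minus[of "y \<ominus> x"] by simp
qed

lemma dist_triangle:
  assumes "x \<in> carrier B" "y \<in> carrier B" "z \<in> carrier B"
  shows "cnorm B (x \<ominus> z) \<le> cnorm B (x \<ominus> y) + cnorm B (y \<ominus> z)"
proof -
  have "x \<ominus> z = (x \<ominus> y) \<oplus> (y \<ominus> z)"
    using assms by (simp add: a_minus_def a_assoc r_neg1 r_neg2)
  then show ?thesis using assms norm_add[of "x \<ominus> y" "y \<ominus> z"] by simp
qed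

lemma norm_le_dist:
  assumes "x \<in> carrier B" "y \<in> carrier B"
  shows "cnorm B x \<le> cnorm B y + cnorm B (x \<ominus> y)"
  using dist_triangle[of x y \<zero>] assms by (simp add: a_minus_def)

lemma dist_add:
  assumes "x \<in> carrier B" "y \<in> carrier B" "x' \<in> carrier B" "y' \<in> carrier B"
  shows "cnorm B ((x \<oplus> y) \<ominus> (x' \<oplus> y')) \<le> cnorm B (x \<ominus> x') + cnorm B (y \<ominus> y')"
proof -
  have "(x \<oplus> y) \<ominus> (x' \<oplus> y') = (x \<ominus> x') \<oplus> (y \<ominus> y')"
    using assms by (simp add: a_minus_def minus_add a_ac)
  then show ?thesis using assms norm_add[of "x \<ominus> x'" "y \<ominus> y'"] by simp
qed

lemma dist_mult:
  assumes "x \<in> carrier B" "y \<in> carrier B" "x' \<in> carrier B" "y' \<in> carrier B"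
  shows "cnorm B ((x \<otimes> y) \<ominus> (x' \<otimes> y')) \<le>
    cnorm B (x \<ominus> x') * cnorm B y + cnorm B x' * cnorm B (y \<ominus> y')"
proof -
  have eq: "(x \<ominus> x') \<otimes> y = x \<otimes> y \<ominus> x' \<otimes> y" "x' \<otimes> (y \<ominus> y') = x' \<otimes> y \<ominus> x' \<otimes> y'"
    using assms by (simp_all add: a_minus_def l_distr r_distr l_minus r_minus)
  have "cnorm B (x \<otimes> y \<ominus> x' \<otimes> y') \<le> cnorm B (x \<otimes> y \<ominus> x' \<otimes> y) + cnorm B (x' \<otimes> y \<ominus> x' \<otimes> y')"
    using assms by (intro dist_triangle) auto
  also have "\<dots> \<le> cnorm B (x \<ominus> x') * cnorm B y + cnorm B x' * cnorm B (y \<ominus> y')"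
    unfolding eq[symmetric] using assms by (intro add_mono norm_mult) auto
  finally show ?thesis .
qed

lemma additive_minus:
  assumes "\<And>x. x \<in> carrier B \<Longrightarrow> h x \<in> carrier B"
    and "\<And>x y. x \<in> carrier B \<Longrightarrow> y \<in> carrier B \<Longrightarrow> h (x \<oplus> y) = h x \<oplus> h y"
    and "x \<in> carrier B" "y \<in> carrier B"
  shows "h (x \<ominus> y) = h x \<ominus> h y"
proof -
  have "(x \<ominus> y) \<oplus> y = x" using assms(3,4) by (simp add: a_minus_def a_assoc l_neg)
  then have "h x = h (x \<ominus> y) \<oplus> h y" using assms by (metis minus_closed)
  moreover have "h (x \<ominus> y) \<in> carrier B" "h y \<in> carrier B" using assms by auto
  ultimately show ?thesis by (simp add: a_minus_def a_assoc r_neg)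
qed

lemma dist_smult:
  assumes "x \<in> carrier B" "y \<in> carrier B"
  shows "cnorm B (c \<odot> x \<ominus> c \<odot> y) \<le> norm c * cnorm B (x \<ominus> y)"
proof -
  have "c \<odot> (x \<ominus> y) = c \<odot> x \<ominus> c \<odot> y"
    by (rule additive_minus) (use assms smult_add in auto)
  then show ?thesis using norm_smult[of "x \<ominus> y" c] assms by simp
qed

lemma dist_star:
  assumes "x \<in> carrier B" "y \<in> carrier B"
  shows "cnorm B (star B x \<ominus> star B y) \<le> cnorm B (x \<ominus> y)"
proof -
  have "star B (x \<ominus> y) = star B x \<ominus> star B y"
    by (rule additive_minus) (use assms star_add in auto)
  then show ?thesis using norm_star[of "x \<ominus> y"] assms by simp
qed

end

subsection \<open>The operator algebra\<close>

lemma L2_tendsto_inner: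
  assumes "\<And>n. X n \<in> L2 M" "Y \<in> L2 M" "Z \<in> L2 M"
    and lim: "(\<lambda>n. L2_norm M (L2_diff M (X n) Y)) \<longlonglongrightarrow> 0"
  shows "(\<lambda>n. L2_inner M (X n) Z) \<longlonglongrightarrow> L2_inner M Y Z"
proof (rule LIM_zero_cancel, rule tendsto_norm_zero_cancel, rule tendsto_sandwich[where f = "\<lambda>_. 0"])
  show "\<forall>\<^sub>F n in sequentially. norm (L2_inner M (X n) Z - L2_inner M Y Z)
      \<le> L2_norm M (L2_diff M (X n) Y) * L2_norm M Z"
    using L2_cauchy_schwarz[of "L2_diff M (X n) Y" M Z for n] assms by (auto intro!: always_eventually)
  show "(\<lambda>n. L2_norm M (L2_diff M (X n) Y) * L2_norm M Z) \<longlonglongrightarrow> 0"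
    using tendsto_mult_left_zero[OF lim] .
qed auto

text \<open>The limit is taken at each vector, where \<open>L2_complete\<close> applies. Linearity
  passes to it through inner products, and letting one index of the Cauchy estimate tend to infinity
  makes the convergence uniform on the unit ball.\<close>

lemma op_complete:
  assumes F: "\<And>n. F n \<in> bounded_ops M"
    and cauchy: "\<And>e. e > 0 \<Longrightarrow>
      \<exists>N. \<forall>m\<ge>N. \<forall>n\<ge>N. op_norm M (F m \<ominus>\<^bsub>op_algebra M\<^esub> F n) \<le> e"
  shows "\<exists>T\<in>bounded_ops M. (\<lambda>n::nat. op_norm M (F n \<ominus>\<^bsub>op_algebra M\<^esub> T)) \<longlonglongrightarrow> 0"
proof -
  interpret ring "op_algebra M" by (rule ring_op_algebra)
  note [simp] = bounded_ops_in[OF F]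
  have diff_in: "S \<ominus>\<^bsub>op_algebra M\<^esub> T \<in> bounded_ops M"
    if "S \<in> bounded_ops M" "T \<in> bounded_ops M" for S T
    using minus_closed[of S T] that by simp
  have le: "L2_norm M (L2_diff M (F m X) (F n X)) \<le> e * L2_norm M X"
    if "op_norm M (F m \<ominus>\<^bsub>op_algebra M\<^esub> F n) \<le> e" "X \<in> L2 M" for m n X e
    using op_norm_bound[OF diff_in[OF F F] that(2), of m n] op_diff[OF F F that(2), of m n] that
      mult_right_mono[OF that(1), of "L2_norm M X"] by simp
  have "\<exists>Y\<in>L2 M. (\<lambda>n. L2_norm M (L2_diff M (F n X) Y)) \<longlonglongrightarrow> 0" if X: "X \<in> L2 M" for X
  proof (rule L2_complete)
    fix e :: real assume e: "e > 0"
    \<comment> \<open>The summand 1 avoids division by zero.\<close>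
    define d where "d = e / (L2_norm M X + 1)"
    have pos: "L2_norm M X + 1 > 0" using L2_norm_nonneg[of M X] by linarith
    then have d: "d > 0" "d * L2_norm M X \<le> e" using e by (auto simp: d_def field_simps)
    obtain N where "\<forall>m\<ge>N. \<forall>n\<ge>N. op_norm M (F m \<ominus>\<^bsub>op_algebra M\<^esub> F n) \<le> d"
      using cauchy[OF d(1)] by auto
    then show "\<exists>N. \<forall>m\<ge>N. \<forall>n\<ge>N. L2_norm M (L2_diff M (F m X) (F n X)) \<le> e"
      using le[OF _ X, of _ _ d] d(2) by (meson order_trans)
  qed (use X in simp)
  then obtain T0 where T0: "\<And>X. X \<in> L2 M \<Longrightarrow> T0 X \<in> L2 M"
    "\<And>X. X \<in> L2 M \<Longrightarrow> (\<lambda>n. L2_norm M (L2_diff M (F n X) (T0 X))) \<longlonglongrightarrow> 0"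
    by metis
  define T where "T = restrict T0 (L2 M)"
  have T: "T X \<in> L2 M" "(\<lambda>n. L2_norm M (L2_diff M (F n X) (T X))) \<longlonglongrightarrow> 0"
    if "X \<in> L2 M" for X using T0[OF that] that by (simp_all add: T_def)
  have lim: "(\<lambda>n. L2_inner M (F n X) Z) \<longlonglongrightarrow> L2_inner M (T X) Z"
    if "X \<in> L2 M" "Z \<in> L2 M" for X Z
    using that by (intro L2_tendsto_inner T) simp_all
  have unif: "L2_norm M (L2_diff M (F n X) (T X)) \<le> e * L2_norm M X"
    if N: "\<forall>m\<ge>N. \<forall>n\<ge>N. op_norm M (F m \<ominus>\<^bsub>op_algebra M\<^esub> F n) \<le> e"
      and n: "n \<ge> N" and X: "X \<in> L2 M" for N n e X
  proof (rule LIMSEQ_le_const)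
    show "(\<lambda>m. e * L2_norm M X + L2_norm M (L2_diff M (F m X) (T X))) \<longlonglongrightarrow> e * L2_norm M X"
      using tendsto_add[OF tendsto_const T(2)[OF X], of "e * L2_norm M X"] by simp
    show "\<exists>N. \<forall>m\<ge>N. L2_norm M (L2_diff M (F n X) (T X))
        \<le> e * L2_norm M X + L2_norm M (L2_diff M (F m X) (T X))"
    proof (intro exI[of _ N] allI impI)
      fix m assume "m \<ge> N"
      then have "L2_norm M (L2_diff M (F n X) (F m X)) \<le> e * L2_norm M X"
        using le[OF _ X] N n by blast
      then show "L2_norm M (L2_diff M (F n X) (T X))
        \<le> e * L2_norm M X + L2_norm M (L2_diff M (F m X) (T X))"
        using L2_diff_triangle[of "F n X" M "F m X" "T X"] T(1)[OF X] X by simp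
    qed
  qed
  have T_in: "T \<in> bounded_ops M"
  proof -
    have "T (L2_add M X Y) = L2_add M (T X) (T Y)" if XY: "X \<in> L2 M" "Y \<in> L2 M" for X Y
    proof (rule L2_eqI[where M = M])
      fix Z assume Z: "Z \<in> L2 M"
      have "(\<lambda>n. L2_inner M (F n (L2_add M X Y)) Z) \<longlonglongrightarrow> L2_inner M (T X) Z + L2_inner M (T Y) Z"
        using XY Z F by (simp add: bounded_ops_add tendsto_add lim)
      then show "L2_inner M (T (L2_add M X Y)) Z = L2_inner M (L2_add M (T X) (T Y)) Z"
        using lim[of "L2_add M X Y" Z] XY Z T(1) LIMSEQ_unique by fastforce
    qed (use XY T(1) in simp_all)
    moreover have "T (L2_scale M c X) = L2_scale M c (T X)" if X: "X \<in> L2 M" for c X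
    proof (rule L2_eqI[where M = M])
      fix Z assume Z: "Z \<in> L2 M"
      have "(\<lambda>n. L2_inner M (F n (L2_scale M c X)) Z) \<longlonglongrightarrow> c * L2_inner M (T X) Z"
        using X Z F by (simp add: bounded_ops_scale tendsto_mult_left lim)
      then show "L2_inner M (T (L2_scale M c X)) Z = L2_inner M (L2_scale M c (T X)) Z"
        using lim[of "L2_scale M c X" Z] X Z T(1) LIMSEQ_unique by fastforce
    qed (use X T(1) in simp_all)
    moreover have "\<exists>K. \<forall>X\<in>L2 M. L2_norm M (T X) \<le> K * L2_norm M X"
    proof -
      obtain N where N: "\<forall>m\<ge>N. \<forall>n\<ge>N. op_norm M (F m \<ominus>\<^bsub>op_algebra M\<^esub> F n) \<le> 1"
        using cauchy[of 1] by auto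
      have "L2_norm M (T X) \<le> (op_norm M (F N) + 1) * L2_norm M X" if X: "X \<in> L2 M" for X
      proof -
        have TX: "T X \<in> L2 M" by (rule T(1)[OF X])
        have "T X = L2_add M (F N X) (L2_diff M (T X) (F N X))"
          using X TX by (intro L2_eqI[where M = M]) auto
        then have "L2_norm M (T X) \<le> L2_norm M (F N X) + L2_norm M (L2_diff M (T X) (F N X))"
          using L2_triangle[of "F N X" M "L2_diff M (T X) (F N X)"] X TX by simp
        also have "L2_norm M (L2_diff M (T X) (F N X)) \<le> 1 * L2_norm M X"
          using unif[OF N order_refl X] L2_norm_diff_commute[of "T X" M "F N X"] X TX by simp
        finally show ?thesis using op_norm_bound[OF F X, of N] by (simp add: distrib_right)
      qed
      then show ?thesis by blast
    qed
    ultimately show ?thesis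
      using T(1) by (simp add: bounded_ops_def T_def)
  qed
  have "(\<lambda>n. op_norm M (F n \<ominus>\<^bsub>op_algebra M\<^esub> T)) \<longlonglongrightarrow> 0"
  proof (rule LIMSEQ_I)
    fix e :: real assume "e > 0"
    then obtain N where N: "\<forall>m\<ge>N. \<forall>n\<ge>N. op_norm M (F m \<ominus>\<^bsub>op_algebra M\<^esub> F n) \<le> e / 2"
      using cauchy[of "e / 2"] by auto
    have "norm (op_norm M (F n \<ominus>\<^bsub>op_algebra M\<^esub> T) - 0) < e" if n: "n \<ge> N" for n
    proof -
      have "op_norm M (F n \<ominus>\<^bsub>op_algebra M\<^esub> T) \<le> e / 2"
        by (rule op_norm_le) (use unif[OF N n] \<open>e > 0\<close> op_diff[OF F T_in] in simp_all)
      moreover have "op_norm M (F n \<ominus>\<^bsub>op_algebra M\<^esub> T) \<ge> 0"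
        by (rule op_norm_nonneg[OF diff_in[OF F T_in]])
      ultimately show ?thesis using \<open>e > 0\<close> by simp
    qed
    then show "\<exists>no. \<forall>n\<ge>no. norm (op_norm M (F n \<ominus>\<^bsub>op_algebra M\<^esub> T) - 0) < e" by blast
  qed
  then show ?thesis using T_in by blast
qed

lemma banach_star_op_algebra: "banach_star_algebra (op_algebra M)"
proof -
  interpret ring "op_algebra M" by (rule ring_op_algebra)
  show ?thesis
  proof (unfold_locales, unfold op_algebra_simps(1,3-))
    fix S T c x assume *: "S \<in> bounded_ops M" "T \<in> bounded_ops M"
    note in_L2 = *[THEN bounded_ops_in]
    show "(\<lambda>X\<in>L2 M. L2_scale M c (S X)) \<in> bounded_ops M" by (rule op_scale_in[OF *(1)])
    show "op_adjoint M S \<in> bounded_ops M" by (rule op_adjoint_in[OF *(1)])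
    show "(\<lambda>X\<in>L2 M. L2_scale M c ((\<lambda>X\<in>L2 M. L2_add M (S X) (T X)) X))
      = (\<lambda>X\<in>L2 M. L2_add M ((\<lambda>X\<in>L2 M. L2_scale M c (S X)) X) ((\<lambda>X\<in>L2 M. L2_scale M c (T X)) X))"
      by (intro restrict_ext) (simp, rule L2_eqI[where M = M], simp_all add: in_L2 distrib_left)
    show "op_adjoint M (\<lambda>X\<in>L2 M. L2_add M (S X) (T X))
      = (\<lambda>X\<in>L2 M. L2_add M (op_adjoint M S X) (op_adjoint M T X))"
      by (rule op_adjoint_eqI) (simp_all add: op_add_in * in_L2 op_adjoint_right)
    show "0 \<le> op_norm M S" by (rule op_norm_nonneg[OF *(1)])
    show "S = (\<lambda>X\<in>L2 M. L2_zero M)" if "op_norm M S = 0"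
    proof (rule extensionalityI)
      show "S X = (\<lambda>X\<in>L2 M. L2_zero M) X" if X: "X \<in> L2 M" for X
        using op_norm_bound[OF *(1) X] \<open>op_norm M S = 0\<close> X L2_norm_nonneg[of M "S X"]
        by (simp add: in_L2 L2_norm_zero_iff[symmetric] del: L2_norm_nonneg)
    qed (use * in \<open>simp_all add: bounded_ops_extensional\<close>)
    show "op_norm M (\<lambda>X\<in>L2 M. L2_add M (S X) (T X)) \<le> op_norm M S + op_norm M T"
    proof (rule op_norm_le)
      fix X assume X: "X \<in> L2 M"
      show "L2_norm M ((\<lambda>X\<in>L2 M. L2_add M (S X) (T X)) X) \<le> (op_norm M S + op_norm M T) * L2_norm M X"
        using X in_L2 L2_triangle[of "S X" M "T X"] op_norm_bound[OF *(1) X] op_norm_bound[OF *(2) X]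
        by (simp add: distrib_right)
    qed (intro add_nonneg_nonneg op_norm_nonneg *)
    show "op_norm M (S \<otimes>\<^bsub>op_algebra M\<^esub> T) \<le> op_norm M S * op_norm M T"
    proof (rule op_norm_le)
      fix X assume X: "X \<in> L2 M"
      have "L2_norm M (S (T X)) \<le> op_norm M S * L2_norm M (T X)"
        using X in_L2 by (intro op_norm_bound *) auto
      also have "\<dots> \<le> op_norm M S * (op_norm M T * L2_norm M X)"
        using X * by (intro mult_left_mono op_norm_bound op_norm_nonneg) auto
      finally show "L2_norm M ((S \<otimes>\<^bsub>op_algebra M\<^esub> T) X) \<le> (op_norm M S * op_norm M T) * L2_norm M X"
        using X by (simp add: mult_ac)
    qed (intro mult_nonneg_nonneg op_norm_nonneg *)
    show "op_norm M (\<lambda>X\<in>L2 M. L2_scale M c (S X)) \<le> norm c * op_norm M S"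
      by (rule op_norm_le)
        (use op_norm_bound[OF *(1)] op_norm_nonneg[OF *(1)] in \<open>simp_all add: in_L2 mult.assoc mult_left_mono\<close>)
    show "op_norm M (op_adjoint M S) \<le> op_norm M S" by (rule op_norm_adjoint_le[OF *(1)])
  next
    show "op_norm M (\<lambda>X\<in>L2 M. L2_zero M) = 0"
      by (rule antisym[OF op_norm_le op_norm_nonneg[OF op_zero_in]]) auto
  qed (simp_all add: op_minus op_complete del: op_algebra_simps(2,5))
qed

subsection \<open>Bounded products\<close>

lemma bounded_product_simps [simp]:
  "carrier (bounded_product K B) = {F \<in> K \<rightarrow>\<^sub>E carrier B. bdd_above ((\<lambda>k. cnorm B (F k)) ` K)}"
  "mult (bounded_product K B) = (\<lambda>F G. \<lambda>k\<in>K. F k \<otimes>\<^bsub>B\<^esub> G k)"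
  "one (bounded_product K B) = (\<lambda>k\<in>K. \<one>\<^bsub>B\<^esub>)"
  "zero (bounded_product K B) = (\<lambda>k\<in>K. \<zero>\<^bsub>B\<^esub>)"
  "add (bounded_product K B) = (\<lambda>F G. \<lambda>k\<in>K. F k \<oplus>\<^bsub>B\<^esub> G k)"
  "smult (bounded_product K B) = (\<lambda>c F. \<lambda>k\<in>K. c \<odot>\<^bsub>B\<^esub> F k)"
  "star (bounded_product K B) = (\<lambda>F. \<lambda>k\<in>K. star B (F k))"
  "cnorm (bounded_product K B) = (\<lambda>F. SUP k\<in>K. cnorm B (F k))"
  by (simp_all add: bounded_product_def)

lemma bounded_product_carrierI:
  assumes "\<And>k. k \<in> K \<Longrightarrow> F k \<in> carrier B" "F \<in> extensional K" "\<And>k. k \<in> K \<Longrightarrow> cnorm B (F k) \<le> L"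
  shows "F \<in> carrier (bounded_product K B)"
  using assms by (auto simp: PiE_iff intro!: bdd_aboveI2)

lemma bounded_product_carrierD:
  assumes "F \<in> carrier (bounded_product K B)"
  shows "k \<in> K \<Longrightarrow> F k \<in> carrier B" "F \<in> extensional K"
    "k \<in> K \<Longrightarrow> cnorm B (F k) \<le> cnorm (bounded_product K B) F"
  using assms by (auto simp: PiE_iff intro!: cSUP_upper)

lemma bounded_product_eqI:
  assumes "F \<in> carrier (bounded_product K B)" "G \<in> carrier (bounded_product K B)"
    and "\<And>k. k \<in> K \<Longrightarrow> F k = G k"
  shows "F = G"
  using assms bounded_product_carrierD(2) by (intro extensionalityI[of _ K]) blast+

lemma bounded_product_norm_le:
  assumes "K \<noteq> {}" "\<And>k. k \<in> K \<Longrightarrow> cnorm B (F k) \<le> L"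
  shows "cnorm (bounded_product K B) F \<le> L"
  using assms by (auto intro!: cSUP_least)

text \<open>Everything is coordinatewise, and a Cauchy sequence converges uniformly in the
  coordinates. For an empty index set the supremum defining the norm would be an unspecified real
  number.\<close>

lemma banach_star_bounded_product:
  fixes B :: "'x cstar_alg" and K :: "'k set"
  assumes "banach_star_algebra B" and K: "K \<noteq> {}"
  shows "banach_star_algebra (bounded_product K B)"
proof -
  interpret banach_star_algebra B by fact
  let ?P = "bounded_product K B"
  note D = bounded_product_carrierD[where K = K and B = B]
  note norm_le = bounded_product_norm_le[OF K, of B]
  have nonneg: "0 \<le> cnorm ?P F" if "F \<in> carrier ?P" for F
  proof -
    obtain k where "k \<in> K" using K by auto
    then show ?thesis using norm_nonneg[of "F k"] D[OF that] by (meson order_trans)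
  qed
  have mult_le: "cnorm B (F k \<otimes>\<^bsub>B\<^esub> G k) \<le> cnorm ?P F * cnorm ?P G"
    if "F \<in> carrier ?P" "G \<in> carrier ?P" "k \<in> K" for F G k
  proof -
    have "cnorm B (F k \<otimes>\<^bsub>B\<^esub> G k) \<le> cnorm B (F k) * cnorm B (G k)"
      using that D by (intro norm_mult) auto
    also have "\<dots> \<le> cnorm ?P F * cnorm ?P G"
      using that D(1)[OF that(1,3)] D(1)[OF that(2,3)] by (intro mult_mono D(3) nonneg norm_nonneg)
    finally show ?thesis .
  qed
  have add_le: "cnorm B (F k \<oplus>\<^bsub>B\<^esub> G k) \<le> cnorm ?P F + cnorm ?P G"
    if "F \<in> carrier ?P" "G \<in> carrier ?P" "k \<in> K" for F G k
    using norm_add[OF D(1)[OF that(1,3)] D(1)[OF that(2,3)]] D(3)[OF that(1,3)] D(3)[OF that(2,3)]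
    by linarith
  have smult_le: "cnorm B (c \<odot>\<^bsub>B\<^esub> F k) \<le> norm c * cnorm ?P F"
    if "F \<in> carrier ?P" "k \<in> K" for F c k
    using norm_smult[OF D(1)[OF that], of c] mult_left_mono[OF D(3)[OF that], of "norm c"] by simp
  have star_le: "cnorm B (star B (F k)) \<le> cnorm ?P F" if "F \<in> carrier ?P" "k \<in> K" for F k
    using norm_star[OF D(1)[OF that]] D(3)[OF that] by linarith
  have add_in: "F \<oplus>\<^bsub>?P\<^esub> G \<in> carrier ?P" if "F \<in> carrier ?P" "G \<in> carrier ?P" for F G
    by (rule bounded_product_carrierI[where L = "cnorm ?P F + cnorm ?P G"])
      (simp_all add: D(1)[OF that(1)] D(1)[OF that(2)] add_le[OF that] del: bounded_product_simps(1,8))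
  have mult_in: "F \<otimes>\<^bsub>?P\<^esub> G \<in> carrier ?P" if "F \<in> carrier ?P" "G \<in> carrier ?P" for F G
    by (rule bounded_product_carrierI[where L = "cnorm ?P F * cnorm ?P G"])
      (simp_all add: D(1)[OF that(1)] D(1)[OF that(2)] mult_le[OF that] del: bounded_product_simps(1,8))
  have smult_in: "c \<odot>\<^bsub>?P\<^esub> F \<in> carrier ?P" if "F \<in> carrier ?P" for F c
    by (rule bounded_product_carrierI[where L = "norm c * cnorm ?P F"])
      (simp_all add: D(1)[OF that] smult_le[OF that] del: bounded_product_simps(1,8))
  have star_in: "star ?P F \<in> carrier ?P" if "F \<in> carrier ?P" for F
    by (rule bounded_product_carrierI[where L = "cnorm ?P F"])
      (simp_all add: D(1)[OF that] star_le[OF that] del: bounded_product_simps(1,8))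
  have zero_in: "\<zero>\<^bsub>?P\<^esub> \<in> carrier ?P" by (rule bounded_product_carrierI[where L = 0]) simp_all
  have one_in: "\<one>\<^bsub>?P\<^esub> \<in> carrier ?P"
    by (rule bounded_product_carrierI[where L = "cnorm B \<one>\<^bsub>B\<^esub>"]) simp_all
  have minus_add: "((-1) \<odot>\<^bsub>?P\<^esub> F) \<oplus>\<^bsub>?P\<^esub> F = \<zero>\<^bsub>?P\<^esub>" if "F \<in> carrier ?P" for F
    unfolding bounded_product_simps by (intro restrict_ext) (simp add: D(1)[OF that] smult_minus_one l_neg)
  have ring: "ring ?P"
  proof (rule ringI)
    show "abelian_group ?P"
    proof (rule abelian_groupI)
      fix F G H assume *: "F \<in> carrier ?P" "G \<in> carrier ?P" "H \<in> carrier ?P"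
      show "F \<oplus>\<^bsub>?P\<^esub> G \<oplus>\<^bsub>?P\<^esub> H = F \<oplus>\<^bsub>?P\<^esub> (G \<oplus>\<^bsub>?P\<^esub> H)"
        unfolding bounded_product_simps by (intro restrict_ext) (simp add: a_assoc *[THEN D(1)])
    next
      fix F G assume *: "F \<in> carrier ?P" "G \<in> carrier ?P"
      show "F \<oplus>\<^bsub>?P\<^esub> G = G \<oplus>\<^bsub>?P\<^esub> F"
        unfolding bounded_product_simps by (intro restrict_ext) (simp add: a_comm *[THEN D(1)])
    next
      fix F assume F: "F \<in> carrier ?P"
      show "\<zero>\<^bsub>?P\<^esub> \<oplus>\<^bsub>?P\<^esub> F = F"
        by (rule bounded_product_eqI[OF add_in[OF zero_in F] F]) (simp add: D(1)[OF F])
      show "\<exists>G\<in>carrier ?P. G \<oplus>\<^bsub>?P\<^esub> F = \<zero>\<^bsub>?P\<^esub>"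
        using minus_add[OF F] smult_in[OF F, of "-1"] by blast
    qed (intro add_in zero_in; assumption)+
    show "monoid ?P"
    proof (rule monoidI)
      fix F G H assume *: "F \<in> carrier ?P" "G \<in> carrier ?P" "H \<in> carrier ?P"
      show "F \<otimes>\<^bsub>?P\<^esub> G \<otimes>\<^bsub>?P\<^esub> H = F \<otimes>\<^bsub>?P\<^esub> (G \<otimes>\<^bsub>?P\<^esub> H)"
        unfolding bounded_product_simps by (intro restrict_ext) (simp add: m_assoc *[THEN D(1)])
    next
      fix F assume F: "F \<in> carrier ?P"
      show "\<one>\<^bsub>?P\<^esub> \<otimes>\<^bsub>?P\<^esub> F = F" 
        by (rule bounded_product_eqI[OF mult_in[OF one_in F] F]) (simp add: D(1)[OF F])
      show "F \<otimes>\<^bsub>?P\<^esub> \<one>\<^bsub>?P\<^esub> = F" 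
        by (rule bounded_product_eqI[OF mult_in[OF F one_in] F]) (simp add: D(1)[OF F])
    qed (intro mult_in one_in; assumption)+
  next
    fix F G H assume *: "F \<in> carrier ?P" "G \<in> carrier ?P" "H \<in> carrier ?P"
    show "(F \<oplus>\<^bsub>?P\<^esub> G) \<otimes>\<^bsub>?P\<^esub> H = F \<otimes>\<^bsub>?P\<^esub> H \<oplus>\<^bsub>?P\<^esub> G \<otimes>\<^bsub>?P\<^esub> H"
      unfolding bounded_product_simps by (intro restrict_ext) (simp add: l_distr *[THEN D(1)])
    show "H \<otimes>\<^bsub>?P\<^esub> (F \<oplus>\<^bsub>?P\<^esub> G) = H \<otimes>\<^bsub>?P\<^esub> F \<oplus>\<^bsub>?P\<^esub> H \<otimes>\<^bsub>?P\<^esub> G"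
      unfolding bounded_product_simps by (intro restrict_ext) (simp add: r_distr *[THEN D(1)])
  qed
  interpret P: ring ?P by (rule ring)
  have minus: "\<ominus>\<^bsub>?P\<^esub> F = (-1) \<odot>\<^bsub>?P\<^esub> F" if "F \<in> carrier ?P" for F
    by (rule P.minus_equality[OF minus_add[OF that] that smult_in[OF that]])
  have diff: "(F \<ominus>\<^bsub>?P\<^esub> G) k = F k \<ominus>\<^bsub>B\<^esub> G k" if "F \<in> carrier ?P" "G \<in> carrier ?P" "k \<in> K" for F G k
    unfolding P.minus_eq minus[OF that(2)] using that(3)
    by (simp add: minus_eq smult_minus_one D(1)[OF that(2)])
  show ?thesis
  proof (unfold_locales)
    fix F G c assume F: "F \<in> carrier ?P" and G: "G \<in> carrier ?P"
    note in_B = F[THEN D(1)] G[THEN D(1)]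
    show "c \<odot>\<^bsub>?P\<^esub> (F \<oplus>\<^bsub>?P\<^esub> G) = c \<odot>\<^bsub>?P\<^esub> F \<oplus>\<^bsub>?P\<^esub> c \<odot>\<^bsub>?P\<^esub> G"
      unfolding bounded_product_simps by (intro restrict_ext) (simp add: smult_add in_B)
    show "star ?P (F \<oplus>\<^bsub>?P\<^esub> G) = star ?P F \<oplus>\<^bsub>?P\<^esub> star ?P G"
      unfolding bounded_product_simps by (intro restrict_ext) (simp add: star_add in_B)
    show "cnorm ?P (F \<oplus>\<^bsub>?P\<^esub> G) \<le> cnorm ?P F + cnorm ?P G"
      by (rule norm_le) (simp add: add_le[OF F G] del: bounded_product_simps(1,8))
    show "cnorm ?P (F \<otimes>\<^bsub>?P\<^esub> G) \<le> cnorm ?P F * cnorm ?P G"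
      by (rule norm_le) (simp add: mult_le[OF F G] del: bounded_product_simps(1,8))
    show "cnorm ?P (c \<odot>\<^bsub>?P\<^esub> F) \<le> norm c * cnorm ?P F"
      by (rule norm_le) (simp add: smult_le[OF F] del: bounded_product_simps(1,8))
    show "cnorm ?P (star ?P F) \<le> cnorm ?P F"
      by (rule norm_le) (simp add: star_le[OF F] del: bounded_product_simps(1,8))
    show "0 \<le> cnorm ?P F" by (rule nonneg[OF F])
    show "(-1) \<odot>\<^bsub>?P\<^esub> F = \<ominus>\<^bsub>?P\<^esub> F" by (simp only: minus[OF F])
    show "c \<odot>\<^bsub>?P\<^esub> F \<in> carrier ?P" "star ?P F \<in> carrier ?P" by (rule smult_in[OF F] star_in[OF F])+
    show "F = \<zero>\<^bsub>?P\<^esub>" if "cnorm ?P F = 0"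
    proof (rule bounded_product_eqI[OF F zero_in])
      fix k assume k: "k \<in> K"
      have "cnorm B (F k) = 0"
        using D(3)[OF F k] norm_nonneg[OF D(1)[OF F k]] that by (simp only:)
      then show "F k = \<zero>\<^bsub>?P\<^esub> k" using norm_zeroD D(1)[OF F k] k by simp
    qed
  next
    show "cnorm ?P \<zero>\<^bsub>?P\<^esub> = 0" using K by simp
  next
    fix F :: "nat \<Rightarrow> 'k \<Rightarrow> 'x"
    assume F: "\<And>n. F n \<in> carrier ?P"
      and cauchy: "\<And>e. e > 0 \<Longrightarrow> \<exists>N. \<forall>m\<ge>N. \<forall>n\<ge>N. cnorm ?P (F m \<ominus>\<^bsub>?P\<^esub> F n) \<le> e"
    have le: "cnorm B (F m k \<ominus>\<^bsub>B\<^esub> F n k) \<le> cnorm ?P (F m \<ominus>\<^bsub>?P\<^esub> F n)" if "k \<in> K" for m n k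
      using D(3)[OF P.minus_closed[OF F F] that, of m n] unfolding diff[OF F F that] .
    have "\<exists>x\<in>carrier B. (\<lambda>n. cnorm B (F n k \<ominus>\<^bsub>B\<^esub> x)) \<longlonglongrightarrow> 0" if k: "k \<in> K" for k
    proof (rule complete)
      show "F n k \<in> carrier B" for n by (rule D(1)[OF F k])
      fix e :: real assume "e > 0"
      then obtain N where N: "\<forall>m\<ge>N. \<forall>n\<ge>N. cnorm ?P (F m \<ominus>\<^bsub>?P\<^esub> F n) \<le> e"
        using cauchy by blast
      have "cnorm B (F m k \<ominus>\<^bsub>B\<^esub> F n k) \<le> e" if "m \<ge> N" "n \<ge> N" for m n
        using le[OF k, of m n] N that order_trans by blast
      then show "\<exists>N. \<forall>m\<ge>N. \<forall>n\<ge>N. cnorm B (F m k \<ominus>\<^bsub>B\<^esub> F n k) \<le> e" by blast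
    qed
    then obtain G0 where G0: "\<And>k. k \<in> K \<Longrightarrow> G0 k \<in> carrier B"
      "\<And>k. k \<in> K \<Longrightarrow> (\<lambda>n. cnorm B (F n k \<ominus>\<^bsub>B\<^esub> G0 k)) \<longlonglongrightarrow> 0" by metis
    define G where "G = restrict G0 K"
    have G: "G k \<in> carrier B" "(\<lambda>n. cnorm B (F n k \<ominus>\<^bsub>B\<^esub> G k)) \<longlonglongrightarrow> 0" if "k \<in> K" for k
      using G0[OF that] that by (simp_all add: G_def)
    have unif: "cnorm B (F n k \<ominus>\<^bsub>B\<^esub> G k) \<le> e"
      if N: "\<forall>m\<ge>N. \<forall>n\<ge>N. cnorm ?P (F m \<ominus>\<^bsub>?P\<^esub> F n) \<le> e" and n: "n \<ge> N" and k: "k \<in> K" for N n e k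
    proof (rule LIMSEQ_le_const)
      show "(\<lambda>m. e + cnorm B (F m k \<ominus>\<^bsub>B\<^esub> G k)) \<longlonglongrightarrow> e"
        using tendsto_add[OF tendsto_const G(2)[OF k], of e] by simp
      show "\<exists>N. \<forall>m\<ge>N. cnorm B (F n k \<ominus>\<^bsub>B\<^esub> G k) \<le> e + cnorm B (F m k \<ominus>\<^bsub>B\<^esub> G k)"
      proof (intro exI[of _ N] allI impI)
        fix m assume m: "m \<ge> N"
        have "cnorm B (F n k \<ominus>\<^bsub>B\<^esub> F m k) \<le> e" using le[OF k, of n m] N n m order_trans by blast
        then show "cnorm B (F n k \<ominus>\<^bsub>B\<^esub> G k) \<le> e + cnorm B (F m k \<ominus>\<^bsub>B\<^esub> G k)"
          using dist_triangle[OF D(1)[OF F k] D(1)[OF F k] G(1)[OF k], of n m] by linarith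
      qed
    qed
    have G_in: "G \<in> carrier ?P"
    proof -
      obtain N where N: "\<forall>m\<ge>N. \<forall>n\<ge>N. cnorm ?P (F m \<ominus>\<^bsub>?P\<^esub> F n) \<le> 1"
        using cauchy[of 1] by auto
      show ?thesis
      proof (rule bounded_product_carrierI[where L = "cnorm ?P (F N) + 1"])
        fix k assume k: "k \<in> K"
        show "G k \<in> carrier B" by (rule G(1)[OF k])
        have "cnorm B (G k) \<le> cnorm B (F N k) + cnorm B (G k \<ominus>\<^bsub>B\<^esub> F N k)"
          by (rule norm_le_dist[OF G(1)[OF k] D(1)[OF F k]])
        also have "cnorm B (G k \<ominus>\<^bsub>B\<^esub> F N k) \<le> 1"
          using unif[OF N order_refl k] dist_commute[OF G(1)[OF k] D(1)[OF F k], of N] by simp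
        also have "cnorm B (F N k) \<le> cnorm ?P (F N)" by (rule D(3)[OF F k])
        finally show "cnorm B (G k) \<le> cnorm ?P (F N) + 1" by linarith
      qed (simp add: G_def)
    qed
    have "(\<lambda>n. cnorm ?P (F n \<ominus>\<^bsub>?P\<^esub> G)) \<longlonglongrightarrow> 0"
    proof (rule LIMSEQ_I)
      fix e :: real assume e: "e > 0"
      then obtain N where N: "\<forall>m\<ge>N. \<forall>n\<ge>N. cnorm ?P (F m \<ominus>\<^bsub>?P\<^esub> F n) \<le> e / 2"
        using cauchy[of "e / 2"] by auto
      have "norm (cnorm ?P (F n \<ominus>\<^bsub>?P\<^esub> G) - 0) < e" if n: "n \<ge> N" for n
      proof -
        have "cnorm ?P (F n \<ominus>\<^bsub>?P\<^esub> G) \<le> e / 2"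
          by (rule norm_le) (simp only: diff[OF F G_in] unif[OF N n])
        moreover have "cnorm ?P (F n \<ominus>\<^bsub>?P\<^esub> G) \<ge> 0"
          by (rule nonneg[OF P.minus_closed[OF F G_in]])
        ultimately show ?thesis using e unfolding real_norm_def by linarith
      qed
      then show "\<exists>no. \<forall>n\<ge>no. norm (cnorm ?P (F n \<ominus>\<^bsub>?P\<^esub> G) - 0) < e" by blast
    qed
    then show "\<exists>x\<in>carrier ?P. (\<lambda>n. cnorm ?P (F n \<ominus>\<^bsub>?P\<^esub> x)) \<longlonglongrightarrow> 0" using G_in by blast
  qed
qed

subsection \<open>Generated algebras\<close>

text \<open>Syntax trees, so that one polynomial can be evaluated in different algebras. There is no
  constant 1, because \<open>closed_star_subalgebra\<close> does not demand the unit;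
  \<open>unit_npoly\<close> expresses it through the generators.\<close>

datatype 'i npoly =
  PGen 'i | PZero | PAdd "'i npoly" "'i npoly" | PMul "'i npoly" "'i npoly"
| PScale complex "'i npoly" | PStar "'i npoly"

primrec npoly_eval :: "('x, 'r) cstar_alg_scheme \<Rightarrow> ('i \<Rightarrow> 'x) \<Rightarrow> 'i npoly \<Rightarrow> 'x" where
  "npoly_eval B g (PGen i) = g i"
| "npoly_eval B g PZero = \<zero>\<^bsub>B\<^esub>"
| "npoly_eval B g (PAdd p q) = npoly_eval B g p \<oplus>\<^bsub>B\<^esub> npoly_eval B g q"
| "npoly_eval B g (PMul p q) = npoly_eval B g p \<otimes>\<^bsub>B\<^esub> npoly_eval B g q"
| "npoly_eval B g (PScale c p) = c \<odot>\<^bsub>B\<^esub> npoly_eval B g p"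
| "npoly_eval B g (PStar p) = star B (npoly_eval B g p)"

lemma (in banach_star_algebra) npoly_eval_closed [simp]:
  assumes "\<And>i. g i \<in> carrier B"
  shows "npoly_eval B g p \<in> carrier B"
  using assms by (induction p) auto

lemma npoly_eval_closed_star_subalgebra:
  assumes "closed_star_subalgebra B C" "range g \<subseteq> C"
  shows "npoly_eval B g p \<in> C"
  using assms by (induction p) (auto simp: closed_star_subalgebra_def)

lemma npoly_eval_bounded_product:
  "k \<in> K \<Longrightarrow> npoly_eval (bounded_product K B) g p k = npoly_eval B (\<lambda>i. g i k) p"
  by (induction p) auto

text \<open>The closure of the pairs of values of a common polynomial, that is, the graph of the
  future isomorphism. As a relation it is symmetric in the two algebras, so every one-sided result
  can be used in both directions.\<close>

definition npoly_limit ::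
    "('x, 'r) cstar_alg_scheme \<Rightarrow> ('i \<Rightarrow> 'x) \<Rightarrow> ('y, 's) cstar_alg_scheme \<Rightarrow> ('i \<Rightarrow> 'y) \<Rightarrow> 'x \<Rightarrow> 'y \<Rightarrow> bool" where
  "npoly_limit B g C g' x y \<longleftrightarrow> x \<in> carrier B \<and> y \<in> carrier C \<and>
    (\<forall>e>0. \<exists>p. cnorm B (x \<ominus>\<^bsub>B\<^esub> npoly_eval B g p) \<le> e \<and> cnorm C (y \<ominus>\<^bsub>C\<^esub> npoly_eval C g' p) \<le> e)"

lemma npoly_limit_sym: "npoly_limit B g C g' x y \<longleftrightarrow> npoly_limit C g' B g y x"
  by (auto simp: npoly_limit_def)

locale isometric_generators =
  B: banach_star_algebra B + C: banach_star_algebra C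
  for B :: "('x, 'r) cstar_alg_scheme" and C :: "('y, 's) cstar_alg_scheme" +
  fixes g :: "'i \<Rightarrow> 'x" and g' :: "'i \<Rightarrow> 'y"
  assumes gB [simp]: "g i \<in> carrier B" and gC [simp]: "g' i \<in> carrier C"
    and isometric: "cnorm B (npoly_eval B g p) = cnorm C (npoly_eval C g' p)"
begin

lemma swap: "isometric_generators C B g' g"
  by unfold_locales (simp_all add: isometric)

abbreviation "evB \<equiv> npoly_eval B g"
abbreviation "evC \<equiv> npoly_eval C g'"
abbreviation lim (infix \<open>\<sim>\<close> 50) where "x \<sim> y \<equiv> npoly_limit B g C g' x y"

lemma limI:
  assumes "x \<in> carrier B" "y \<in> carrier C"
    and "\<And>e. e > 0 \<Longrightarrow> \<exists>p. cnorm B (x \<ominus>\<^bsub>B\<^esub> evB p) \<le> e \<and> cnorm C (y \<ominus>\<^bsub>C\<^esub> evC p) \<le> e"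
  shows "x \<sim> y"
  using assms by (auto simp: npoly_limit_def)

lemma limE:
  assumes "x \<sim> y" "e > 0"
  obtains p where "cnorm B (x \<ominus>\<^bsub>B\<^esub> evB p) \<le> e" "cnorm C (y \<ominus>\<^bsub>C\<^esub> evC p) \<le> e"
  using assms by (auto simp: npoly_limit_def)

lemma lim_closed: "x \<sim> y \<Longrightarrow> x \<in> carrier B" "x \<sim> y \<Longrightarrow> y \<in> carrier C"
  by (auto simp: npoly_limit_def)

lemma lim_eval: "evB p \<sim> evC p"
  by (rule limI) (auto simp: B.minus_eq B.r_neg C.minus_eq C.r_neg intro!: exI[of _ p])

text \<open>Both elements are close to the values of one polynomial, and these have equal
  norms.\<close>

lemma lim_norm_le:
  assumes "x \<sim> y"
  shows "cnorm B x \<le> cnorm C y"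
proof (rule field_le_epsilon)
  fix e :: real assume "e > 0"
  then obtain p where p: "cnorm B (x \<ominus>\<^bsub>B\<^esub> evB p) \<le> e / 2" "cnorm C (y \<ominus>\<^bsub>C\<^esub> evC p) \<le> e / 2"
    using limE[OF assms, of "e / 2"] by auto
  have "cnorm C (evC p) \<le> cnorm C y + e / 2"
    using C.norm_le_dist[of "evC p" y] C.dist_commute[of "evC p" y] p lim_closed[OF assms] by simp
  moreover have "cnorm B x \<le> cnorm B (evB p) + e / 2"
    using B.norm_le_dist[of x "evB p"] p lim_closed[OF assms] by simp
  ultimately show "cnorm B x \<le> cnorm C y + e" using isometric[of p] by simp
qed

lemma lim_norm: "x \<sim> y \<Longrightarrow> cnorm B x = cnorm C y"
  using lim_norm_le isometric_generators.lim_norm_le[OF swap, of y x]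
  by (auto simp: npoly_limit_sym[of C] intro: antisym)

lemma lim_add:
  assumes "x \<sim> y" "x' \<sim> y'"
  shows "x \<oplus>\<^bsub>B\<^esub> x' \<sim> y \<oplus>\<^bsub>C\<^esub> y'"
proof (rule limI)
  fix e :: real assume "e > 0"
  then obtain p q where p: "cnorm B (x \<ominus>\<^bsub>B\<^esub> evB p) \<le> e / 2" "cnorm C (y \<ominus>\<^bsub>C\<^esub> evC p) \<le> e / 2"
    and q: "cnorm B (x' \<ominus>\<^bsub>B\<^esub> evB q) \<le> e / 2" "cnorm C (y' \<ominus>\<^bsub>C\<^esub> evC q) \<le> e / 2"
    using limE[OF assms(1), of "e / 2"] limE[OF assms(2), of "e / 2"] by (metis half_gt_zero)
  show "\<exists>p. cnorm B (x \<oplus>\<^bsub>B\<^esub> x' \<ominus>\<^bsub>B\<^esub> evB p) \<le> e \<and> cnorm C (y \<oplus>\<^bsub>C\<^esub> y' \<ominus>\<^bsub>C\<^esub> evC p) \<le> e"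
    using B.dist_add[of x x' "evB p" "evB q"] C.dist_add[of y y' "evC p" "evC q"] p q
      lim_closed[OF assms(1)] lim_closed[OF assms(2)]
    by (intro exI[of _ "PAdd p q"]) auto
qed (use lim_closed[OF assms(1)] lim_closed[OF assms(2)] in auto)

lemma lim_smult:
  assumes "x \<sim> y"
  shows "c \<odot>\<^bsub>B\<^esub> x \<sim> c \<odot>\<^bsub>C\<^esub> y"
proof (rule limI)
  fix e :: real assume e: "e > 0"
  define d where "d = e / (norm c + 1)"
  have "norm c + 1 > 0" using norm_ge_zero[of c] by linarith
  then have d: "d > 0" "norm c * d \<le> e" using e by (auto simp: d_def field_simps)
  obtain p where p: "cnorm B (x \<ominus>\<^bsub>B\<^esub> evB p) \<le> d" "cnorm C (y \<ominus>\<^bsub>C\<^esub> evC p) \<le> d"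
    using limE[OF assms d(1)] by auto
  have "norm c * cnorm B (x \<ominus>\<^bsub>B\<^esub> evB p) \<le> e" "norm c * cnorm C (y \<ominus>\<^bsub>C\<^esub> evC p) \<le> e"
    using d(2) mult_left_mono[OF p(1), of "norm c"] mult_left_mono[OF p(2), of "norm c"] by auto
  then show "\<exists>p. cnorm B (c \<odot>\<^bsub>B\<^esub> x \<ominus>\<^bsub>B\<^esub> evB p) \<le> e \<and> cnorm C (c \<odot>\<^bsub>C\<^esub> y \<ominus>\<^bsub>C\<^esub> evC p) \<le> e"
    using B.dist_smult[of x "evB p" c] C.dist_smult[of y "evC p" c] lim_closed[OF assms]
    by (intro exI[of _ "PScale c p"]) auto
qed (use lim_closed[OF assms(1)] in auto)

lemma lim_star:
  assumes "x \<sim> y"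
  shows "star B x \<sim> star C y"
proof (rule limI)
  fix e :: real assume e: "e > 0"
  obtain p where p: "cnorm B (x \<ominus>\<^bsub>B\<^esub> evB p) \<le> e" "cnorm C (y \<ominus>\<^bsub>C\<^esub> evC p) \<le> e"
    using limE[OF assms e] by auto
  then show "\<exists>p. cnorm B (star B x \<ominus>\<^bsub>B\<^esub> evB p) \<le> e \<and> cnorm C (star C y \<ominus>\<^bsub>C\<^esub> evC p) \<le> e"
    using B.dist_star[of x "evB p"] C.dist_star[of y "evC p"] lim_closed[OF assms]
    by (intro exI[of _ "PStar p"]) auto
qed (use lim_closed[OF assms(1)] in auto)

lemma lim_mult:
  assumes "x \<sim> y" "x' \<sim> y'"
  shows "x \<otimes>\<^bsub>B\<^esub> x' \<sim> y \<otimes>\<^bsub>C\<^esub> y'"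
proof (rule limI)
  note cl [simp] = lim_closed[OF assms(1)] lim_closed[OF assms(2)]
  fix e :: real assume e: "e > 0"
  \<comment> \<open>With errors \<open>d \<le> 1\<close> in both factors, \<open>dist_mult\<close>
    gives at most \<open>d\<close> times the norm of \<open>x'\<close> plus \<open>d\<close> times
    the norm of \<open>x\<close> plus \<open>d * d\<close>, hence at most \<open>d * L\<close>.
    Related elements have equal norms, so the same \<open>L\<close> serves in
    \<open>C\<close>.\<close>
  define L where "L = cnorm B x + cnorm B x' + 1"
  have L: "L > 0" using B.norm_nonneg[of x] B.norm_nonneg[of x'] by (simp add: L_def)
  define d where "d = min 1 (e / L)"
  have d: "d > 0" "d \<le> 1" "d * L \<le> e" using e L
    by (auto simp: d_def min_def field_simps)
  obtain p q where p: "cnorm B (x \<ominus>\<^bsub>B\<^esub> evB p) \<le> d" "cnorm C (y \<ominus>\<^bsub>C\<^esub> evC p) \<le> d"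
    and q: "cnorm B (x' \<ominus>\<^bsub>B\<^esub> evB q) \<le> d" "cnorm C (y' \<ominus>\<^bsub>C\<^esub> evC q) \<le> d"
    using limE[OF assms(1) d(1)] limE[OF assms(2) d(1)] by metis
  have bound: "u * a + b * v \<le> e"
    if "0 \<le> u" "u \<le> d" "0 \<le> v" "v \<le> d" "b \<le> cnorm B x + d" "a = cnorm B x'" "0 \<le> b" "0 \<le> a" for u v a b
  proof -
    have "u * a + b * v \<le> d * a + (cnorm B x + 1) * d"
      using that d by (intro add_mono mult_mono) auto
    also have "\<dots> = d * L" using that by (simp add: L_def algebra_simps)
    finally show ?thesis using d(3) by simp
  qed
  have "cnorm B (evB p) \<le> cnorm B x + d" "cnorm C (evC p) \<le> cnorm B x + d"
    using B.norm_le_dist[of "evB p" x] B.dist_commute[of "evB p" x] p isometric[of p] by auto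
  then have "cnorm B (x \<otimes>\<^bsub>B\<^esub> x' \<ominus>\<^bsub>B\<^esub> evB p \<otimes>\<^bsub>B\<^esub> evB q) \<le> e"
    "cnorm C (y \<otimes>\<^bsub>C\<^esub> y' \<ominus>\<^bsub>C\<^esub> evC p \<otimes>\<^bsub>C\<^esub> evC q) \<le> e"
    using p q lim_norm[OF assms(2)]
    by - (rule order_trans[OF B.dist_mult bound] order_trans[OF C.dist_mult bound];
        simp add: B.norm_nonneg C.norm_nonneg)+
  then show "\<exists>p. cnorm B (x \<otimes>\<^bsub>B\<^esub> x' \<ominus>\<^bsub>B\<^esub> evB p) \<le> e \<and> cnorm C (y \<otimes>\<^bsub>C\<^esub> y' \<ominus>\<^bsub>C\<^esub> evC p) \<le> e"
    by (intro exI[of _ "PMul p q"]) auto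
qed (use lim_closed[OF assms(1)] lim_closed[OF assms(2)] in auto)

lemma lim_diff:
  assumes "x \<sim> y" "x' \<sim> y'"
  shows "x \<ominus>\<^bsub>B\<^esub> x' \<sim> y \<ominus>\<^bsub>C\<^esub> y'"
  using lim_add[OF assms(1) lim_smult[OF assms(2), of "-1"]]
  by (simp add: B.minus_eq C.minus_eq B.smult_minus_one C.smult_minus_one lim_closed[OF assms(2)])

text \<open>The relation is compatible with differences, so zero is related to \<open>y\<close>
  minus \<open>y'\<close>, whose norm must vanish.\<close>

lemma lim_unique:
  assumes "x \<sim> y" "x \<sim> y'"
  shows "y = y'"
proof (rule C.eq_of_dist_zero)
  show "cnorm C (y \<ominus>\<^bsub>C\<^esub> y') = 0"
    using lim_norm[OF lim_diff[OF assms]] lim_closed[OF assms(1)] by (simp add: B.minus_eq B.r_neg)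
qed (use lim_closed assms in auto)

text \<open>Differences of the \<open>F n\<close> are related to differences of the
  \<open>G n\<close> and have the same norms. Thus \<open>G\<close> is Cauchy, and its limit is the
  partner of \<open>x\<close>.\<close>

lemma lim_complete:
  assumes F: "\<And>n. F n \<sim> G n" and x: "x \<in> carrier B"
    and conv: "(\<lambda>n::nat. cnorm B (F n \<ominus>\<^bsub>B\<^esub> x)) \<longlonglongrightarrow> 0"
  shows "\<exists>y. x \<sim> y"
proof -
  note cl [simp] = lim_closed[OF F]
  have small: "\<exists>N. \<forall>n\<ge>N. cnorm B (F n \<ominus>\<^bsub>B\<^esub> x) \<le> e" if "e > 0" for e
    using LIMSEQ_D[OF conv that] by (metis abs_le_D1 diff_zero less_imp_le real_norm_def)
  have "\<exists>y\<in>carrier C. (\<lambda>n. cnorm C (G n \<ominus>\<^bsub>C\<^esub> y)) \<longlonglongrightarrow> 0"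
  proof (rule C.complete)
    fix e :: real assume "e > 0"
    then obtain N where N: "\<And>n. n \<ge> N \<Longrightarrow> cnorm B (F n \<ominus>\<^bsub>B\<^esub> x) \<le> e / 2"
      using small[of "e / 2"] by auto
    have "cnorm C (G m \<ominus>\<^bsub>C\<^esub> G n) \<le> e" if "m \<ge> N" "n \<ge> N" for m n
      using lim_norm[OF lim_diff[OF F F], of m n] B.dist_triangle[of "F m" x "F n"] N[OF that(1)] N[OF that(2)]
        B.dist_commute[of x "F n"] x by simp
    then show "\<exists>N. \<forall>m\<ge>N. \<forall>n\<ge>N. cnorm C (G m \<ominus>\<^bsub>C\<^esub> G n) \<le> e" by blast
  qed simp
  then obtain y where y: "y \<in> carrier C" and lim: "(\<lambda>n. cnorm C (G n \<ominus>\<^bsub>C\<^esub> y)) \<longlonglongrightarrow> 0" by auto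
  have "x \<sim> y"
  proof (rule limI)
    fix e :: real assume e: "e > 0"
    obtain N where N: "\<And>n. n \<ge> N \<Longrightarrow> cnorm B (F n \<ominus>\<^bsub>B\<^esub> x) \<le> e / 2"
      using small[of "e / 2"] e by auto
    obtain N' where N': "\<And>n. n \<ge> N' \<Longrightarrow> norm (cnorm C (G n \<ominus>\<^bsub>C\<^esub> y) - 0) < e / 2"
      using LIMSEQ_D[OF lim, of "e / 2"] e by auto
    define n where "n = max N N'"
    obtain p where p: "cnorm B (F n \<ominus>\<^bsub>B\<^esub> evB p) \<le> e / 2" "cnorm C (G n \<ominus>\<^bsub>C\<^esub> evC p) \<le> e / 2"
      using limE[OF F, of "e / 2" n] e by auto
    have "cnorm B (x \<ominus>\<^bsub>B\<^esub> evB p) \<le> e"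
      using B.dist_triangle[of x "F n" "evB p"] B.dist_commute[of x "F n"] p N[of n] x by (simp add: n_def)
    moreover have "cnorm C (y \<ominus>\<^bsub>C\<^esub> evC p) \<le> e"
      using C.dist_triangle[of y "G n" "evC p"] C.dist_commute[of y "G n"] p N'[of n] y by (simp add: n_def)
    ultimately show "\<exists>p. cnorm B (x \<ominus>\<^bsub>B\<^esub> evB p) \<le> e \<and> cnorm C (y \<ominus>\<^bsub>C\<^esub> evC p) \<le> e" by blast
  qed (use x y in auto)
  then show ?thesis by blast
qed

text \<open>The domain of the relation is itself a closed star subalgebra containing the generators,
  hence contains the generated one. Conversely, each of its elements is a limit of polynomials,
  which lie in every such subalgebra.\<close>

lemma carrier_generated:
  "carrier (generated_cstar_algebra B (range g)) = {x. \<exists>y. x \<sim> y}"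
proof (intro equalityI subsetI)
  fix x assume x: "x \<in> carrier (generated_cstar_algebra B (range g))"
  have "closed_star_subalgebra B {x. \<exists>y. x \<sim> y}"
    unfolding closed_star_subalgebra_def
  proof (intro conjI ballI allI impI)
    show "{x. \<exists>y. x \<sim> y} \<subseteq> carrier B" using lim_closed by auto
    show "\<zero>\<^bsub>B\<^esub> \<in> {x. \<exists>y. x \<sim> y}" using lim_eval[of PZero] by auto
    show "x \<in> {x. \<exists>y. x \<sim> y}" if F: "(\<forall>n. F n \<in> {x. \<exists>y. x \<sim> y}) \<and> x \<in> carrier B \<and>
        (\<lambda>n. cnorm B (F n \<ominus>\<^bsub>B\<^esub> x)) \<longlonglongrightarrow> 0" for F x
    proof -
      from F obtain G where G: "\<And>n. F n \<sim> G n" by (auto simp: choice_iff)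
      have "\<exists>y. x \<sim> y"
        by (rule lim_complete[of F G x]) (simp_all add: F G)
      then show ?thesis by simp
    qed
  qed (use lim_add lim_mult lim_smult lim_star in blast)+
  moreover have "range g \<subseteq> {x. \<exists>y. x \<sim> y}"
  proof (rule image_subsetI)
    show "g i \<in> {x. \<exists>y. x \<sim> y}" for i using lim_eval[of "PGen i"] by auto
  qed
  ultimately show "x \<in> {x. \<exists>y. x \<sim> y}" using x by (auto simp: generated_cstar_algebra_def)
next
  fix x assume "x \<in> {x. \<exists>y. x \<sim> y}"
  then obtain y where y: "x \<sim> y" by auto
  have x: "x \<in> carrier B" using lim_closed y by auto
  have "x \<in> D" if D: "closed_star_subalgebra B D" "range g \<subseteq> D" for D
  proof -
    have "\<exists>p. cnorm B (x \<ominus>\<^bsub>B\<^esub> evB p) \<le> 1 / real (Suc n)" for n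
      using limE[OF y, of "1 / real (Suc n)"] by auto
    then obtain p where p: "\<And>n. cnorm B (x \<ominus>\<^bsub>B\<^esub> evB (p n)) \<le> 1 / real (Suc n)" by metis
    have "(\<lambda>n. cnorm B (evB (p n) \<ominus>\<^bsub>B\<^esub> x)) \<longlonglongrightarrow> 0"
    proof (rule tendsto_sandwich[where f = "\<lambda>_. 0"])
      show "(\<lambda>n. 1 / real (Suc n)) \<longlonglongrightarrow> 0" using LIMSEQ_Suc[OF lim_1_over_n] .
      show "\<forall>\<^sub>F n in sequentially. cnorm B (evB (p n) \<ominus>\<^bsub>B\<^esub> x) \<le> 1 / real (Suc n)"
        using p x by (intro always_eventually) (simp add: B.dist_commute[of _ x])
    qed (use x in \<open>auto simp: B.norm_nonneg\<close>)
    moreover have "\<forall>n. evB (p n) \<in> D" using npoly_eval_closed_star_subalgebra[OF D] by blast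
    moreover have "\<forall>F x. (\<forall>n. F n \<in> D) \<and> x \<in> carrier B \<and>
        (\<lambda>n::nat. cnorm B (F n \<ominus>\<^bsub>B\<^esub> x)) \<longlonglongrightarrow> 0 \<longrightarrow> x \<in> D"
      using D(1) unfolding closed_star_subalgebra_def by (elim conjE)
    ultimately show ?thesis using x by simp
  qed
  then show "x \<in> carrier (generated_cstar_algebra B (range g))"
    using x by (auto simp: generated_cstar_algebra_def)
qed

end

text \<open>The relation is the graph of a bijection by \<open>lim_unique\<close> in both
  directions. Ring homomorphisms preserve the unit, which is why a polynomial \<open>u\<close> with
  value 1 in both algebras is required.\<close>

lemma star_isomorphic_generated:
  assumes "isometric_generators B C g g'"
    and one: "npoly_eval B g u = \<one>\<^bsub>B\<^esub>" "npoly_eval C g' u = \<one>\<^bsub>C\<^esub>"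
  shows "star_isomorphic (generated_cstar_algebra B (range g)) (generated_cstar_algebra C (range g'))"
proof -
  interpret isometric_generators B C g g' by fact
  interpret S: isometric_generators C B g' g by (rule swap)
  let ?B = "generated_cstar_algebra B (range g)" and ?C = "generated_cstar_algebra C (range g')"
  define h where "h x = (THE y. x \<sim> y)" for x
  have hI: "h x = y" if "x \<sim> y" for x y
    unfolding h_def using that lim_unique by blast
  have h: "x \<sim> h x" if "x \<in> carrier ?B" for x
    using that hI unfolding carrier_generated by auto
  have C: "carrier ?C = {y. \<exists>x. x \<sim> y}"
    unfolding S.carrier_generated by (intro Collect_cong ex_cong1 npoly_limit_sym)
  have simps: "mult ?B = mult B" "add ?B = add B" "one ?B = one B" "star ?B = star B" "smult ?B = smult B"
    "mult ?C = mult C" "add ?C = add C" "one ?C = one C" "star ?C = star C" "smult ?C = smult C"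
    by (simp_all add: generated_cstar_algebra_def)
  have "h \<in> ring_hom ?B ?C"
  proof (rule ring_hom_memI, unfold simps)
    show "h x \<in> carrier ?C" if "x \<in> carrier ?B" for x using h[OF that] C by auto
    show "h \<one>\<^bsub>B\<^esub> = \<one>\<^bsub>C\<^esub>" using lim_eval[of u] one by (intro hI) simp
  qed (intro hI lim_add lim_mult h; assumption)+
  moreover have "bij_betw h (carrier ?B) (carrier ?C)"
  proof (rule bij_betwI')
    fix x x' assume *: "x \<in> carrier ?B" "x' \<in> carrier ?B"
    show "h x = h x' \<longleftrightarrow> x = x'"
      using h[OF *(1)] h[OF *(2)] S.lim_unique by (metis npoly_limit_sym)
  next
    show "\<exists>x\<in>carrier ?B. y = h x" if "y \<in> carrier ?C" for y
      using that hI unfolding C carrier_generated by blast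
  qed (use h C in auto)
  moreover have "h (c \<odot>\<^bsub>?B\<^esub> x) = c \<odot>\<^bsub>?C\<^esub> h x" if "x \<in> carrier ?B" for c x
    unfolding simps by (intro hI lim_smult h that)
  moreover have "h (star ?B x) = star ?C (h x)" if "x \<in> carrier ?B" for x
    unfolding simps by (intro hI lim_star h that)
  ultimately show ?thesis unfolding star_isomorphic_def ring_iso_def by blast
qed

section \<open>Admissible words\<close>

abbreviation admissible :: "nat^'i^'i \<Rightarrow> 'i list \<Rightarrow> bool" where
  "admissible A \<equiv> successively (\<lambda>i j. A $ i $ j = 1)"

lemma zero_one_cases: "zero_one_matrix A \<Longrightarrow> A $ i $ j = 0 \<or> A $ i $ j = 1"
  by (auto simp: zero_one_matrix_def)

text \<open>Entries of the power count paths; \<open>n\<close> edges visit \<open>Suc n\<close>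
  vertices.\<close>

lemma matrix_power_path:
  fixes A :: "nat^'i::finite^'i"
  assumes "zero_one_matrix A" "(((**) A ^^ n) (mat 1)) $ i $ j > 0"
  shows "\<exists>w. length w = Suc n \<and> admissible A w \<and> hd w = i \<and> last w = j"
  using assms(2)
proof (induction n arbitrary: i)
  case 0
  then show ?case by (intro exI[of _ "[i]"]) (auto simp: mat_def split: if_splits)
next
  case (Suc n)
  have "(A ** B) $ i $ j = (\<Sum>k\<in>UNIV. A $ i $ k * B $ k $ j)" for B
    by (simp add: matrix_matrix_mult_def)
  then have "(\<Sum>k\<in>UNIV. A $ i $ k * (((**) A ^^ n) (mat 1)) $ k $ j) \<noteq> 0"
    using Suc.prems by (metis funpow.simps(2) comp_apply less_irrefl)
  then obtain k where k: "A $ i $ k * (((**) A ^^ n) (mat 1)) $ k $ j \<noteq> 0"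
    by (meson sum.neutral)
  then obtain w where w: "length w = Suc n" "admissible A w" "hd w = k" "last w = j"
    using Suc.IH[of k] by auto
  moreover have "A $ i $ k = 1" using k zero_one_cases[OF assms(1), of i k] by auto
  ultimately show ?case by (intro exI[of _ "i # w"]) (cases w, auto)
qed

lemma admissible_extend:
  fixes A :: "nat^'i::finite^'i"
  assumes "zero_one_matrix A" "irreducible_matrix A" "admissible A w" "w \<noteq> []"
  shows "\<exists>v. v \<noteq> [] \<and> admissible A (w @ v) \<and> last (w @ v) = j"
proof -
  obtain n where n: "n \<ge> 1" "(((**) A ^^ n) (mat 1)) $ (last w) $ j > 0"
    using assms(2) by (auto simp: irreducible_matrix_def)
  obtain x where x: "length x = Suc n" "admissible A x" "hd x = last w" "last x = j"
    using matrix_power_path[OF assms(1) n(2)] by blast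
  obtain y v where xv: "x = last w # y # v"
    using x n(1) by (cases x; cases "tl x") auto
  show ?thesis using x assms(3,4) by (intro exI[of _ "y # v"]) (auto simp: xv successively_append_iff)
qed

lemma admissible_extend_long:
  fixes A :: "nat^'i::finite^'i"
  assumes "zero_one_matrix A" "irreducible_matrix A" "admissible A w" "w \<noteq> []"
  shows "\<exists>v. admissible A (w @ v) \<and> length (w @ v) \<ge> n"
proof (induction n)
  case 0
  then show ?case using assms by (intro exI[of _ "[]"]) simp
next
  case (Suc n)
  then obtain v where v: "admissible A (w @ v)" "length (w @ v) \<ge> n" by auto
  obtain v' where v': "v' \<noteq> []" "admissible A ((w @ v) @ v')"
    using admissible_extend[OF assms(1,2) v(1)] assms(4) by blast
  have "length v' \<ge> 1" using v'(1) by (cases v') auto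
  then show ?case using v v' by (intro exI[of _ "v @ v'"]) auto
qed

text \<open>If no row had two entries 1, the matrix would be the graph of a function. Nonzero
  columns make it surjective, hence a permutation of the finite index set.\<close>

lemma branching_vertex:
  fixes A :: "nat^'i::finite^'i"
  assumes A: "zero_one_matrix A" "\<not> permutation_matrix A"
  shows "\<exists>v b c. b \<noteq> c \<and> A $ v $ b = 1 \<and> A $ v $ c = 1"
proof (rule ccontr)
  assume *: "\<not> ?thesis"
  have "\<forall>i. \<exists>j. A $ i $ j = 1" using A by (auto simp: zero_one_matrix_def)
  then obtain \<pi> where \<pi>: "\<And>i. A $ i $ \<pi> i = 1" by metis
  have eq: "A $ i $ j = (if j = \<pi> i then 1 else 0)" for i j
    using * \<pi>[of i] zero_one_cases[OF A(1), of i j] by auto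
  have "surj \<pi>"
  proof (rule surjI)
    fix j
    have "\<exists>i. A $ i $ j = 1" using A by (auto simp: zero_one_matrix_def)
    then have "A $ (SOME i. A $ i $ j = 1) $ j = 1" by (rule someI_ex)
    then show "\<pi> (SOME i. A $ i $ j = 1) = j"
      using eq[of "SOME i. A $ i $ j = 1" j] by (metis zero_neq_one)
  qed
  then have "\<pi> permutes UNIV"
    by (intro bij_imp_permutes) (auto simp: bij_def finite_UNIV_surj_inj)
  then show False using A(2) eq by (auto simp: permutation_matrix_def)
qed

text \<open>A mismatch of the word with its shift by \<open>p\<close>, witnessed inside the word and
  therefore stable under appending letters. It separates \<open>x @ \<gamma>\<close> from
  \<open>y @ \<gamma>\<close> when the lengths of \<open>x\<close> and \<open>y\<close> differ by
  \<open>p\<close>.\<close>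

definition aperiodic :: "nat \<Rightarrow> 'i list \<Rightarrow> bool" where
  "aperiodic p w \<longleftrightarrow> (\<exists>t. t + p < length w \<and> w ! (t + p) \<noteq> w ! t)"

lemma aperiodic_append: "aperiodic p w \<Longrightarrow> aperiodic p (w @ v)"
  unfolding aperiodic_def by (metis add_lessD1 length_append nth_append trans_less_add1)

text \<open>A sufficiently long word ending at a branching vertex has two one-letter extensions, and the
  next letter prescribed by a period \<open>p\<close> can agree with at most one of them.\<close>

lemma aperiodic_extend:
  fixes A :: "nat^'i::finite^'i"
  assumes A: "zero_one_matrix A" "irreducible_matrix A" "\<not> permutation_matrix A"
    and w: "admissible A w" "w \<noteq> []" and p: "p \<ge> 1"
  shows "\<exists>v. admissible A (w @ v) \<and> aperiodic p (w @ v)"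
proof -
  obtain y b c where br: "b \<noteq> c" "A $ y $ b = 1" "A $ y $ c = 1"
    using branching_vertex[OF A(1,3)] by blast
  obtain v where v: "admissible A (w @ v)" "length (w @ v) \<ge> p"
    using admissible_extend_long[OF A(1,2) w] by blast
  obtain v' where v': "admissible A ((w @ v) @ v')" "last ((w @ v) @ v') = y"
    using admissible_extend[OF A(1,2) v(1)] w(2) by blast
  define x where "x = (w @ v) @ v'"
  have x: "admissible A x" "last x = y" "length x \<ge> p" "x \<noteq> []"
    using v v' w(2) by (auto simp: x_def)
  have "aperiodic p (x @ [b]) \<or> aperiodic p (x @ [c])"
  proof (rule ccontr)
    assume "\<not> ?thesis"
    then have per: "\<And>t. t + p < length (x @ [b]) \<Longrightarrow> (x @ [b]) ! (t + p) = (x @ [b]) ! t"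
      "\<And>t. t + p < length (x @ [c]) \<Longrightarrow> (x @ [c]) ! (t + p) = (x @ [c]) ! t"
      unfolding aperiodic_def by blast+
    \<comment> \<open>The compared position is that of the appended letter. As \<open>p\<close> is
      at least 1, the position \<open>p\<close> steps before lies in \<open>x\<close>, where both
      extensions agree.\<close>
    have "(x @ [b]) ! (length x - p + p) = (x @ [b]) ! (length x - p)"
      "(x @ [c]) ! (length x - p + p) = (x @ [c]) ! (length x - p)"
      by (rule per(1), use x(3) in simp, rule per(2), use x(3) in simp)
    moreover have "length x - p < length x" using p x(3) by auto
    ultimately show False using br(1) x(3) by (simp add: nth_append)
  qed
  moreover have "admissible A (x @ [b])" "admissible A (x @ [c])"
    using x br by (auto simp: successively_append_iff)
  ultimately have "\<exists>d. admissible A (x @ [d]) \<and> aperiodic p (x @ [d])" by blast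
  then show ?thesis unfolding x_def by (metis append.assoc)
qed

text \<open>The periods are destroyed one at a time; by \<open>aperiodic_append\<close> the
  mismatches found earlier survive.\<close>

lemma aperiodic_word:
  fixes A :: "nat^'i::finite^'i"
  assumes A: "zero_one_matrix A" "irreducible_matrix A" "\<not> permutation_matrix A"
  shows "\<exists>w. w \<noteq> [] \<and> hd w = j \<and> admissible A w \<and> (\<forall>p\<in>{1..P}. aperiodic p w)"
proof (induction P)
  case 0
  then show ?case by (intro exI[of _ "[j]"]) auto
next
  case (Suc P)
  then obtain w where w: "w \<noteq> []" "hd w = j" "admissible A w" "\<forall>p\<in>{1..P}. aperiodic p w" by blast
  obtain v where v: "admissible A (w @ v)" "aperiodic (Suc P) (w @ v)"
    using aperiodic_extend[OF A w(3,1), of "Suc P"] by auto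
  have "\<forall>p\<in>{1..Suc P}. aperiodic p (w @ v)"
    using w(4) v(2) by (auto simp: aperiodic_append le_Suc_eq)
  then show ?case using w v by (intro exI[of _ "w @ v"]) auto
qed

text \<open>A letter \<open>(i, b)\<close> stands for the generator with index \<open>i\<close>, or its adjoint if \<open>b\<close> holds. It acts on
  nonempty words by prepending or deleting \<open>i\<close>, the result \<open>None\<close> standing for zero.\<close>

definition letter_act :: "nat^'i^'i \<Rightarrow> 'i \<times> bool \<Rightarrow> 'i list \<Rightarrow> 'i list option" where
  "letter_act A l w = (if snd l then (if hd w = fst l then Some (tl w) else None)
     else (if A $ fst l $ hd w = 1 then Some (fst l # w) else None))"

primrec word_act :: "nat^'i^'i \<Rightarrow> ('i \<times> bool) list \<Rightarrow> 'i list \<Rightarrow> 'i list option" where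
  "word_act A [] w = Some w"
| "word_act A (l # u) w = Option.bind (word_act A u w) (letter_act A l)"

text \<open>Each letter of \<open>u\<close> removes at most one letter of the word. As
  \<open>u\<close> is shorter than \<open>w\<close>, the last letter is never reached.\<close>

lemma word_act_Some:
  assumes "word_act A u w = Some w'" "length u < length w" "admissible A w"
  shows "admissible A w' \<and> last w' = last w \<and> length w \<le> length w' + length u
    \<and> length w' \<le> length w + length u"
  using assms(1,2)
proof (induction u arbitrary: w')
  case Nil
  then show ?case using assms(3) by simp
next
  case (Cons l u)
  obtain v where v: "word_act A u w = Some v" "letter_act A l v = Some w'"
    using Cons.prems by (auto simp: bind_eq_Some_conv)
  then have IH: "admissible A v" "last v = last w" "length w \<le> length v + length u"
    "length v \<le> length w + length u" using Cons by auto
  \<comment> \<open>One letter may be deleted now and one more must remain, so that the result is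
    nonempty and ends with the same letter.\<close>
  have "length v \<ge> 2" using IH Cons.prems by simp
  then obtain j k v' where "v = j # k # v'" by (cases v; cases "tl v") auto
  then show ?case using v(2) IH by (auto simp: letter_act_def split: if_splits)
qed

lemma finite_words [simp]: "finite {w :: 'i::finite list. length w = n}"
  "finite {w :: 'i::finite list. length w < n}"
proof -
  show "finite {w :: 'i::finite list. length w = n}"
    using finite_lists_length_eq[of "UNIV :: 'i set" n] by simp
  have "{w :: 'i::finite list. length w < n} \<subseteq> {w. set w \<subseteq> UNIV \<and> length w \<le> n}" by auto
  then show "finite {w :: 'i::finite list. length w < n}"
    by (rule finite_subset) (rule finite_lists_length_le, simp)
qed

lemma sum_words_Suc:
  fixes f :: "'i::finite list \<Rightarrow> 'b::comm_monoid_add"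
  shows "(\<Sum>w\<in>{w. length w = Suc n}. f w) = (\<Sum>i\<in>UNIV. \<Sum>w\<in>{w. length w = n}. f (i # w))"
proof -
  have "(\<Sum>w\<in>{w. length w = Suc n}. f w)
      = (\<Sum>(i, w)\<in>UNIV \<times> {w. length w = n}. f (i # w))"
    by (rule sum.reindex_bij_witness[of _ "\<lambda>(i, w). i # w" "\<lambda>w. (hd w, tl w)"])
      (auto simp: length_Suc_conv)
  then show ?thesis by (simp add: sum.cartesian_product)
qed

section \<open>Polynomials in the generators\<close>

text \<open>Unlike the elements of \<open>bounded_ops\<close>, these maps are not cut off outside
  \<open>L2 M\<close>, so identities with operators are stated only at vectors of
  \<open>L2 M\<close>.\<close>

primrec word_op :: "'a measure \<Rightarrow> ('i \<Rightarrow> 'a L2_op) \<Rightarrow> ('i \<times> bool) list \<Rightarrow> 'a L2_op" where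
  "word_op M t [] X = X"
| "word_op M t (l # u) X = (if snd l then op_adjoint M (t (fst l)) else t (fst l)) (word_op M t u X)"

primrec poly_op :: "'a measure \<Rightarrow> ('i \<Rightarrow> 'a L2_op) \<Rightarrow> (complex \<times> ('i \<times> bool) list) list \<Rightarrow> 'a L2_op" where
  "poly_op M t [] X = L2_zero M"
| "poly_op M t (m # q) X = L2_add M (L2_scale M (fst m) (word_op M t (snd m) X)) (poly_op M t q X)"

definition word_star :: "('i \<times> bool) list \<Rightarrow> ('i \<times> bool) list" where
  "word_star u = rev (map (\<lambda>l. (fst l, \<not> snd l)) u)"

lemma word_star_append: "word_star (u @ v) = word_star v @ word_star u"
  by (simp add: word_star_def)

definition poly_star where
  "poly_star q = map (\<lambda>m. (cnj (fst m), word_star (snd m))) q"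

definition poly_mult where
  "poly_mult p q = concat (map (\<lambda>m. map (\<lambda>n. (fst m * fst n, snd m @ snd n)) q) p)"

definition poly_scale where
  "poly_scale c q = map (\<lambda>m. (c * fst m, snd m)) q"

text \<open>Lists of monomials, on which the degree and the coefficients can be read off.\<close>

primrec poly_flat :: "'i npoly \<Rightarrow> (complex \<times> ('i \<times> bool) list) list" where
  "poly_flat (PGen i) = [(1, [(i, False)])]"
| "poly_flat PZero = []"
| "poly_flat (PAdd p q) = poly_flat p @ poly_flat q"
| "poly_flat (PMul p q) = poly_mult (poly_flat p) (poly_flat q)"
| "poly_flat (PScale c p) = poly_scale c (poly_flat p)"
| "poly_flat (PStar p) = poly_star (poly_flat p)"

abbreviation gen_op where "gen_op M t w \<equiv> word_op M t (map (\<lambda>i. (i, False)) w)"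

locale op_family =
  fixes M :: "'a measure" and t :: "'i \<Rightarrow> 'a L2_op"
  assumes t_in [simp]: "t i \<in> bounded_ops M"
begin

lemma t_L2 [simp]: "X \<in> L2 M \<Longrightarrow> t i X \<in> L2 M"
  by (rule bounded_ops_in[OF t_in])

lemma t_adjoint:
  "X \<in> L2 M \<Longrightarrow> Y \<in> L2 M \<Longrightarrow> L2_inner M (t i X) Y = L2_inner M X (op_adjoint M (t i) Y)"
  by (rule op_adjoint_right[symmetric]) simp_all

lemma word_op_L2 [simp]: "X \<in> L2 M \<Longrightarrow> word_op M t u X \<in> L2 M"
  by (induction u) auto

lemma poly_op_L2 [simp]: "X \<in> L2 M \<Longrightarrow> poly_op M t q X \<in> L2 M"
  by (induction q) auto

lemma word_op_append: "word_op M t (u @ v) X = word_op M t u (word_op M t v X)"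
  by (induction u) auto

lemma word_op_adjoint:
  assumes "X \<in> L2 M" "Y \<in> L2 M"
  shows "L2_inner M (word_op M t u X) Y = L2_inner M X (word_op M t (word_star u) Y)"
  using assms by (induction u arbitrary: Y)
    (auto simp: word_star_def word_op_append op_adjoint_left t_adjoint)

lemma poly_op_inner:
  assumes "X \<in> L2 M" "Y \<in> L2 M"
  shows "L2_inner M (poly_op M t q X) Y = (\<Sum>m\<leftarrow>q. fst m * L2_inner M (word_op M t (snd m) X) Y)"
  using assms by (induction q) auto

lemma word_star_star [simp]: "word_star (word_star u) = u"
  by (simp add: word_star_def rev_map o_def)

lemma poly_op_inner_right:
  assumes "X \<in> L2 M" "Y \<in> L2 M"
  shows "L2_inner M Y (poly_op M t q X) = (\<Sum>m\<leftarrow>q. cnj (fst m) * L2_inner M Y (word_op M t (snd m) X))"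
  using assms by (induction q) auto

lemma poly_op_adjoint:
  assumes "X \<in> L2 M" "Y \<in> L2 M"
  shows "L2_inner M (poly_op M t q X) Y = L2_inner M X (poly_op M t (poly_star q) Y)"
  using assms by (simp add: poly_op_inner poly_op_inner_right poly_star_def o_def word_op_adjoint)

lemma poly_star_star [simp]: "poly_star (poly_star q) = q"
  by (simp add: poly_star_def o_def)

lemma poly_op_append:
  assumes "X \<in> L2 M"
  shows "poly_op M t (p @ q) X = L2_add M (poly_op M t p X) (poly_op M t q X)"
  using assms by (intro L2_eqI[where M = M]) (auto simp: poly_op_inner)

lemma poly_op_scale:
  assumes "X \<in> L2 M"
  shows "poly_op M t (poly_scale c q) X = L2_scale M c (poly_op M t q X)"
  using assms by (intro L2_eqI[where M = M])
    (auto simp: poly_op_inner poly_scale_def o_def sum_list_const_mult mult.assoc)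

lemma poly_op_mult:
  assumes "X \<in> L2 M"
  shows "poly_op M t (poly_mult p q) X = poly_op M t p (poly_op M t q X)"
proof -
  have *: "poly_op M t (map (\<lambda>n. (c * fst n, u @ snd n)) q) X = L2_scale M c (word_op M t u (poly_op M t q X))"
    for c u
    using assms by (intro L2_eqI[where M = M])
      (auto simp: poly_op_inner o_def word_star_append word_op_append word_op_adjoint mult.assoc
        sum_list_const_mult)
  show ?thesis using assms
    by (induction p) (simp_all add: poly_mult_def poly_op_append *)
qed

lemma poly_flat_eval:
  assumes "X \<in> L2 M"
  shows "npoly_eval (op_algebra M) t p X = poly_op M t (poly_flat p) X"
  using assms
proof (induction p arbitrary: X)
  case (PGen i)
  then show ?case by (intro L2_eqI[where M = M]) (auto simp: poly_op_inner)
next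
  case (PStar p)
  interpret banach_star_algebra "op_algebra M" by (rule banach_star_op_algebra)
  have *: "npoly_eval (op_algebra M) t p \<in> bounded_ops M"
    using npoly_eval_closed[of t p] by simp
  from PStar show ?case
    by (intro L2_eqI[where M = M]) (auto simp: op_adjoint_left[OF *] poly_op_adjoint op_adjoint_L2[OF *])
qed (auto simp: poly_op_append poly_op_mult poly_op_scale)

end

section \<open>Families satisfying the Cuntz--Krieger relations\<close>

locale ck_family =
  fixes M :: "'a measure" and A :: "nat^'i::finite^'i" and t :: "'i \<Rightarrow> 'a L2_op"
  assumes family: "cuntz_krieger_family A (op_algebra M) t"
    and zero_one: "zero_one_matrix A"
begin

sublocale op_family M t
  using family by unfold_locales (simp add: cuntz_krieger_family_def partial_isometry_def)

abbreviation s where "s i \<equiv> op_adjoint M (t i)"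

lemma s_L2 [simp]: "X \<in> L2 M \<Longrightarrow> s i X \<in> L2 M"
  by simp

lemma s_adjoint: "X \<in> L2 M \<Longrightarrow> Y \<in> L2 M \<Longrightarrow> L2_inner M (s i X) Y = L2_inner M X (t i Y)"
  by (rule op_adjoint_left) simp_all

lemma partial_isom [simp]:
  assumes "X \<in> L2 M"
  shows "t i (s i (t i X)) = t i X"
proof -
  have "t i \<otimes>\<^bsub>op_algebra M\<^esub> s i \<otimes>\<^bsub>op_algebra M\<^esub> t i = t i"
    using family by (simp add: cuntz_krieger_family_def partial_isometry_def)
  from fun_cong[OF this, of X] show ?thesis using assms by simp
qed

lemma range_projection_in: "t j \<otimes>\<^bsub>op_algebra M\<^esub> s j \<in> bounded_ops M"
  unfolding op_algebra_simps by (intro op_mult_in t_in op_adjoint_in)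

text \<open>The relation that the range projections sum to 1, in weak form.\<close>

lemma total:
  assumes "X \<in> L2 M" "Y \<in> L2 M"
  shows "(\<Sum>j\<in>UNIV. L2_inner M (s j X) (s j Y)) = L2_inner M X Y"
proof -
  have "(\<Oplus>\<^bsub>op_algebra M\<^esub>j\<in>UNIV. t j \<otimes>\<^bsub>op_algebra M\<^esub> s j) = \<one>\<^bsub>op_algebra M\<^esub>"
    using family by (simp add: cuntz_krieger_family_def)
  from fun_cong[OF this, of X]
  have "L2_inner M ((\<Oplus>\<^bsub>op_algebra M\<^esub>j\<in>UNIV. t j \<otimes>\<^bsub>op_algebra M\<^esub> s j) X) Y = L2_inner M X Y"
    using assms by simp
  moreover have "L2_inner M ((\<Oplus>\<^bsub>op_algebra M\<^esub>j\<in>UNIV. t j \<otimes>\<^bsub>op_algebra M\<^esub> s j) X) Y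
      = (\<Sum>j\<in>UNIV. L2_inner M ((t j \<otimes>\<^bsub>op_algebra M\<^esub> s j) X) Y)"
    by (intro op_finsum_inner range_projection_in assms) simp
  ultimately show ?thesis using assms by (simp add: t_adjoint)
qed

lemma relation:
  assumes "X \<in> L2 M" "Y \<in> L2 M"
  shows "L2_inner M (t i X) (t i Y) = (\<Sum>j\<in>UNIV. of_nat (A $ i $ j) * L2_inner M (s j X) (s j Y))"
proof -
  let ?P = "\<lambda>j. of_nat (A $ i $ j) \<odot>\<^bsub>op_algebra M\<^esub> (t j \<otimes>\<^bsub>op_algebra M\<^esub> s j)"
  have "s i \<otimes>\<^bsub>op_algebra M\<^esub> t i = (\<Oplus>\<^bsub>op_algebra M\<^esub>j\<in>UNIV. ?P j)"
    using family by (simp add: cuntz_krieger_family_def)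
  from fun_cong[OF this, of X]
  have "s i (t i X) = (\<Oplus>\<^bsub>op_algebra M\<^esub>j\<in>UNIV. ?P j) X"
    using assms by simp
  moreover have "L2_inner M ((\<Oplus>\<^bsub>op_algebra M\<^esub>j\<in>UNIV. ?P j) X) Y = (\<Sum>j\<in>UNIV. L2_inner M (?P j X) Y)"
  proof (intro op_finsum_inner assms)
    show "?P j \<in> bounded_ops M" for j
      using op_scale_in[OF range_projection_in] unfolding op_algebra_simps .
  qed simp
  ultimately have "L2_inner M (s i (t i X)) Y = (\<Sum>j\<in>UNIV. L2_inner M (?P j X) Y)"
    by (simp only:)
  then show ?thesis using assms by (simp add: t_adjoint s_adjoint)
qed

section \<open>The Cuntz-Krieger relations on words\<close>

lemma t_zero [simp]: "t i (L2_zero M) = L2_zero M"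
  by (rule L2_eqI[where M = M]) (auto simp: t_adjoint)

text \<open>Let \<open>Y = t i X\<close>. The squared norms of all \<open>s k Y\<close> sum to that
  of \<open>Y\<close>, and the term for \<open>i\<close> alone already equals it because
  \<open>t i\<close> is a partial isometry. So the remaining terms vanish.\<close>

lemma orthogonal:
  assumes "X \<in> L2 M" "i \<noteq> j"
  shows "s j (t i X) = L2_zero M"
proof -
  let ?Y = "t i X"
  have Y: "?Y \<in> L2 M" using assms by simp
  have "L2_inner M (s i ?Y) (s i ?Y) = L2_inner M ?Y ?Y"
    using assms Y by (simp add: s_adjoint)
  then have i: "(L2_norm M (s i ?Y))\<^sup>2 = (L2_norm M ?Y)\<^sup>2"
    by (simp only: L2_inner_self_norm of_real_eq_iff)
  have "complex_of_real (\<Sum>k\<in>UNIV. (L2_norm M (s k ?Y))\<^sup>2) = of_real ((L2_norm M ?Y)\<^sup>2)"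
    using total[OF Y Y] by (simp only: L2_inner_self_norm of_real_sum)
  then have "(\<Sum>k\<in>UNIV. (L2_norm M (s k ?Y))\<^sup>2) = (L2_norm M (s i ?Y))\<^sup>2"
    by (simp only: of_real_eq_iff i)
  moreover have "(\<Sum>k\<in>UNIV. (L2_norm M (s k ?Y))\<^sup>2)
      = (L2_norm M (s i ?Y))\<^sup>2 + (\<Sum>k\<in>UNIV - {i}. (L2_norm M (s k ?Y))\<^sup>2)"
    by (rule sum.remove) auto
  ultimately have "(\<Sum>k\<in>UNIV - {i}. (L2_norm M (s k ?Y))\<^sup>2) = 0" by simp
  then have "L2_norm M (s j ?Y) = 0"
    using assms(2) by (subst (asm) sum_nonneg_eq_0_iff) auto
  then show ?thesis using Y by (simp add: L2_norm_zero_iff)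
qed

lemma domain:
  assumes "X \<in> L2 M"
  shows "s i (t i (t j X)) = (if A $ i $ j = 1 then t j X else L2_zero M)"
proof (rule L2_eqI[where M = M])
  fix Z assume Z: "Z \<in> L2 M"
  have "L2_inner M (s i (t i (t j X))) Z = L2_inner M (t i (t j X)) (t i Z)"
    using assms Z by (simp add: s_adjoint)
  also have "\<dots> = (\<Sum>k\<in>UNIV. of_nat (A $ i $ k) * L2_inner M (s k (t j X)) (s k Z))"
    using assms Z by (simp add: relation)
  also have "\<dots> = of_nat (A $ i $ j) * L2_inner M (s j (t j X)) (s j Z)"
    using assms Z by (subst sum.remove[of _ j]) (auto simp: orthogonal intro!: sum.neutral)
  also have "\<dots> = of_nat (A $ i $ j) * L2_inner M (t j X) Z"
    using assms Z by (simp flip: t_adjoint)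
  finally show "L2_inner M (s i (t i (t j X))) Z
      = L2_inner M (if A $ i $ j = 1 then t j X else L2_zero M) Z"
    using Z zero_one_cases[OF zero_one, of i j] by auto
qed (use assms in auto)

text \<open>The squared norm of \<open>t i (t j X)\<close> is an inner product with
  \<open>s i (t i (t j X))\<close>, which is zero by \<open>domain\<close>.\<close>

lemma not_admissible:
  assumes "X \<in> L2 M" "A $ i $ j \<noteq> 1"
  shows "t i (t j X) = L2_zero M"
proof -
  have "L2_inner M (t i (t j X)) (t i (t j X)) = L2_inner M (s i (t i (t j X))) (t j X)"
    using assms by (simp add: s_adjoint)
  also have "\<dots> = 0" using assms by (simp add: domain)
  finally have "L2_norm M (t i (t j X)) = 0" by (simp add: L2_norm_def)
  then show ?thesis using assms by (simp add: L2_norm_zero_iff)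
qed

lemma gen_op_not_admissible:
  assumes "X \<in> L2 M" "\<not> admissible A w"
  shows "gen_op M t w X = L2_zero M"
  using assms(2)
proof (induction w rule: induct_list012)
  case (3 i j w)
  then show ?case using assms(1) by (cases "A $ i $ j = 1") (auto simp: not_admissible)
qed auto

lemma word_op_zero [simp]: "word_op M t u (L2_zero M) = L2_zero M"
  by (rule L2_eqI[where M = M]) (auto simp: word_op_adjoint)

text \<open>This reduces the operators to the combinatorics of \<open>word_act\<close>: deletion is
  \<open>domain\<close> or \<open>orthogonal\<close>, and a forbidden prepending is
  \<open>not_admissible\<close>.\<close>

lemma word_op_gen_op:
  assumes "length u < length w" "admissible A w" "X \<in> L2 M"
  shows "word_op M t u (gen_op M t w X)
    = (case word_act A u w of None \<Rightarrow> L2_zero M | Some w' \<Rightarrow> gen_op M t w' X)"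
  using assms(1)
proof (induction u)
  case Nil
  then show ?case by simp
next
  case (Cons l u)
  show ?case
  proof (cases "word_act A u w")
    case None
    then have "word_op M t (l # u) (gen_op M t w X) = word_op M t [l] (L2_zero M)"
      using Cons by simp
    then show ?thesis using None by (simp only: word_op_zero) simp
  next
    case (Some v)
    then have v: "admissible A v" "length w \<le> length v + length u"
      using word_act_Some[OF Some _ assms(2)] Cons.prems by auto
    \<comment> \<open>Two letters are needed: deleting \<open>j\<close> by its adjoint uses that the
      following letter \<open>k\<close> is an admissible successor.\<close>
    then have "length v \<ge> 2" using Cons.prems by simp
    then obtain j k v' where vv: "v = j # k # v'" by (cases v; cases "tl v") auto
    have jk: "A $ j $ k = 1" using v by (simp add: vv)
    obtain i b where l: "l = (i, b)" by (cases l)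
    show ?thesis
    proof (cases b)
      case True
      then show ?thesis using Some Cons jk assms(3)
        by (auto simp: l vv letter_act_def domain orthogonal)
    next
      case False
      then show ?thesis using Some Cons assms(3)
        by (auto simp: l vv letter_act_def not_admissible)
    qed
  qed
qed

text \<open>Common first letters are stripped, since the initial projection of \<open>t i\<close>
  either fixes or kills the remaining vector; at the first difference the ranges are
  orthogonal.\<close>

lemma gen_op_inner_neq:
  assumes "length x = length y" "x \<noteq> y" "X \<in> L2 M" "Y \<in> L2 M"
  shows "L2_inner M (gen_op M t x X) (gen_op M t y Y) = 0"
  using assms(1,2)
proof (induction x y rule: list_induct2)
  case (Cons i x j y)
  let ?X = "gen_op M t x X" and ?Y = "gen_op M t y Y"
  have "L2_inner M (t i ?X) (t j ?Y) = L2_inner M (s j (t i ?X)) ?Y"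
    using assms by (simp add: s_adjoint)
  also have "\<dots> = 0"
  proof (cases "i = j")
    case False
    then show ?thesis using assms by (simp add: orthogonal)
  next
    case True
    then have "x \<noteq> y" using Cons by simp
    then obtain k x' where x: "x = k # x'" using Cons.hyps by (cases x) auto
    have "s i (t i ?X) = ?X \<or> s i (t i ?X) = L2_zero M" using assms by (simp add: x domain)
    then show ?thesis using True Cons.IH[OF \<open>x \<noteq> y\<close>] assms by auto
  qed
  finally show ?case by simp
qed simp

lemma gen_op_append: "gen_op M t (x @ y) X = gen_op M t x (gen_op M t y X)"
  by (simp add: word_op_append)

lemma gen_op_inner_incomparable:
  assumes "take (length y) x \<noteq> y" "length y \<le> length x" "X \<in> L2 M" "Y \<in> L2 M"
  shows "L2_inner M (gen_op M t x X) (gen_op M t y Y) = 0"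
  using gen_op_inner_neq[of "take (length y) x" y "gen_op M t (drop (length y) x) X" Y] assms
  by (simp flip: gen_op_append map_append word_op_append)

text \<open>Each generator is isometric on the vectors it meets: admissibility ensures this for all
  letters but the last, and the final hypothesis for the last.\<close>

lemma gen_op_inner_same:
  assumes "admissible A x" "x \<noteq> []" "X \<in> L2 M" "Y \<in> L2 M" "s (last x) (t (last x) X) = X"
  shows "L2_inner M (gen_op M t x X) (gen_op M t x Y) = L2_inner M X Y"
  using assms(1,2,5)
proof (induction x rule: induct_list012)
  case (2 i)
  then show ?case using assms(3,4) by (simp flip: s_adjoint)
next
  case (3 i j x)
  then show ?case using assms(3,4) by (simp flip: s_adjoint add: domain)
qed simp

text \<open>The adjoint of \<open>gen_op M t w\<close>; it passes the vector through the adjoint of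
  the first letter first, which avoids reversing words in the inductions.\<close>

primrec gen_adj :: "'i list \<Rightarrow> 'a L2_op" where
  "gen_adj [] X = X"
| "gen_adj (i # w) X = gen_adj w (s i X)"

lemma gen_adj_L2 [simp]: "X \<in> L2 M \<Longrightarrow> gen_adj w X \<in> L2 M"
  by (induction w arbitrary: X) auto

lemma gen_adj: "X \<in> L2 M \<Longrightarrow> Y \<in> L2 M \<Longrightarrow> L2_inner M (gen_op M t w X) Y = L2_inner M X (gen_adj w Y)"
  by (induction w arbitrary: Y) (auto simp: t_adjoint)

text \<open>The relation \<open>total\<close>, iterated \<open>n\<close> times. Inadmissible words
  may stay in the sum, since their operators are zero by
  \<open>gen_op_not_admissible\<close>.\<close>

lemma total_words:
  assumes "X \<in> L2 M" "Y \<in> L2 M"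
  shows "(\<Sum>w\<in>{w. length w = n}. L2_inner M (gen_adj w X) (gen_adj w Y)) = L2_inner M X Y"
  using assms
proof (induction n arbitrary: X Y)
  case (Suc n)
  then show ?case by (simp add: sum_words_Suc total)
qed simp

lemma total_words_norm:
  assumes "X \<in> L2 M"
  shows "(\<Sum>w\<in>{w. length w = n}. (L2_norm M (gen_adj w X))\<^sup>2) = (L2_norm M X)\<^sup>2"
proof -
  have "L2_inner M X X = of_real (\<Sum>w\<in>{w. length w = n}. (L2_norm M (gen_adj w X))\<^sup>2)"
    using total_words[OF assms assms, of n] by (simp only: L2_inner_self_norm of_real_sum)
  then show ?thesis by (rule L2_norm_sqI[symmetric])
qed

text \<open>The entries of the scalar matrices. They involve \<open>A\<close> but neither
  \<open>M\<close> nor \<open>t\<close>, so two families for the same matrix share them; a bound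
  derived from one family can thus be used in another.\<close>

definition coef where
  "coef q \<mu> \<nu> = (\<Sum>m\<leftarrow>q. if word_act A (snd m) \<nu> = Some \<mu> then fst m else 0)"

lemma coef_nonzero:
  assumes "coef q \<mu> \<nu> \<noteq> 0" "\<And>m. m \<in> set q \<Longrightarrow> length (snd m) \<le> D" "D < length \<nu>" "admissible A \<nu>"
  shows "admissible A \<mu>" "last \<mu> = last \<nu>" "\<mu> \<noteq> []" "length \<mu> \<le> length \<nu> + D"
proof -
  have "\<exists>m\<in>set q. word_act A (snd m) \<nu> = Some \<mu>"
  proof (rule ccontr)
    assume "\<not> ?thesis"
    then have "coef q \<mu> \<nu> = (\<Sum>m\<leftarrow>q. 0)"
      unfolding coef_def by (intro arg_cong[of _ _ sum_list] map_cong) auto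
    then show False using assms(1) by simp
  qed
  then obtain m where m: "m \<in> set q" "word_act A (snd m) \<nu> = Some \<mu>" by blast
  have "length (snd m) \<le> D" using m assms by blast
  then show "admissible A \<mu>" "last \<mu> = last \<nu>" "\<mu> \<noteq> []" "length \<mu> \<le> length \<nu> + D"
    using word_act_Some[OF m(2) _ assms(4)] assms(3) by auto
qed

lemma poly_op_gen_op:
  assumes "\<And>m. m \<in> set q \<Longrightarrow> length (snd m) \<le> D" "D < length \<nu>" "admissible A \<nu>"
    and "length \<nu> + D < L" "X \<in> L2 M" "Y \<in> L2 M"
  shows "L2_inner M (poly_op M t q (gen_op M t \<nu> X)) Y
    = (\<Sum>\<mu>\<in>{\<mu>. length \<mu> < L}. coef q \<mu> \<nu> * L2_inner M (gen_op M t \<mu> X) Y)"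
  using assms(1)
proof (induction q)
  case Nil
  then show ?case using assms by (simp add: coef_def)
next
  case (Cons m q)
  have len: "length (snd m) \<le> D" using Cons.prems by simp
  have "L2_inner M (word_op M t (snd m) (gen_op M t \<nu> X)) Y
      = (\<Sum>\<mu>\<in>{\<mu>. length \<mu> < L}. (if word_act A (snd m) \<nu> = Some \<mu> then 1 else 0) * L2_inner M (gen_op M t \<mu> X) Y)"
  proof (cases "word_act A (snd m) \<nu>")
    case None
    then show ?thesis using word_op_gen_op[of "snd m" \<nu> X] len assms by simp
  next
    case (Some \<mu>)
    then have "length \<mu> < L" using word_act_Some[OF Some _ assms(3)] len assms(2,4) by auto
    then show ?thesis using Some word_op_gen_op[of "snd m" \<nu> X] len assms
      by (simp add: if_distrib[of "\<lambda>x. x * _"] sum.delta' cong: if_cong)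
  qed
  then have "L2_inner M (poly_op M t (m # q) (gen_op M t \<nu> X)) Y
      = fst m * (\<Sum>\<mu>\<in>{\<mu>. length \<mu> < L}. (if word_act A (snd m) \<nu> = Some \<mu> then 1 else 0) * L2_inner M (gen_op M t \<mu> X) Y)
        + (\<Sum>\<mu>\<in>{\<mu>. length \<mu> < L}. coef q \<mu> \<nu> * L2_inner M (gen_op M t \<mu> X) Y)"
    using Cons assms by simp
  also have "\<dots> = (\<Sum>\<mu>\<in>{\<mu>. length \<mu> < L}. coef (m # q) \<mu> \<nu> * L2_inner M (gen_op M t \<mu> X) Y)"
    unfolding sum_distrib_left sum.distrib[symmetric]
    by (intro sum.cong) (simp_all add: coef_def distrib_right)
  finally show ?case .
qed

text \<open>The projections onto the ranges of words of length \<open>N > D\<close> are inserted in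
  front of \<open>X\<close>, the polynomial is expanded by \<open>coef\<close> on each of these
  ranges, and the resulting words are moved to the other side as adjoints.\<close>

lemma poly_op_expand:
  assumes q: "\<And>m. m \<in> set q \<Longrightarrow> length (snd m) \<le> D" "D < N" "N + D < L"
    and "X \<in> L2 M" "Y \<in> L2 M"
  defines "V \<equiv> {\<nu>. length \<nu> = N \<and> admissible A \<nu>}"
  shows "L2_inner M (poly_op M t q X) Y
    = (\<Sum>\<mu>\<in>{\<mu>. length \<mu> < L}. L2_inner M (L2_lincomb M V (coef q \<mu>) (\<lambda>\<nu>. gen_adj \<nu> X)) (gen_adj \<mu> Y))"
proof -
  have fin: "finite V" unfolding V_def by (rule finite_subset[OF _ finite_words(1)[of N]]) auto
  let ?Z = "poly_op M t (poly_star q) Y"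
  have Z: "?Z \<in> L2 M" using assms by simp
  \<comment> \<open>The polynomial is moved to the right so that \<open>total_words\<close> applies
    with \<open>X\<close> itself as one argument; it is moved back once the words of length
    \<open>N\<close> are in place.\<close>
  have "L2_inner M (poly_op M t q X) Y = L2_inner M X ?Z"
    using assms by (simp add: poly_op_adjoint)
  also have "\<dots> = (\<Sum>\<nu>\<in>{\<nu>. length \<nu> = N}. L2_inner M (gen_adj \<nu> X) (gen_adj \<nu> ?Z))"
    using assms Z by (simp add: total_words)
  also have "\<dots> = (\<Sum>\<nu>\<in>{\<nu>. length \<nu> = N}. L2_inner M (gen_op M t \<nu> (gen_adj \<nu> X)) ?Z)"
    using assms Z by (simp add: gen_adj)
  also have "\<dots> = (\<Sum>\<nu>\<in>V. L2_inner M (gen_op M t \<nu> (gen_adj \<nu> X)) ?Z)"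
    using assms(4) Z by (intro sum.mono_neutral_right) (auto simp: V_def gen_op_not_admissible)
  also have "\<dots> = (\<Sum>\<nu>\<in>V. L2_inner M (poly_op M t q (gen_op M t \<nu> (gen_adj \<nu> X))) Y)"
    using assms by (simp add: poly_op_adjoint)
  also have "\<dots> = (\<Sum>\<nu>\<in>V. \<Sum>\<mu>\<in>{\<mu>. length \<mu> < L}. coef q \<mu> \<nu> * L2_inner M (gen_op M t \<mu> (gen_adj \<nu> X)) Y)"
    using assms by (intro sum.cong poly_op_gen_op[of q D]) (auto simp: V_def)
  also have "\<dots> = (\<Sum>\<mu>\<in>{\<mu>. length \<mu> < L}. \<Sum>\<nu>\<in>V. coef q \<mu> \<nu> * L2_inner M (gen_adj \<nu> X) (gen_adj \<mu> Y))"
    using assms by (subst sum.swap) (simp add: gen_adj)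
  also have "\<dots> = (\<Sum>\<mu>\<in>{\<mu>. length \<mu> < L}. L2_inner M (L2_lincomb M V (coef q \<mu>) (\<lambda>\<nu>. gen_adj \<nu> X)) (gen_adj \<mu> Y))"
    using assms fin by simp
  finally show ?thesis .
qed

end

text \<open>The scalar inequality is applied to the values of representatives at each point and then
  integrated.\<close>

lemma L2_matrix_amplification:
  fixes C :: "'m \<Rightarrow> 'n \<Rightarrow> complex"
  assumes fin: "finite S" "finite V" and X: "\<And>\<nu>. \<nu> \<in> V \<Longrightarrow> X \<nu> \<in> L2 M"
    and scal: "\<And>z. (\<Sum>\<mu>\<in>S. (norm (\<Sum>\<nu>\<in>V. C \<mu> \<nu> * z \<nu>))\<^sup>2) \<le> K * (\<Sum>\<nu>\<in>V. (norm (z \<nu>))\<^sup>2)"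
  shows "(\<Sum>\<mu>\<in>S. (L2_norm M (L2_lincomb M V (C \<mu>) X))\<^sup>2) \<le> K * (\<Sum>\<nu>\<in>V. (L2_norm M (X \<nu>))\<^sup>2)"
proof -
  have sq: "L2_rep (X \<nu>) \<in> sq_int M" if "\<nu> \<in> V" for \<nu> using X[OF that] by (rule L2_rep_sq_int)
  have sq': "(\<lambda>x. \<Sum>\<nu>\<in>V. C \<mu> \<nu> * L2_rep (X \<nu>) x) \<in> sq_int M" for \<mu>
    by (intro sq_int_sum fin sq_int_scale sq)
  have norm: "(L2_norm M (L2_lincomb M V (C \<mu>) X))\<^sup>2
      = (LINT x|M. (norm (\<Sum>\<nu>\<in>V. C \<mu> \<nu> * L2_rep (X \<nu>) x))\<^sup>2)" for \<mu>
    unfolding L2_lincomb_def by (rule L2_norm_class[OF sq'])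
  have "(\<Sum>\<mu>\<in>S. (L2_norm M (L2_lincomb M V (C \<mu>) X))\<^sup>2)
      = (LINT x|M. (\<Sum>\<mu>\<in>S. (norm (\<Sum>\<nu>\<in>V. C \<mu> \<nu> * L2_rep (X \<nu>) x))\<^sup>2))"
    unfolding norm by (rule Bochner_Integration.integral_sum[symmetric]) (rule sq_int_integrable[OF sq'])
  also have "\<dots> \<le> (LINT x|M. K * (\<Sum>\<nu>\<in>V. (norm (L2_rep (X \<nu>) x))\<^sup>2))"
    by (intro integral_mono Bochner_Integration.integrable_sum integrable_mult_right
        sq_int_integrable sq sq' scal)
  also have "\<dots> = K * (\<Sum>\<nu>\<in>V. (LINT x|M. (norm (L2_rep (X \<nu>) x))\<^sup>2))"
    by (simp add: Bochner_Integration.integral_sum sq_int_integrable sq)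
  finally show ?thesis by (simp only: L2_norm_sq)
qed

section \<open>Comparing a polynomial with its coefficient matrices\<close>

context ck_family
begin

text \<open>With \<open>Y\<close> the image of \<open>X\<close>, the inner product of
  \<open>Y\<close> with itself is expanded by \<open>poly_op_expand\<close> and grouped by the
  length of \<mu>. Cauchy-Schwarz bounds each of the \<open>L\<close> groups by
  \<open>K * L2_norm M X * L2_norm M Y\<close>.\<close>

lemma poly_op_upper:
  assumes q: "\<And>m. m \<in> set q \<Longrightarrow> length (snd m) \<le> D" "D < N" "N + D < L"
    and K: "K \<ge> 0" and X: "X \<in> L2 M"
  defines "V \<equiv> {\<nu>. length \<nu> = N \<and> admissible A \<nu>}"
  assumes scal: "\<And>l z. l < L \<Longrightarrow> (\<Sum>\<mu>\<in>{\<mu>. length \<mu> = l}. (norm (\<Sum>\<nu>\<in>V. coef q \<mu> \<nu> * z \<nu>))\<^sup>2)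
      \<le> K\<^sup>2 * (\<Sum>\<nu>\<in>V. (norm (z \<nu>))\<^sup>2)"
  shows "L2_norm M (poly_op M t q X) \<le> real L * K * L2_norm M X"
proof -
  have fin: "finite V" unfolding V_def by (rule finite_subset[OF _ finite_words(1)[of N]]) auto
  define Y where "Y = poly_op M t q X"
  have Y: "Y \<in> L2 M" using X by (simp add: Y_def)
  define h where "h \<mu> = L2_lincomb M V (coef q \<mu>) (\<lambda>\<nu>. gen_adj \<nu> X)" for \<mu>
  have h: "h \<mu> \<in> L2 M" for \<mu> using fin X by (simp add: h_def)
  have layer: "(\<Sum>\<mu>\<in>{\<mu>. length \<mu> = l}. L2_norm M (h \<mu>) * L2_norm M (gen_adj \<mu> Y))
      \<le> K * L2_norm M X * L2_norm M Y" if "l < L" for l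
  proof -
    have "(\<Sum>\<mu>\<in>{\<mu>. length \<mu> = l}. (L2_norm M (h \<mu>))\<^sup>2) \<le> K\<^sup>2 * (\<Sum>\<nu>\<in>V. (L2_norm M (gen_adj \<nu> X))\<^sup>2)"
      unfolding h_def by (rule L2_matrix_amplification) (use fin X scal[OF that] in simp_all)
    also have "\<dots> \<le> K\<^sup>2 * (\<Sum>\<nu>\<in>{\<nu>. length \<nu> = N}. (L2_norm M (gen_adj \<nu> X))\<^sup>2)"
      by (intro mult_left_mono sum_mono2) (auto simp: V_def)
    also have "\<dots> = (K * L2_norm M X)\<^sup>2"
      using X by (simp add: total_words_norm power_mult_distrib)
    finally have "L2_set (\<lambda>\<mu>. L2_norm M (h \<mu>)) {\<mu>. length \<mu> = l} \<le> K * L2_norm M X"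
      unfolding L2_set_def using K by (intro real_le_lsqrt) (auto intro: sum_nonneg)
    moreover have "L2_set (\<lambda>\<mu>. L2_norm M (gen_adj \<mu> Y)) {\<mu>. length \<mu> = l} = L2_norm M Y"
      unfolding L2_set_def by (simp add: total_words_norm[OF Y])
    ultimately have "L2_set (\<lambda>\<mu>. L2_norm M (h \<mu>)) {\<mu>. length \<mu> = l} *
        L2_set (\<lambda>\<mu>. L2_norm M (gen_adj \<mu> Y)) {\<mu>. length \<mu> = l} \<le> K * L2_norm M X * L2_norm M Y"
      by (simp add: mult_right_mono)
    then show ?thesis
      using L2_set_mult_ineq[of "\<lambda>\<mu>. L2_norm M (h \<mu>)" "\<lambda>\<mu>. L2_norm M (gen_adj \<mu> Y)" "{\<mu>. length \<mu> = l}"]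
      by simp
  qed
  have "norm (L2_inner M Y Y) = norm (\<Sum>\<mu>\<in>{\<mu>. length \<mu> < L}. L2_inner M (h \<mu>) (gen_adj \<mu> Y))"
    using poly_op_expand[OF q X Y] by (simp only: Y_def h_def V_def)
  also have "\<dots> \<le> (\<Sum>\<mu>\<in>{\<mu>. length \<mu> < L}. L2_norm M (h \<mu>) * L2_norm M (gen_adj \<mu> Y))"
    by (intro sum_norm_le L2_cauchy_schwarz h gen_adj_L2 Y)
  also have "\<dots> = (\<Sum>l<L. \<Sum>\<mu>\<in>{\<mu> \<in> {\<mu>. length \<mu> < L}. length \<mu> = l}. L2_norm M (h \<mu>) * L2_norm M (gen_adj \<mu> Y))"
    by (rule sum.group[symmetric]) auto
  also have "\<dots> = (\<Sum>l<L. \<Sum>\<mu>\<in>{\<mu>. length \<mu> = l}. L2_norm M (h \<mu>) * L2_norm M (gen_adj \<mu> Y))"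
    by (intro sum.cong) auto
  also have "\<dots> \<le> (\<Sum>l<L. K * L2_norm M X * L2_norm M Y)"
    by (intro sum_mono layer) simp
  finally have "L2_norm M Y \<le> real L * K * L2_norm M X"
    using K by (intro L2_norm_leI) (simp_all add: mult_ac)
  then show ?thesis by (simp add: Y_def)
qed

text \<open>If \<open>x\<close> is longer than \<open>y\<close> and \<open>y @ \<gamma>\<close> were
  a prefix of \<open>x @ \<gamma>\<close>, then \<gamma> would agree with its own shift by the
  difference of lengths. So the two words are incomparable and their ranges orthogonal.\<close>

lemma gen_op_aperiodic_inner:
  assumes \<gamma>: "\<gamma> \<noteq> []" "admissible A \<gamma>" "A $ r $ hd \<gamma> = 1" "\<And>p. p \<in> {1..P} \<Longrightarrow> aperiodic p \<gamma>"
    and f: "f \<in> L2 M" "s (last \<gamma>) (t (last \<gamma>) f) = f"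
    and x: "admissible A x" "x \<noteq> []" "last x = r" "length x \<le> P"
    and y: "admissible A y" "y \<noteq> []" "last y = r" "length y \<le> P"
  shows "L2_inner M (gen_op M t x (gen_op M t \<gamma> f)) (gen_op M t y (gen_op M t \<gamma> f))
    = (if x = y then L2_inner M f f else 0)"
proof -
  have lt: "L2_inner M (gen_op M t x (gen_op M t \<gamma> f)) (gen_op M t y (gen_op M t \<gamma> f)) = 0"
    if *: "length y < length x" "length x \<le> P" for x y
  proof -
    have "take (length (y @ \<gamma>)) (x @ \<gamma>) \<noteq> y @ \<gamma>"
    proof
      assume eq: "take (length (y @ \<gamma>)) (x @ \<gamma>) = y @ \<gamma>"
      define p where "p = length x - length y"
      have "p \<in> {1..P}" using * by (auto simp: p_def)
      then obtain k where k: "k + p < length \<gamma>" "\<gamma> ! (k + p) \<noteq> \<gamma> ! k"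
        using \<gamma>(4) by (auto simp: aperiodic_def)
      have "(y @ \<gamma>) ! (length y + (k + p)) = \<gamma> ! (k + p)" by (simp only: nth_append_length_plus)
      moreover have "(y @ \<gamma>) ! (length y + (k + p)) = take (length (y @ \<gamma>)) (x @ \<gamma>) ! (length y + (k + p))"
        by (simp only: eq)
      moreover have "\<dots> = (x @ \<gamma>) ! (length y + (k + p))"
        using k by (intro nth_take) simp
      \<comment> \<open>One position of the common prefix is read in two ways, as letter
        \<open>k + p\<close> and as letter \<open>k\<close> of \<gamma>.\<close>
      moreover have "length y + (k + p) = length x + k" using * by (simp add: p_def)
      moreover have "(x @ \<gamma>) ! (length x + k) = \<gamma> ! k" by (simp only: nth_append_length_plus)
      ultimately show False using k by simp
    qed
    then have "L2_inner M (gen_op M t (x @ \<gamma>) f) (gen_op M t (y @ \<gamma>) f) = 0"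
      using * f by (intro gen_op_inner_incomparable) auto
    then show ?thesis by (simp add: word_op_append)
  qed
  show ?thesis
  proof (cases "length x = length y")
    case False
    then consider "length y < length x" | "length x < length y" by linarith
    then have "L2_inner M (gen_op M t x (gen_op M t \<gamma> f)) (gen_op M t y (gen_op M t \<gamma> f)) = 0"
    proof cases
      case 1
      then show ?thesis using lt x by simp
    next
      case 2
      then show ?thesis using lt[of x y] y
        L2_inner_commute[of M "gen_op M t x (gen_op M t \<gamma> f)" "gen_op M t y (gen_op M t \<gamma> f)"] by simp
    qed
    then show ?thesis using False by auto
  next
    case True
    show ?thesis
    proof (cases "x = y")
      case False
      then show ?thesis using gen_op_inner_neq[OF True False, of "gen_op M t \<gamma> f" "gen_op M t \<gamma> f"] f by simp
    next
      case eq: True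
      have "L2_inner M (gen_op M t (x @ \<gamma>) f) (gen_op M t (x @ \<gamma>) f) = L2_inner M f f"
        using x \<gamma> f by (intro gen_op_inner_same) (auto simp: successively_append_iff)
      then show ?thesis using eq by (simp add: word_op_append)
    qed
  qed
qed

lemma poly_op_lincomb:
  assumes "finite S" "\<And>i. i \<in> S \<Longrightarrow> X i \<in> L2 M" "Y \<in> L2 M"
  shows "L2_inner M (poly_op M t q (L2_lincomb M S c X)) Y = (\<Sum>i\<in>S. c i * L2_inner M (poly_op M t q (X i)) Y)"
  using assms by (simp add: poly_op_adjoint)

lemma L2_norm_lincomb_orthogonal:
  assumes "finite S" "\<And>i. i \<in> S \<Longrightarrow> X i \<in> L2 M"
    and "\<And>i j. i \<in> S \<Longrightarrow> j \<in> S \<Longrightarrow> L2_inner M (X i) (X j) = (if i = j then of_real F else 0)"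
  shows "(L2_norm M (L2_lincomb M S c X))\<^sup>2 = F * (\<Sum>i\<in>S. (norm (c i))\<^sup>2)"
proof (rule L2_norm_sqI)
  have "L2_inner M (L2_lincomb M S c X) (L2_lincomb M S c X)
      = (\<Sum>i\<in>S. c i * L2_inner M (X i) (L2_lincomb M S c X))"
    by (intro L2_inner_lincomb_left L2_lincomb_in assms)
  also have "\<dots> = (\<Sum>i\<in>S. c i * (\<Sum>j\<in>S. cnj (c j) * L2_inner M (X i) (X j)))"
    using assms(1,2) by (intro sum.cong refl arg_cong[of _ _ "\<lambda>x. _ * x"] L2_inner_lincomb_right)
  also have "\<dots> = (\<Sum>i\<in>S. c i * (\<Sum>j\<in>S. if i = j then cnj (c j) * of_real F else 0))"
    by (intro sum.cong refl arg_cong[of _ _ "\<lambda>x. _ * x"]) (simp add: assms(3))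
  also have "\<dots> = (\<Sum>i\<in>S. of_real F * (c i * cnj (c i)))"
    using assms(1) by (intro sum.cong) (simp_all add: sum.delta')
  also have "\<dots> = of_real (F * (\<Sum>i\<in>S. (norm (c i))\<^sup>2))"
    by (simp only: complex_norm_square[symmetric] of_real_mult of_real_sum sum_distrib_left)
  finally show "L2_inner M (L2_lincomb M S c X) (L2_lincomb M S c X)
      = of_real (F * (\<Sum>i\<in>S. (norm (c i))\<^sup>2))" .
qed

text \<open>On the vectors \<open>gen_op M t \<nu> e\<close>, which are orthogonal and of equal
  norm, the polynomial acts as the scalar matrix. Pairing its value at \<open>X\<close> with
  \<open>Y\<close>, the part belonging to length \<open>l\<close>, gives exactly the squared norm of
  \<open>Y\<close>.\<close>

lemma coef_block_bound:
  assumes q: "\<And>m. m \<in> set q \<Longrightarrow> length (snd m) \<le> D" "D < N"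
    and K: "K \<ge> 0" "\<And>X. X \<in> L2 M \<Longrightarrow> L2_norm M (poly_op M t q X) \<le> K * L2_norm M X"
    and \<gamma>: "\<gamma> \<noteq> []" "admissible A \<gamma>" "A $ r $ hd \<gamma> = 1" "\<And>p. p \<in> {1..N + D} \<Longrightarrow> aperiodic p \<gamma>"
    and f: "f \<in> L2 M" "s (last \<gamma>) (t (last \<gamma>) f) = f" "f \<noteq> L2_zero M"
  defines "V \<equiv> {\<nu>. length \<nu> = N \<and> admissible A \<nu> \<and> last \<nu> = r}"
  shows "(\<Sum>\<mu>\<in>{\<mu>. length \<mu> = l \<and> last \<mu> = r}. (norm (\<Sum>\<nu>\<in>V. coef q \<mu> \<nu> * z \<nu>))\<^sup>2)
    \<le> K\<^sup>2 * (\<Sum>\<nu>\<in>V. (norm (z \<nu>))\<^sup>2)"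
proof -
  define e where "e = gen_op M t \<gamma> f"
  define w where "w \<mu> = (\<Sum>\<nu>\<in>V. coef q \<mu> \<nu> * z \<nu>)" for \<mu>
  \<comment> \<open>The rows in which a coefficient can be nonzero; for these the orthogonality
    relations are available. The other rows of length \<open>l\<close> contribute zero.\<close>
  define S where "S = {\<mu>. length \<mu> = l \<and> last \<mu> = r \<and> admissible A \<mu> \<and> \<mu> \<noteq> [] \<and> length \<mu> \<le> N + D}"
  define F where "F = (L2_norm M f)\<^sup>2"
  have F: "F > 0" using f by (simp add: F_def L2_norm_zero_iff)
  have ff: "L2_inner M f f = of_real F" unfolding F_def by (rule L2_inner_self_norm)
  have finV: "finite V" unfolding V_def by (rule finite_subset[OF _ finite_words(1)[of N]]) auto
  have finS: "finite S" unfolding S_def by (rule finite_subset[OF _ finite_words(1)[of l]]) auto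
  have e: "e \<in> L2 M" using f by (simp add: e_def)
  have orth: "L2_inner M (gen_op M t x e) (gen_op M t y e) = (if x = y then of_real F else 0)"
    if "admissible A x" "x \<noteq> []" "last x = r" "length x \<le> N + D"
      "admissible A y" "y \<noteq> []" "last y = r" "length y \<le> N + D" for x y
    unfolding e_def ff[symmetric] by (rule gen_op_aperiodic_inner[OF \<gamma> f(1,2) that])
  have V: "admissible A \<nu>" "\<nu> \<noteq> []" "last \<nu> = r" "length \<nu> \<le> N + D" "length \<nu> = N" if "\<nu> \<in> V" for \<nu>
    using that q(2) by (auto simp: V_def)
  have S: "admissible A \<mu>" "\<mu> \<noteq> []" "last \<mu> = r" "length \<mu> \<le> N + D" "length \<mu> = l" if "\<mu> \<in> S" for \<mu>
    using that by (auto simp: S_def)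
  have coef0: "coef q \<mu> \<nu> = 0 \<or> admissible A \<mu> \<and> \<mu> \<noteq> [] \<and> last \<mu> = r \<and> length \<mu> \<le> N + D"
    if "\<nu> \<in> V" for \<mu> \<nu>
    using coef_nonzero[of q \<mu> \<nu> D] q V[OF that] by auto
  define X where "X = L2_lincomb M V z (\<lambda>\<nu>. gen_op M t \<nu> e)"
  define Y where "Y = L2_lincomb M S w (\<lambda>\<mu>. gen_op M t \<mu> e)"
  have XY: "X \<in> L2 M" "Y \<in> L2 M" using finV finS e by (simp_all add: X_def Y_def)
  have normX: "(L2_norm M X)\<^sup>2 = F * (\<Sum>\<nu>\<in>V. (norm (z \<nu>))\<^sup>2)"
    unfolding X_def using finV e V by (intro L2_norm_lincomb_orthogonal) (simp_all add: orth)
  have normY: "(L2_norm M Y)\<^sup>2 = F * (\<Sum>\<mu>\<in>S. (norm (w \<mu>))\<^sup>2)"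
    unfolding Y_def using finS e S by (intro L2_norm_lincomb_orthogonal) (simp_all add: orth)
  \<comment> \<open>Rows of a length other than \<open>l\<close> drop out because their vectors are
    orthogonal to \<open>Y\<close>; this is where the absence of periods is used.\<close>
  have innerY: "coef q \<mu> \<nu> * L2_inner M (gen_op M t \<mu> e) Y
      = (if \<mu> \<in> S then coef q \<mu> \<nu> * (cnj (w \<mu>) * of_real F) else 0)" if "\<nu> \<in> V" for \<mu> \<nu>
  proof (cases "coef q \<mu> \<nu> = 0")
    case False
    then have \<mu>: "admissible A \<mu>" "\<mu> \<noteq> []" "last \<mu> = r" "length \<mu> \<le> N + D" using coef0[OF that, of \<mu>] by auto
    have "L2_inner M (gen_op M t \<mu> e) Y = (\<Sum>\<mu>'\<in>S. cnj (w \<mu>') * L2_inner M (gen_op M t \<mu> e) (gen_op M t \<mu>' e))"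
      unfolding Y_def using finS e by simp
    also have "\<dots> = (\<Sum>\<mu>'\<in>S. if \<mu> = \<mu>' then cnj (w \<mu>') * of_real F else 0)"
      using S by (intro sum.cong refl) (simp add: orth[OF \<mu>])
    also have "\<dots> = (if \<mu> \<in> S then cnj (w \<mu>) * of_real F else 0)"
      using finS by (rule sum.delta')
    finally show ?thesis by simp
  qed simp
  define L where "L = Suc (N + D)"
  have "L2_inner M (poly_op M t q X) Y = (\<Sum>\<nu>\<in>V. z \<nu> * L2_inner M (poly_op M t q (gen_op M t \<nu> e)) Y)"
    unfolding X_def using finV e XY by (intro poly_op_lincomb) auto
  also have "\<dots> = (\<Sum>\<nu>\<in>V. z \<nu> * (\<Sum>\<mu>\<in>{\<mu>. length \<mu> < L}. coef q \<mu> \<nu> * L2_inner M (gen_op M t \<mu> e) Y))"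
    using q V e XY by (intro sum.cong refl arg_cong[of _ _ "\<lambda>x. _ * x"] poly_op_gen_op[of q D])
      (auto simp: L_def)
  also have "\<dots> = (\<Sum>\<nu>\<in>V. z \<nu> * (\<Sum>\<mu>\<in>S. coef q \<mu> \<nu> * (cnj (w \<mu>) * of_real F)))"
  proof (rule sum.cong[OF refl])
    fix \<nu> assume \<nu>: "\<nu> \<in> V"
    have "(\<Sum>\<mu>\<in>{\<mu>. length \<mu> < L}. coef q \<mu> \<nu> * L2_inner M (gen_op M t \<mu> e) Y)
        = (\<Sum>\<mu>\<in>S. coef q \<mu> \<nu> * (cnj (w \<mu>) * of_real F))"
      unfolding innerY[OF \<nu>] by (rule sum.mono_neutral_cong_right) (auto simp: S_def L_def)
    then show "z \<nu> * (\<Sum>\<mu>\<in>{\<mu>. length \<mu> < L}. coef q \<mu> \<nu> * L2_inner M (gen_op M t \<mu> e) Y)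
        = z \<nu> * (\<Sum>\<mu>\<in>S. coef q \<mu> \<nu> * (cnj (w \<mu>) * of_real F))"
      by (simp only:)
  qed
  also have "\<dots> = (\<Sum>\<mu>\<in>S. of_real F * (w \<mu> * cnj (w \<mu>)))"
  proof -
    have "(\<Sum>\<nu>\<in>V. z \<nu> * (coef q \<mu> \<nu> * (cnj (w \<mu>) * of_real F))) = of_real F * (w \<mu> * cnj (w \<mu>))" for \<mu>
    proof -
      have "(\<Sum>\<nu>\<in>V. z \<nu> * (coef q \<mu> \<nu> * (cnj (w \<mu>) * of_real F)))
          = (\<Sum>\<nu>\<in>V. (coef q \<mu> \<nu> * z \<nu>) * (cnj (w \<mu>) * of_real F))"
        by (intro sum.cong) simp_all
      also have "\<dots> = w \<mu> * (cnj (w \<mu>) * of_real F)"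
        by (simp only: sum_distrib_right[symmetric] w_def)
      finally show ?thesis by simp
    qed
    then show ?thesis unfolding sum_distrib_left by (subst sum.swap) (simp only:)
  qed
  also have "\<dots> = of_real (F * (\<Sum>\<mu>\<in>S. (norm (w \<mu>))\<^sup>2))"
    by (simp only: complex_norm_square[symmetric] of_real_mult of_real_sum sum_distrib_left)
  also have "\<dots> = L2_inner M Y Y" by (simp only: normY L2_inner_self_norm)
  finally have "norm (L2_inner M Y Y) = norm (L2_inner M (poly_op M t q X) Y)" by (simp only:)
  also have "\<dots> \<le> L2_norm M (poly_op M t q X) * L2_norm M Y"
    using XY by (intro L2_cauchy_schwarz) auto
  also have "\<dots> \<le> (K * L2_norm M X) * L2_norm M Y"
    by (intro mult_right_mono K(2) XY) simp
  finally have "L2_norm M Y \<le> K * L2_norm M X"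
    using K(1) by (intro L2_norm_leI) simp_all
  then have "(L2_norm M Y)\<^sup>2 \<le> K\<^sup>2 * (L2_norm M X)\<^sup>2"
    using power_mono[of "L2_norm M Y" "K * L2_norm M X" 2] by (simp add: power_mult_distrib)
  then have "(\<Sum>\<mu>\<in>S. (norm (w \<mu>))\<^sup>2) \<le> K\<^sup>2 * (\<Sum>\<nu>\<in>V. (norm (z \<nu>))\<^sup>2)"
    unfolding normX normY using F by (simp add: mult.left_commute)
  moreover have "(\<Sum>\<mu>\<in>{\<mu>. length \<mu> = l \<and> last \<mu> = r}. (norm (w \<mu>))\<^sup>2) = (\<Sum>\<mu>\<in>S. (norm (w \<mu>))\<^sup>2)"
  proof (rule sum.mono_neutral_right)
    show "finite {\<mu> :: 'i list. length \<mu> = l \<and> last \<mu> = r}"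
      by (rule finite_subset[OF _ finite_words(1)[of l]]) auto
    show "\<forall>\<mu>\<in>{\<mu>. length \<mu> = l \<and> last \<mu> = r} - S. (norm (w \<mu>))\<^sup>2 = 0"
    proof
      fix \<mu> assume "\<mu> \<in> {\<mu>. length \<mu> = l \<and> last \<mu> = r} - S"
      then have "coef q \<mu> \<nu> = 0" if "\<nu> \<in> V" for \<nu> using coef0[OF that, of \<mu>] by (auto simp: S_def)
      then show "(norm (w \<mu>))\<^sup>2 = 0" by (simp add: w_def)
    qed
  qed (auto simp: S_def)
  ultimately show ?thesis by (simp only: w_def)
qed

text \<open>Some \<open>s j X\<close> is nonzero, since the range projections sum to 1.
  Irreducibility gives a path from \<open>k\<close> to \<open>j\<close>, and the corresponding word
  of generators is isometric on \<open>U\<close>, so its first factor \<open>t k\<close> cannot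
  vanish.\<close>

lemma generator_nonzero:
  assumes "irreducible_matrix A" "L2 M \<noteq> {L2_zero M}"
  shows "\<exists>f\<in>L2 M. s k (t k f) = f \<and> f \<noteq> L2_zero M"
proof -
  obtain X where X: "X \<in> L2 M" "X \<noteq> L2_zero M" using assms(2) L2_zero_in[of M] by blast
  then have "(\<Sum>j\<in>UNIV. L2_inner M (s j X) (s j X)) \<noteq> 0"
    using total[OF X(1) X(1)] by (simp add: L2_inner_self_norm L2_norm_zero_iff)
  then obtain j where j: "L2_inner M (s j X) (s j X) \<noteq> 0" by (meson sum.neutral)
  \<comment> \<open>This form makes it immediate from \<open>partial_isom\<close> that the initial
    projection of \<open>t j\<close> fixes \<open>U\<close>.\<close>
  define U where "U = s j (t j (s j X))"
  have U: "U \<in> L2 M" "s j (t j U) = U" "L2_inner M U (s j X) \<noteq> 0"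
    using X j by (simp_all add: U_def s_adjoint t_adjoint)
  obtain n where n: "(((**) A ^^ n) (mat 1)) $ k $ j > 0"
    using assms(1) by (auto simp: irreducible_matrix_def)
  obtain w where w: "length w = Suc n" "admissible A w" "hd w = k" "last w = j"
    using matrix_power_path[OF zero_one n] by blast
  have w0: "w \<noteq> []" using w by auto
  have "U \<noteq> L2_zero M" using U(3) X by auto
  moreover have "L2_inner M (gen_op M t w U) (gen_op M t w U) = L2_inner M U U"
    using U w w0 by (intro gen_op_inner_same) auto
  ultimately have "gen_op M t w U \<noteq> L2_zero M"
    using U(1) L2_norm_zero_iff[OF U(1)] by (metis L2_inner_zero_left L2_norm_def L2_zero_in real_sqrt_zero zero_complex.simps(1))
  moreover have "gen_op M t w U = t k (gen_op M t (tl w) U)" using w w0 by (cases w) auto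
  ultimately have "t k (gen_op M t (tl w) U) \<noteq> L2_zero M" by simp
  then have "s k (t k (gen_op M t (tl w) U)) \<noteq> L2_zero M"
    using U(1) by (metis partial_isom t_zero word_op_L2)
  then show ?thesis using U(1) by (intro bexI[of _ "s k (t k (gen_op M t (tl w) U))"]) auto
qed

text \<open>Nonzero coefficients connect only words with the same last letter. The matrix is block
  diagonal, so the bounds for the blocks add up without loss.\<close>

lemma coef_bound:
  assumes A: "irreducible_matrix A" "\<not> permutation_matrix A" and L2: "L2 M \<noteq> {L2_zero M}"
    and q: "\<And>m. m \<in> set q \<Longrightarrow> length (snd m) \<le> D" "D < N"
    and K: "K \<ge> 0" "\<And>X. X \<in> L2 M \<Longrightarrow> L2_norm M (poly_op M t q X) \<le> K * L2_norm M X"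
  defines "V \<equiv> {\<nu>. length \<nu> = N \<and> admissible A \<nu>}"
  shows "(\<Sum>\<mu>\<in>{\<mu>. length \<mu> = l}. (norm (\<Sum>\<nu>\<in>V. coef q \<mu> \<nu> * z \<nu>))\<^sup>2) \<le> K\<^sup>2 * (\<Sum>\<nu>\<in>V. (norm (z \<nu>))\<^sup>2)"
proof -
  have finV: "finite V" unfolding V_def by (rule finite_subset[OF _ finite_words(1)[of N]]) auto
  have block: "(\<Sum>\<mu>\<in>{\<mu>. length \<mu> = l \<and> last \<mu> = r}. (norm (\<Sum>\<nu>\<in>V. coef q \<mu> \<nu> * z \<nu>))\<^sup>2)
      \<le> K\<^sup>2 * (\<Sum>\<nu>\<in>{\<nu> \<in> V. last \<nu> = r}. (norm (z \<nu>))\<^sup>2)" for r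
  proof -
    \<comment> \<open>A successor of \<open>r\<close> as first letter of \<gamma> keeps
      \<open>\<nu> @ \<gamma>\<close> admissible for every admissible \<nu> ending in
      \<open>r\<close>.\<close>
    obtain j where j: "A $ r $ j = 1" using zero_one unfolding zero_one_matrix_def by blast
    obtain \<gamma> where \<gamma>: "\<gamma> \<noteq> []" "hd \<gamma> = j" "admissible A \<gamma>" "\<And>p. p \<in> {1..N + D} \<Longrightarrow> aperiodic p \<gamma>"
      using aperiodic_word[OF zero_one A] by blast
    obtain f where f: "f \<in> L2 M" "s (last \<gamma>) (t (last \<gamma>) f) = f" "f \<noteq> L2_zero M"
      using generator_nonzero[OF A(1) L2] by blast
    have V: "{\<nu> \<in> V. last \<nu> = r} = {\<nu>. length \<nu> = N \<and> admissible A \<nu> \<and> last \<nu> = r}"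
      by (auto simp: V_def)
    have "(\<Sum>\<nu>\<in>V. coef q \<mu> \<nu> * z \<nu>) = (\<Sum>\<nu>\<in>{\<nu> \<in> V. last \<nu> = r}. coef q \<mu> \<nu> * z \<nu>)"
      if "last \<mu> = r" for \<mu>
    proof (rule sum.mono_neutral_right[OF finV])
      show "\<forall>\<nu>\<in>V - {\<nu> \<in> V. last \<nu> = r}. coef q \<mu> \<nu> * z \<nu> = 0"
        using coef_nonzero(2)[of q \<mu> _ D] q that by (fastforce simp: V_def)
    qed auto
    then have "(\<Sum>\<mu>\<in>{\<mu>. length \<mu> = l \<and> last \<mu> = r}. (norm (\<Sum>\<nu>\<in>V. coef q \<mu> \<nu> * z \<nu>))\<^sup>2)
        = (\<Sum>\<mu>\<in>{\<mu>. length \<mu> = l \<and> last \<mu> = r}. (norm (\<Sum>\<nu>\<in>{\<nu> \<in> V. last \<nu> = r}. coef q \<mu> \<nu> * z \<nu>))\<^sup>2)"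
      by (intro sum.cong) auto
    also have "\<dots> \<le> K\<^sup>2 * (\<Sum>\<nu>\<in>{\<nu> \<in> V. last \<nu> = r}. (norm (z \<nu>))\<^sup>2)"
      unfolding V using q K \<gamma> f j by (intro coef_block_bound[of q D N K \<gamma> r f]) auto
    finally show ?thesis .
  qed
  have "(\<Sum>\<mu>\<in>{\<mu>. length \<mu> = l}. (norm (\<Sum>\<nu>\<in>V. coef q \<mu> \<nu> * z \<nu>))\<^sup>2)
      = (\<Sum>r\<in>UNIV. \<Sum>\<mu>\<in>{\<mu> \<in> {\<mu>. length \<mu> = l}. last \<mu> = r}. (norm (\<Sum>\<nu>\<in>V. coef q \<mu> \<nu> * z \<nu>))\<^sup>2)"
    by (rule sum.group[symmetric]) auto
  also have "\<dots> \<le> (\<Sum>r\<in>UNIV. K\<^sup>2 * (\<Sum>\<nu>\<in>{\<nu> \<in> V. last \<nu> = r}. (norm (z \<nu>))\<^sup>2))"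
    using block by (intro sum_mono) simp
  also have "\<dots> = K\<^sup>2 * (\<Sum>r\<in>UNIV. \<Sum>\<nu>\<in>{\<nu> \<in> V. last \<nu> = r}. (norm (z \<nu>))\<^sup>2)"
    by (rule sum_distrib_left[symmetric])
  also have "(\<Sum>r\<in>UNIV. \<Sum>\<nu>\<in>{\<nu> \<in> V. last \<nu> = r}. (norm (z \<nu>))\<^sup>2) = (\<Sum>\<nu>\<in>V. (norm (z \<nu>))\<^sup>2)"
    using finV by (rule sum.group) auto
  finally show ?thesis .
qed

end

text \<open>The matrix bounds come from the second family and are used in the first. With words of
  length \<open>Suc D\<close> the image words have length at most \<open>2 * D + 1\<close>, which
  leaves \<open>2 * D + 2\<close> possible lengths.\<close>

lemma poly_norm_transfer_coarse:
  fixes t :: "'i::finite \<Rightarrow> 'a L2_op" and t' :: "'i \<Rightarrow> 'b L2_op"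
  assumes "ck_family M A t" "ck_family M' A t'"
    and A: "irreducible_matrix A" "\<not> permutation_matrix A" and L2: "L2 M' \<noteq> {L2_zero M'}"
    and q: "\<And>m. m \<in> set q \<Longrightarrow> length (snd m) \<le> D"
    and K: "K \<ge> 0" "\<And>X. X \<in> L2 M' \<Longrightarrow> L2_norm M' (poly_op M' t' q X) \<le> K * L2_norm M' X"
    and X: "X \<in> L2 M"
  shows "L2_norm M (poly_op M t q X) \<le> real (2 * D + 2) * K * L2_norm M X"
proof -
  interpret T: ck_family M A t by fact
  interpret T': ck_family M' A t' by fact
  show ?thesis
  proof (rule T.poly_op_upper[of q D "Suc D"])
    show "(\<Sum>\<mu>\<in>{\<mu>. length \<mu> = l}. (norm (\<Sum>\<nu>\<in>{\<nu>. length \<nu> = Suc D \<and> admissible A \<nu>}. T.coef q \<mu> \<nu> * z \<nu>))\<^sup>2)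
        \<le> K\<^sup>2 * (\<Sum>\<nu>\<in>{\<nu>. length \<nu> = Suc D \<and> admissible A \<nu>}. (norm (z \<nu>))\<^sup>2)" for l z
      using q K by (intro T'.coef_bound[of q D "Suc D"] A L2) auto
  qed (use q K X in auto)
qed

subsection \<open>Equality of norms\<close>

primrec star_square :: "(complex \<times> ('i \<times> bool) list) list \<Rightarrow> nat \<Rightarrow> (complex \<times> ('i \<times> bool) list) list" where
  "star_square p 0 = p"
| "star_square p (Suc n) = poly_mult (poly_star (star_square p n)) (star_square p n)"

lemma star_square_length:
  assumes "\<And>m. m \<in> set p \<Longrightarrow> length (snd m) \<le> D" "m \<in> set (star_square p n)"
  shows "length (snd m) \<le> 2 ^ n * D"
  using assms(2)
proof (induction n arbitrary: m)
  case (Suc n)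
  obtain a b where ab: "a \<in> set (star_square p n)" "b \<in> set (star_square p n)"
    "length (snd m) = length (snd a) + length (snd b)"
    using Suc.prems by (auto simp: poly_mult_def poly_star_def word_star_def)
  then show ?case using Suc.IH[OF ab(1)] Suc.IH[OF ab(2)] by simp
qed (use assms(1) in simp)

context op_family
begin

lemma poly_star_bound:
  assumes "K \<ge> 0" "\<And>X. X \<in> L2 M \<Longrightarrow> L2_norm M (poly_op M t q X) \<le> K * L2_norm M X" "X \<in> L2 M"
  shows "L2_norm M (poly_op M t (poly_star q) X) \<le> K * L2_norm M X"
  by (rule adjoint_bound[of M "poly_op M t q", OF _ _ _ assms]) (simp_all add: poly_op_adjoint)

lemma star_square_bound:
  assumes "K \<ge> 0" "\<And>X. X \<in> L2 M \<Longrightarrow> L2_norm M (poly_op M t p X) \<le> K * L2_norm M X" "X \<in> L2 M"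
  shows "L2_norm M (poly_op M t (star_square p n) X) \<le> K ^ (2 ^ n) * L2_norm M X"
  using assms(3)
proof (induction n arbitrary: X)
  case 0
  then show ?case using assms(2) by simp
next
  case (Suc n)
  let ?q = "star_square p n"
  have K: "K ^ (2 ^ n) \<ge> 0" using assms(1) by simp
  have "L2_norm M (poly_op M t (poly_star ?q) (poly_op M t ?q X))
      \<le> K ^ (2 ^ n) * L2_norm M (poly_op M t ?q X)"
    using Suc by (intro poly_star_bound[OF K]) auto
  also have "\<dots> \<le> K ^ (2 ^ n) * (K ^ (2 ^ n) * L2_norm M X)"
    using Suc K by (intro mult_left_mono) auto
  finally show ?case using Suc.prems by (simp add: poly_op_mult power_add mult_2 mult.assoc)
qed

text \<open>The C*-identity in vector form: the squared norm of \<open>?q\<close> at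
  \<open>X\<close> is the inner product of the next iterated square at \<open>X\<close> with
  \<open>X\<close>. Each step down takes a square root of the constant.\<close>

lemma star_square_bound_converse:
  assumes "K \<ge> 0" "\<And>X. X \<in> L2 M \<Longrightarrow> L2_norm M (poly_op M t (star_square p n) X) \<le> K ^ (2 ^ n) * L2_norm M X"
    "X \<in> L2 M"
  shows "L2_norm M (poly_op M t p X) \<le> K * L2_norm M X"
  using assms(2,3)
proof (induction n arbitrary: X)
  case (Suc n)
  let ?q = "star_square p n"
  have "L2_norm M (poly_op M t ?q X) \<le> K ^ (2 ^ n) * L2_norm M X" if X: "X \<in> L2 M" for X
  proof (rule power2_le_imp_le)
    have "complex_of_real ((L2_norm M (poly_op M t ?q X))\<^sup>2)
        = L2_inner M (poly_op M t (star_square p (Suc n)) X) X"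
      using X by (simp add: poly_op_mult poly_op_adjoint L2_inner_self_norm[symmetric] del: of_real_power)
    then have "(L2_norm M (poly_op M t ?q X))\<^sup>2 = norm (L2_inner M (poly_op M t (star_square p (Suc n)) X) X)"
      by (metis norm_of_real abs_of_nonneg zero_le_power2)
    also have "\<dots> \<le> L2_norm M (poly_op M t (star_square p (Suc n)) X) * L2_norm M X"
      using X by (intro L2_cauchy_schwarz poly_op_L2)
    also have "\<dots> \<le> (K ^ (2 ^ Suc n) * L2_norm M X) * L2_norm M X"
      by (intro mult_right_mono Suc.prems X) simp
    also have "\<dots> = (K ^ (2 ^ n) * L2_norm M X)\<^sup>2"
      by (simp add: power_mult_distrib power2_eq_square mult_2 power_add)
    finally show "(L2_norm M (poly_op M t ?q X))\<^sup>2 \<le> (K ^ (2 ^ n) * L2_norm M X)\<^sup>2" .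
  qed (use assms(1) in simp)
  then show ?case using Suc by blast
qed simp

end

text \<open>The linear loss in the coarse comparison disappears upon passing to high powers.\<close>

lemma poly_norm_transfer:
  fixes t :: "'i::finite \<Rightarrow> 'a L2_op" and t' :: "'i \<Rightarrow> 'b L2_op"
  assumes ck: "ck_family M A t" "ck_family M' A t'"
    and A: "irreducible_matrix A" "\<not> permutation_matrix A" and L2: "L2 M' \<noteq> {L2_zero M'}"
    and K: "K \<ge> 0" "\<And>X. X \<in> L2 M' \<Longrightarrow> L2_norm M' (poly_op M' t' p X) \<le> K * L2_norm M' X"
    and X: "X \<in> L2 M"
  shows "L2_norm M (poly_op M t p X) \<le> K * L2_norm M X"
proof -
  interpret T: ck_family M A t by fact
  interpret T': ck_family M' A t' by fact
  define D where "D = Max (insert 0 ((\<lambda>m. length (snd m)) ` set p))"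
  have D: "length (snd m) \<le> D" if "m \<in> set p" for m
    unfolding D_def using that by (intro Max_ge) auto
  \<comment> \<open>The strict inequality \<open>c > K\<close> is essential: the geometric decay of
    the powers of \<open>K / c\<close> beats the factor that is linear in
    \<open>2 ^ n\<close>.\<close>
  have le: "L2_norm M (poly_op M t p X) \<le> c * L2_norm M X" if c: "c > K" for c
  proof -
    have c0: "c > 0" using c K(1) by linarith
    define x where "x = K / c"
    have x: "norm x < 1" "x \<ge> 0" using c c0 K(1) by (auto simp: x_def)
    have "(\<lambda>m. real m * x ^ m) \<longlonglongrightarrow> 0" using powser_times_n_limit_0[OF x(1)] by simp
    then have "(\<lambda>m. 2 * real D * (real m * x ^ m) + 2 * x ^ m) \<longlonglongrightarrow> 2 * real D * 0 + 2 * 0"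
      by (intro tendsto_add tendsto_mult tendsto_const LIMSEQ_power_zero[OF x(1)])
    then have "\<forall>\<^sub>F m in sequentially. 2 * real D * (real m * x ^ m) + 2 * x ^ m < 1"
      by (rule order_tendstoD(2)) simp
    then obtain n where "\<And>m. m \<ge> n \<Longrightarrow> 2 * real D * (real m * x ^ m) + 2 * x ^ m < 1"
      by (auto simp: eventually_sequentially)
    then have "2 * real D * (real (2 ^ n) * x ^ (2 ^ n)) + 2 * x ^ (2 ^ n) < 1"
      using less_exp[of n] by (meson less_imp_le)
    then have "real (2 * (2 ^ n * D) + 2) * x ^ (2 ^ n) \<le> 1" by (simp add: algebra_simps)
    then have num: "real (2 * (2 ^ n * D) + 2) * K ^ (2 ^ n) \<le> c ^ (2 ^ n)"
      using c0 by (simp add: x_def power_divide field_simps)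
    show ?thesis
    proof (rule T.star_square_bound_converse[OF _ _ X])
      show "c \<ge> 0" using c0 by simp
      fix X assume X: "X \<in> L2 M"
      have "L2_norm M (poly_op M t (star_square p n) X)
          \<le> real (2 * (2 ^ n * D) + 2) * K ^ (2 ^ n) * L2_norm M X"
      proof (rule poly_norm_transfer_coarse[OF ck A L2 _ _ _ X])
        show "length (snd m) \<le> 2 ^ n * D" if "m \<in> set (star_square p n)" for m
          using star_square_length[of p D m n] D that by blast
        show "L2_norm M' (poly_op M' t' (star_square p n) X) \<le> K ^ (2 ^ n) * L2_norm M' X"
          if "X \<in> L2 M'" for X
          using T'.star_square_bound[of K p X n] K that by blast
      qed (use K in simp)
      also have "\<dots> \<le> c ^ (2 ^ n) * L2_norm M X" by (intro mult_right_mono num) simp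
      finally show "L2_norm M (poly_op M t (star_square p n) X) \<le> c ^ (2 ^ n) * L2_norm M X" .
    qed
  qed
  show ?thesis
  proof (rule LIMSEQ_le_const)
    show "(\<lambda>n. (K + 1 / real (Suc n)) * L2_norm M X) \<longlonglongrightarrow> K * L2_norm M X"
      using tendsto_mult[OF tendsto_add[OF tendsto_const LIMSEQ_Suc[OF lim_1_over_n]] tendsto_const, of K "L2_norm M X"]
      by simp
    show "\<exists>N. \<forall>n\<ge>N. L2_norm M (poly_op M t p X) \<le> (K + 1 / real (Suc n)) * L2_norm M X"
      by (intro exI allI impI le) simp
  qed
qed

lemma op_norm_transfer:
  fixes t :: "'i::finite \<Rightarrow> 'a L2_op" and t' :: "'i \<Rightarrow> 'b L2_op"
  assumes ck: "ck_family M A t" "ck_family M' A t'"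
    and A: "irreducible_matrix A" "\<not> permutation_matrix A" and L2: "L2 M' \<noteq> {L2_zero M'}"
  shows "op_norm M (npoly_eval (op_algebra M) t p) \<le> op_norm M' (npoly_eval (op_algebra M') t' p)"
proof -
  interpret T: ck_family M A t by fact
  interpret T': ck_family M' A t' by fact
  interpret B: banach_star_algebra "op_algebra M'" by (rule banach_star_op_algebra)
  have in': "npoly_eval (op_algebra M') t' p \<in> bounded_ops M'"
    using B.npoly_eval_closed[of t' p] by simp
  show ?thesis
  proof (rule op_norm_le[OF op_norm_nonneg[OF in']])
    fix X assume X: "X \<in> L2 M"
    have "L2_norm M (poly_op M t (poly_flat p) X)
        \<le> op_norm M' (npoly_eval (op_algebra M') t' p) * L2_norm M X"
      by (rule poly_norm_transfer[OF ck A L2 op_norm_nonneg[OF in'] _ X])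
        (use op_norm_bound[OF in'] T'.poly_flat_eval in simp)
    then show "L2_norm M (npoly_eval (op_algebra M) t p X)
        \<le> op_norm M' (npoly_eval (op_algebra M') t' p) * L2_norm M X"
      using T.poly_flat_eval[OF X] by simp
  qed
qed

section \<open>Weighted composition operators\<close>

lemma L2_add_class:
  assumes "f \<in> sq_int M" "g \<in> sq_int M"
  shows "L2_add M (L2_class M f) (L2_class M g) = L2_class M (\<lambda>x. f x + g x)"
proof -
  have m: "f \<in> borel_measurable M" "g \<in> borel_measurable M" using assms by (auto dest: sq_int_measurable)
  note [measurable] = L2_rep_class(1)[OF m(1)] L2_rep_class(1)[OF m(2)] m
  have "AE x in M. L2_rep (L2_class M f) x + L2_rep (L2_class M g) x = f x + g x"
    using L2_rep_class(2)[OF m(1)] L2_rep_class(2)[OF m(2)] by eventually_elim simp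
  then show ?thesis unfolding L2_add_def by (intro L2_class_eq_iff[THEN iffD2]) auto
qed

lemma L2_scale_class:
  assumes "f \<in> sq_int M"
  shows "L2_scale M c (L2_class M f) = L2_class M (\<lambda>x. c * f x)"
proof -
  have m: "f \<in> borel_measurable M" using assms by (auto dest: sq_int_measurable)
  note [measurable] = L2_rep_class(1)[OF m] m
  have "AE x in M. c * L2_rep (L2_class M f) x = c * f x"
    using L2_rep_class(2)[OF m] by eventually_elim simp
  then show ?thesis unfolding L2_scale_def by (intro L2_class_eq_iff[THEN iffD2]) auto
qed

text \<open>The common ground of the Radon-Nikodym operators and the model on the sequence space.
  The density \<open>J\<close> plays the role of the derivative of m after \<theta>,
  \<open>change\<close> is its defining property on a cell, and \<open>\<psi> i\<close> is the
  measurable inverse branch on the image of cell \<open>i\<close>.\<close>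

locale weighted_composition =
  fixes M :: "'a measure" and \<theta> :: "'a \<Rightarrow> 'a" and a :: "'i::finite \<Rightarrow> 'a set" and J :: "'a \<Rightarrow> real"
    and \<psi> :: "'i \<Rightarrow> 'a \<Rightarrow> 'a" and A :: "nat^'i^'i"
  assumes space: "space M = UNIV"
    and map [measurable]: "\<theta> \<in> M \<rightarrow>\<^sub>M M"
    and cell [measurable]: "a i \<in> sets M"
    and cell_image [measurable]: "\<theta> ` a i \<in> sets M"
    and cells_disjoint: "disjoint_family a"
    and cells_cover: "(\<Union>i. a i) = UNIV"
    and weight [measurable]: "J \<in> borel_measurable M"
    and weight_nonneg: "0 \<le> J x"
    and weight_pos: "AE x in M. 0 < J x"
    and change: "E \<in> sets M \<Longrightarrow>
      (\<integral>\<^sup>+x. ennreal (J x) * indicator (a i \<inter> \<theta> -` E) x \<partial>M) = emeasure M (E \<inter> \<theta> ` a i)"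
    and inverse [measurable]: "\<psi> i \<in> M \<rightarrow>\<^sub>M M"
    and inverse_eq: "x \<in> a i \<Longrightarrow> \<psi> i (\<theta> x) = x"
    and incidence: "AE x in M. indicator (\<theta> ` a i) x = (\<Sum>j\<in>UNIV. of_nat (A $ i $ j) * indicator (a j) x :: complex)"
begin

definition weighted_op where
  "weighted_op i = (\<lambda>X\<in>L2 M. L2_class M (\<lambda>x.
     indicator (a i) x * of_real (sqrt (J x)) * L2_rep X (\<theta> x)))"

text \<open>The change of variables as an equality of measures, from which the formulas for
  nonnegative and for complex integrands both follow.\<close>

lemma push: "distr (density M (\<lambda>x. ennreal (indicator (a i) x * J x))) M \<theta>
    = density M (\<lambda>x. ennreal (indicator (\<theta> ` a i) x))"
proof (rule measure_eqI)
  fix E assume "E \<in> sets (distr (density M (\<lambda>x. ennreal (indicator (a i) x * J x))) M \<theta>)"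
  then have E [measurable]: "E \<in> sets M" by simp
  have "emeasure (distr (density M (\<lambda>x. ennreal (indicator (a i) x * J x))) M \<theta>) E
      = (\<integral>\<^sup>+x. ennreal (indicator (a i) x * J x) * indicator (\<theta> -` E \<inter> space M) x \<partial>M)"
    by (subst emeasure_distr) (simp_all add: emeasure_density)
  also have "\<dots> = (\<integral>\<^sup>+x. ennreal (J x) * indicator (a i \<inter> \<theta> -` E) x \<partial>M)"
    by (intro nn_integral_cong) (auto simp: space indicator_def)
  also have "\<dots> = (\<integral>\<^sup>+x. indicator (E \<inter> \<theta> ` a i) x \<partial>M)" by (simp add: change)
  also have "\<dots> = (\<integral>\<^sup>+x. ennreal (indicator (\<theta> ` a i) x) * indicator E x \<partial>M)"
    by (intro nn_integral_cong) (auto simp: indicator_def)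
  finally show "emeasure (distr (density M (\<lambda>x. ennreal (indicator (a i) x * J x))) M \<theta>) E
      = emeasure (density M (\<lambda>x. ennreal (indicator (\<theta> ` a i) x))) E"
    by (simp add: emeasure_density)
qed simp

lemma change_nn:
  assumes [measurable]: "F \<in> borel_measurable M"
  shows "(\<integral>\<^sup>+x. ennreal (indicator (a i) x * J x) * F (\<theta> x) \<partial>M)
    = (\<integral>\<^sup>+x. ennreal (indicator (\<theta> ` a i) x) * F x \<partial>M)"
proof -
  have "(\<integral>\<^sup>+x. F x \<partial>distr (density M (\<lambda>x. ennreal (indicator (a i) x * J x))) M \<theta>)
      = (\<integral>\<^sup>+x. ennreal (indicator (a i) x * J x) * F (\<theta> x) \<partial>M)"
    by (subst nn_integral_distr) (simp_all add: nn_integral_density)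
  then show ?thesis unfolding push by (simp add: nn_integral_density)
qed

lemma change_integral:
  fixes F :: "'a \<Rightarrow> complex"
  assumes [measurable]: "F \<in> borel_measurable M"
  shows "(LINT x|M. (indicator (a i) x * J x) *\<^sub>R F (\<theta> x)) = (LINT x|M. indicator (\<theta> ` a i) x *\<^sub>R F x)"
proof -
  have "integral\<^sup>L (distr (density M (\<lambda>x. ennreal (indicator (a i) x * J x))) M \<theta>) F
      = (LINT x|M. (indicator (a i) x * J x) *\<^sub>R F (\<theta> x))"
    by (subst integral_distr) (simp_all add: integral_density weight_nonneg)
  then show ?thesis unfolding push by (simp add: integral_density)
qed

text \<open>For a null set \<open>N\<close> the integral of \<open>J\<close> over the points of a
  cell mapped into \<open>N\<close> is zero, and \<open>J\<close> is positive almost everywhere.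
  This makes composition with \<theta> well defined on classes.\<close>

lemma AE_map:
  assumes "AE x in M. P x"
  shows "AE x in M. P (\<theta> x)"
proof -
  obtain N where N: "{x \<in> space M. \<not> P x} \<subseteq> N" "emeasure M N = 0" "N \<in> sets M"
    using assms by (rule AE_E)
  have "AE x in M. ennreal (indicator (a i) x * J x) * indicator N (\<theta> x) = 0" for i
  proof (rule nn_integral_0_iff_AE[THEN iffD1])
    have [measurable]: "N \<in> sets M" by fact
    have "(\<integral>\<^sup>+x. ennreal (indicator (\<theta> ` a i) x) * indicator N x \<partial>M) \<le> (\<integral>\<^sup>+x. indicator N x \<partial>M)"
      by (intro nn_integral_mono) (auto simp: indicator_def)
    also have "\<dots> = 0" using N by simp
    finally show "(\<integral>\<^sup>+x. ennreal (indicator (a i) x * J x) * indicator N (\<theta> x) \<partial>M) = 0"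
      by (subst change_nn) auto
    show "(\<lambda>x. ennreal (indicator (a i) x * J x) * indicator N (\<theta> x)) \<in> borel_measurable M"
      by measurable
  qed
  then have "AE x in M. \<forall>i\<in>UNIV. ennreal (indicator (a i) x * J x) * indicator N (\<theta> x) = 0"
    by (intro AE_finite_allI) auto
  then show ?thesis using weight_pos
  proof eventually_elim
    case (elim x)
    obtain i where "x \<in> a i" using cells_cover by blast
    then have "\<theta> x \<notin> N" using elim by (auto simp: indicator_def split: if_splits)
    then show ?case using N space by auto
  qed
qed

lemma weighted_measurable:
  assumes [measurable]: "f \<in> borel_measurable M"
  shows "(\<lambda>x. indicator (a i) x * of_real (sqrt (J x)) * f (\<theta> x) :: complex) \<in> borel_measurable M"
  by measurable

lemma weighted_sq_int:
  assumes f: "f \<in> sq_int M"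
  shows "(\<lambda>x. indicator (a i) x * of_real (sqrt (J x)) * f (\<theta> x)) \<in> sq_int M" (is "?g \<in> _")
    and "L2_norm M (L2_class M (\<lambda>x. indicator (a i) x * of_real (sqrt (J x)) * f (\<theta> x))) \<le> L2_norm M (L2_class M f)"
proof -
  have [measurable]: "f \<in> borel_measurable M" using f by (rule sq_int_measurable)
  have "(\<integral>\<^sup>+x. ennreal ((norm (?g x))\<^sup>2) \<partial>M)
      = (\<integral>\<^sup>+x. ennreal (indicator (a i) x * J x) * ennreal ((norm (f (\<theta> x)))\<^sup>2) \<partial>M)"
    by (intro nn_integral_cong)
      (auto simp: indicator_def norm_mult power_mult_distrib weight_nonneg ennreal_mult)
  also have "\<dots> = (\<integral>\<^sup>+x. ennreal (indicator (\<theta> ` a i) x) * ennreal ((norm (f x))\<^sup>2) \<partial>M)"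
    by (rule change_nn) measurable
  also have "\<dots> \<le> (\<integral>\<^sup>+x. ennreal ((norm (f x))\<^sup>2) \<partial>M)"
    by (intro nn_integral_mono) (auto simp: indicator_def)
  also have "\<dots> = ennreal ((L2_norm M (L2_class M f))\<^sup>2)" by (rule L2_norm_class_nn[OF f])
  finally show "?g \<in> sq_int M" "L2_norm M (L2_class M ?g) \<le> L2_norm M (L2_class M f)"
    by (auto intro!: L2_norm_class_le weighted_measurable)
qed

lemma weighted_op_class:
  assumes f: "f \<in> sq_int M"
  shows "weighted_op i (L2_class M f) = L2_class M (\<lambda>x. indicator (a i) x * of_real (sqrt (J x)) * f (\<theta> x))"
proof -
  have m: "f \<in> borel_measurable M" using f by (rule sq_int_measurable)
  have "AE x in M. L2_rep (L2_class M f) (\<theta> x) = f (\<theta> x)"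
    by (rule AE_map) (rule L2_rep_class(2)[OF m])
  then have "AE x in M. indicator (a i) x * of_real (sqrt (J x)) * L2_rep (L2_class M f) (\<theta> x)
      = indicator (a i) x * of_real (sqrt (J x)) * f (\<theta> x)"
    by eventually_elim simp
  then show ?thesis using f unfolding weighted_op_def
    by (simp add: L2_class_eq_iff[OF weighted_measurable[OF L2_rep_class(1)[OF m]] weighted_measurable[OF m]])
qed

lemma weighted_op_L2 [simp]: "X \<in> L2 M \<Longrightarrow> weighted_op i X \<in> L2 M"
  using weighted_op_class[OF L2_rep_sq_int, of X i] weighted_sq_int(1)[OF L2_rep_sq_int, of X i] by simp

lemma weighted_op_in [simp]: "weighted_op i \<in> bounded_ops M"
proof -
  have "weighted_op i (L2_add M X Y) = L2_add M (weighted_op i X) (weighted_op i Y)"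
    if "X \<in> L2 M" "Y \<in> L2 M" for X Y
  proof -
    note s = that[THEN L2_rep_sq_int]
    have "weighted_op i (L2_add M X Y) = L2_class M (\<lambda>x. indicator (a i) x * of_real (sqrt (J x)) * (L2_rep X (\<theta> x) + L2_rep Y (\<theta> x)))"
      unfolding L2_add_def by (rule weighted_op_class[OF sq_int_add[OF s]])
    also have "\<dots> = L2_add M (weighted_op i (L2_class M (L2_rep X))) (weighted_op i (L2_class M (L2_rep Y)))"
      using s by (simp add: weighted_op_class L2_add_class weighted_sq_int distrib_left)
    finally show ?thesis using that by simp
  qed
  moreover have "weighted_op i (L2_scale M c X) = L2_scale M c (weighted_op i X)" if "X \<in> L2 M" for c X
  proof -
    note s = that[THEN L2_rep_sq_int]
    have "weighted_op i (L2_scale M c X) = L2_class M (\<lambda>x. indicator (a i) x * of_real (sqrt (J x)) * (c * L2_rep X (\<theta> x)))"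
      unfolding L2_scale_def by (rule weighted_op_class[OF sq_int_scale[OF s]])
    also have "\<dots> = L2_class M (\<lambda>x. c * (indicator (a i) x * of_real (sqrt (J x)) * L2_rep X (\<theta> x)))"
      by (simp add: mult_ac)
    also have "\<dots> = L2_scale M c (weighted_op i (L2_class M (L2_rep X)))"
      by (simp only: weighted_op_class[OF s] L2_scale_class[OF weighted_sq_int(1)[OF s]])
    finally show ?thesis using that by simp
  qed
  moreover have "\<exists>K. \<forall>X\<in>L2 M. L2_norm M (weighted_op i X) \<le> K * L2_norm M X"
  proof (intro exI[of _ 1] ballI)
    fix X assume X: "X \<in> L2 M"
    show "L2_norm M (weighted_op i X) \<le> 1 * L2_norm M X"
      using weighted_sq_int(2)[OF L2_rep_sq_int[OF X], of i] weighted_op_class[OF L2_rep_sq_int[OF X], of i] X by simp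
  qed
  ultimately show ?thesis
    by (simp add: bounded_ops_def PiE_def) (simp add: weighted_op_def)
qed

abbreviation s where "s i \<equiv> op_adjoint M (weighted_op i)"

lemma weighted_adjoint:
  "X \<in> L2 M \<Longrightarrow> Y \<in> L2 M \<Longrightarrow> L2_inner M (s i X) Y = L2_inner M X (weighted_op i Y)"
  by (rule op_adjoint_left) simp_all

text \<open>The projections in the Cuntz-Krieger relations take this form: final projections belong
  to cells, initial projections to their images under \<theta>.\<close>

definition mult_ind :: "'a set \<Rightarrow> 'a L2_op" where
  "mult_ind E X = L2_class M (\<lambda>x. indicator E x * L2_rep X x)"

lemma sq_int_indicator:
  assumes "E \<in> sets M" "f \<in> sq_int M"
  shows "(\<lambda>x. indicator E x * f x) \<in> sq_int M"
proof (rule sq_int_dominated)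
  have [measurable]: "E \<in> sets M" "f \<in> borel_measurable M" using assms by (auto dest: sq_int_measurable)
  show "(\<lambda>x. indicator E x * f x) \<in> borel_measurable M" by measurable
  show "integrable M (\<lambda>x. (norm (f x))\<^sup>2)" using assms by (auto dest: sq_int_integrable)
qed (auto simp: indicator_def)

lemma mult_ind_L2 [simp]: "E \<in> sets M \<Longrightarrow> X \<in> L2 M \<Longrightarrow> mult_ind E X \<in> L2 M"
  by (simp add: mult_ind_def sq_int_indicator L2_rep_sq_int)

lemma mult_ind_inner:
  assumes "E \<in> sets M" "X \<in> L2 M" "Y \<in> L2 M"
  shows "L2_inner M (mult_ind E X) Y = (LINT x|M. indicator E x * (L2_rep X x * cnj (L2_rep Y x)))"
  using L2_inner_class[OF sq_int_indicator[OF assms(1) L2_rep_sq_int[OF assms(2)]] L2_rep_sq_int[OF assms(3)]] assms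
  by (simp add: mult_ind_def mult.assoc)

text \<open>The two square roots in the inner product combine to \<open>J\<close>, and
  \<open>change_integral\<close> transports the integral from the cell to its image.\<close>

lemma adjoint_weighted_op:
  assumes X: "X \<in> L2 M"
  shows "s i (weighted_op i X) = mult_ind (\<theta> ` a i) X"
proof (rule L2_eqI[where M = M])
  fix Y assume Y: "Y \<in> L2 M"
  have [measurable]: "L2_rep X \<in> borel_measurable M" "L2_rep Y \<in> borel_measurable M"
    using X Y by (auto intro: sq_int_measurable L2_rep_sq_int)
  have "L2_inner M (s i (weighted_op i X)) Y
      = L2_inner M (weighted_op i (L2_class M (L2_rep X))) (weighted_op i (L2_class M (L2_rep Y)))"
    using X Y by (simp add: weighted_adjoint)
  also have "\<dots> = (LINT x|M. indicator (a i) x * of_real (sqrt (J x)) * L2_rep X (\<theta> x) *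
      cnj (indicator (a i) x * of_real (sqrt (J x)) * L2_rep Y (\<theta> x)))"
    unfolding weighted_op_class[OF L2_rep_sq_int[OF X]] weighted_op_class[OF L2_rep_sq_int[OF Y]]
    by (intro L2_inner_class weighted_sq_int L2_rep_sq_int X Y)
  also have "\<dots> = (LINT x|M. (indicator (a i) x * J x) *\<^sub>R (L2_rep X (\<theta> x) * cnj (L2_rep Y (\<theta> x))))"
  proof (rule Bochner_Integration.integral_cong[OF refl])
    fix x
    have "complex_of_real (sqrt (J x)) * of_real (sqrt (J x)) = of_real (J x)"
      using weight_nonneg[of x] by (simp flip: of_real_mult)
    then show "indicator (a i) x * of_real (sqrt (J x)) * L2_rep X (\<theta> x) *
      cnj (indicator (a i) x * of_real (sqrt (J x)) * L2_rep Y (\<theta> x))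
      = (indicator (a i) x * J x) *\<^sub>R (L2_rep X (\<theta> x) * cnj (L2_rep Y (\<theta> x)))"
      by (auto simp: indicator_def scaleR_conv_of_real mult_ac)
  qed
  also have "\<dots> = (LINT x|M. indicator (\<theta> ` a i) x *\<^sub>R (L2_rep X x * cnj (L2_rep Y x)))"
    by (rule change_integral) measurable
  also have "\<dots> = L2_inner M (mult_ind (\<theta> ` a i) X) Y"
    unfolding mult_ind_inner[OF cell_image X Y]
    by (intro Bochner_Integration.integral_cong) (auto simp: indicator_def)
  finally show "L2_inner M (s i (weighted_op i X)) Y = L2_inner M (mult_ind (\<theta> ` a i) X) Y" .
qed (use X in \<open>auto simp: bounded_ops_in[OF op_adjoint_in[OF weighted_op_in]]\<close>)

lemma weighted_op_partial_isometry:
  assumes X: "X \<in> L2 M"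
  shows "weighted_op i (s i (weighted_op i X)) = weighted_op i X"
proof -
  have "weighted_op i (s i (weighted_op i X))
      = L2_class M (\<lambda>x. indicator (a i) x * of_real (sqrt (J x)) * (indicator (\<theta> ` a i) (\<theta> x) * L2_rep X (\<theta> x)))"
    unfolding adjoint_weighted_op[OF X] mult_ind_def
    by (rule weighted_op_class[OF sq_int_indicator[OF cell_image L2_rep_sq_int[OF X]]])
  also have "\<dots> = L2_class M (\<lambda>x. indicator (a i) x * of_real (sqrt (J x)) * L2_rep X (\<theta> x))"
    by (intro arg_cong[of _ _ "L2_class M"]) (auto simp: indicator_def)
  also have "\<dots> = weighted_op i X" using X by (simp add: weighted_op_def)
  finally show ?thesis .
qed

text \<open>A function on the cell is transported to the image by \<open>\<psi> i\<close> and
  divided by the square root of the density.\<close>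

lemma range_weighted_op:
  assumes X: "X \<in> L2 M"
  shows "\<exists>Y\<in>L2 M. weighted_op i Y = mult_ind (a i) X"
proof -
  let ?f = "L2_rep X"
  have f: "?f \<in> sq_int M" by (rule L2_rep_sq_int[OF X])
  have [measurable]: "?f \<in> borel_measurable M" using f by (rule sq_int_measurable)
  \<comment> \<open>Where the density vanishes the quotient is 0 by convention; this affects only a
    null set of the cell.\<close>
  define g where "g x = indicator (\<theta> ` a i) x * (?f (\<psi> i x) / of_real (sqrt (J (\<psi> i x))))" for x
  have g_meas [measurable]: "g \<in> borel_measurable M" unfolding g_def by measurable
  have "(\<integral>\<^sup>+x. ennreal ((norm (g x))\<^sup>2) \<partial>M)
      = (\<integral>\<^sup>+x. ennreal (indicator (\<theta> ` a i) x) * ennreal ((norm (?f (\<psi> i x)))\<^sup>2 / J (\<psi> i x)) \<partial>M)"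
    by (intro nn_integral_cong)
      (auto simp: g_def indicator_def norm_divide power_divide weight_nonneg)
  also have "\<dots> = (\<integral>\<^sup>+x. ennreal (indicator (a i) x * J x) *
      ennreal ((norm (?f (\<psi> i (\<theta> x))))\<^sup>2 / J (\<psi> i (\<theta> x))) \<partial>M)"
    by (rule change_nn[symmetric]) measurable
  also have "\<dots> \<le> (\<integral>\<^sup>+x. ennreal ((norm (?f x))\<^sup>2) \<partial>M)"
  proof (intro nn_integral_mono)
    fix x
    show "ennreal (indicator (a i) x * J x) * ennreal ((norm (?f (\<psi> i (\<theta> x))))\<^sup>2 / J (\<psi> i (\<theta> x)))
        \<le> ennreal ((norm (?f x))\<^sup>2)"
      using weight_nonneg[of x]
      by (cases "x \<in> a i"; cases "J x = 0") (auto simp: inverse_eq ennreal_mult[symmetric])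
  qed
  also have "\<dots> < \<infinity>" using f by (simp add: sq_int_iff_nn)
  finally have g: "g \<in> sq_int M" by (simp add: sq_int_iff_nn)
  have "weighted_op i (L2_class M g) = L2_class M (\<lambda>x. indicator (a i) x * of_real (sqrt (J x)) * g (\<theta> x))"
    by (rule weighted_op_class[OF g])
  also have "\<dots> = mult_ind (a i) X"
    unfolding mult_ind_def
  proof (subst L2_class_eq_iff)
    show "AE x in M. indicator (a i) x * complex_of_real (sqrt (J x)) * g (\<theta> x) = indicator (a i) x * ?f x"
      using weight_pos by eventually_elim (auto simp: g_def indicator_def inverse_eq)
  qed measurable
  finally show ?thesis by (intro bexI[of _ "L2_class M g"] L2_class_in g)
qed

text \<open>The adjoint sees only the part of \<open>X\<close> in the cell, because the range of
  \<open>weighted_op i\<close> vanishes elsewhere. That part is \<open>weighted_op i Y\<close> for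
  some \<open>Y\<close>, and the partial isometry identity finishes.\<close>

lemma weighted_op_adjoint_op:
  assumes X: "X \<in> L2 M"
  shows "weighted_op i (s i X) = mult_ind (a i) X"
proof -
  obtain Y where Y: "Y \<in> L2 M" "weighted_op i Y = mult_ind (a i) X"
    using range_weighted_op[OF X] by blast
  have "s i X = s i (mult_ind (a i) X)"
  proof (rule L2_eqI[where M = M])
    fix Z assume Z: "Z \<in> L2 M"
    let ?g = "\<lambda>x. indicator (a i) x * of_real (sqrt (J x)) * L2_rep Z (\<theta> x)"
    have w: "weighted_op i Z = L2_class M ?g"
      using weighted_op_class[OF L2_rep_sq_int[OF Z], of i] Z by simp
    note g = weighted_sq_int(1)[OF L2_rep_sq_int[OF Z], of i]
    note f = L2_rep_sq_int[OF X]
    have "L2_inner M (mult_ind (a i) X) (L2_class M ?g) = L2_inner M (L2_class M (L2_rep X)) (L2_class M ?g)"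
      unfolding mult_ind_def L2_inner_class[OF sq_int_indicator[OF cell f] g] L2_inner_class[OF f g]
      by (intro Bochner_Integration.integral_cong) (auto simp: indicator_def)
    then show "L2_inner M (s i X) Z = L2_inner M (s i (mult_ind (a i) X)) Z"
      using X Z by (simp add: weighted_adjoint w)
  qed (use X in \<open>auto simp: bounded_ops_in[OF op_adjoint_in[OF weighted_op_in]]\<close>)
  then have "weighted_op i (s i X) = weighted_op i (s i (weighted_op i Y))" by (simp only: Y(2))
  also have "\<dots> = weighted_op i Y" by (rule weighted_op_partial_isometry[OF Y(1)])
  finally show ?thesis by (simp only: Y(2))
qed

lemma mult_ind_sum_inner:
  assumes "X \<in> L2 M" "Y \<in> L2 M" "E \<in> sets M"
    and "AE x in M. indicator E x = (\<Sum>j\<in>UNIV. c j * indicator (a j) x :: complex)"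
  shows "(\<Sum>j\<in>UNIV. c j * L2_inner M (mult_ind (a j) X) Y) = L2_inner M (mult_ind E X) Y"
proof -
  note s = assms(1,2)[THEN L2_rep_sq_int]
  note [measurable] = s[THEN sq_int_measurable] assms(3)
  let ?F = "\<lambda>x. L2_rep X x * cnj (L2_rep Y x)"
  have int: "integrable M (\<lambda>x. indicator (a j) x * ?F x)" for j
    using sq_int_mult_integrable[OF sq_int_indicator[OF cell s(1)] s(2), of j] by (simp add: mult.assoc)
  have "(\<Sum>j\<in>UNIV. c j * L2_inner M (mult_ind (a j) X) Y) = (LINT x|M. (\<Sum>j\<in>UNIV. c j * (indicator (a j) x * ?F x)))"
    using assms(1,2) int by (simp add: mult_ind_inner Bochner_Integration.integral_sum)
  also have "\<dots> = (LINT x|M. indicator E x * ?F x)"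
  proof (rule integral_cong_AE)
    show "AE x in M. (\<Sum>j\<in>UNIV. c j * (indicator (a j) x * ?F x)) = indicator E x * ?F x"
      using assms(4)
    proof eventually_elim
      case (elim x)
      then show ?case by (simp only: elim sum_distrib_right mult.assoc)
    qed
  qed measurable
  also have "\<dots> = L2_inner M (mult_ind E X) Y" using assms by (simp add: mult_ind_inner)
  finally show ?thesis .
qed

lemma indicator_cells: "(\<Sum>j\<in>UNIV. indicator (a j) x) = (1 :: complex)"
proof -
  obtain i where i: "x \<in> a i" using cells_cover by blast
  have "indicator (a j) x = (if j = i then 1 else 0 :: complex)" for j
    using i cells_disjoint by (auto simp: disjoint_family_on_def indicator_def)
  then show ?thesis by simp
qed

text \<open>Sums in the algebra are compared through inner products, where
  \<open>op_finsum_inner\<close> evaluates them and \<open>mult_ind_sum_inner\<close> adds up the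
  indicators of the cells.\<close>

lemma cuntz_krieger_family: "cuntz_krieger_family A (op_algebra M) weighted_op"
proof -
  have s_L2: "X \<in> L2 M \<Longrightarrow> s i X \<in> L2 M" for X i by (rule op_adjoint_L2[OF weighted_op_in])
  have s_in: "s i \<in> bounded_ops M" for i by (rule op_adjoint_in[OF weighted_op_in])
  have P_in: "(\<lambda>X\<in>L2 M. weighted_op i (s i X)) \<in> bounded_ops M" for i
    by (rule op_mult_in[OF weighted_op_in s_in])
  have cP_in: "(\<lambda>X\<in>L2 M. L2_scale M c ((\<lambda>X\<in>L2 M. weighted_op i (s i X)) X)) \<in> bounded_ops M" for c i
    by (rule op_scale_in[OF P_in])
  interpret ring "op_algebra M" by (rule ring_op_algebra)
  have "partial_isometry (op_algebra M) (weighted_op i)" for i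
    unfolding partial_isometry_def op_algebra_simps
  proof (intro conjI weighted_op_in extensionalityI[of _ "L2 M"])
    show "weighted_op i \<in> extensional (L2 M)" by (simp add: weighted_op_def)
    fix X assume "X \<in> L2 M"
    then show "(\<lambda>X\<in>L2 M. (\<lambda>X\<in>L2 M. weighted_op i (s i X)) (weighted_op i X)) X = weighted_op i X"
      by (simp add: weighted_op_partial_isometry)
  qed simp
  moreover have "(\<Oplus>\<^bsub>op_algebra M\<^esub>j\<in>UNIV. weighted_op j \<otimes>\<^bsub>op_algebra M\<^esub> star (op_algebra M) (weighted_op j))
      = \<one>\<^bsub>op_algebra M\<^esub>" (is "?S = _")
  proof (rule bounded_ops_eqI[where M = M])
    have "?S \<in> carrier (op_algebra M)"
    proof (rule finsum_closed, rule Pi_I)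
      fix j
      show "weighted_op j \<otimes>\<^bsub>op_algebra M\<^esub> star (op_algebra M) (weighted_op j) \<in> carrier (op_algebra M)"
        unfolding op_algebra_simps by (rule P_in)
    qed
    then show "?S \<in> bounded_ops M" by (simp only: op_algebra_simps(1))
    show "\<one>\<^bsub>op_algebra M\<^esub> \<in> bounded_ops M" unfolding op_algebra_simps by (rule op_one_in)
    fix X Y assume X: "X \<in> L2 M" and Y: "Y \<in> L2 M"
    have "L2_inner M (?S X) Y = (\<Sum>j\<in>UNIV. L2_inner M ((\<lambda>X\<in>L2 M. weighted_op j (s j X)) X) Y)"
      unfolding op_algebra_simps(2,7) by (rule op_finsum_inner) (simp_all add: P_in X Y del: restrict_apply)
    also have "\<dots> = (\<Sum>j\<in>UNIV. 1 * L2_inner M (mult_ind (a j) X) Y)"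
      using X by (simp add: weighted_op_adjoint_op)
    also have "\<dots> = L2_inner M (mult_ind UNIV X) Y"
      by (rule mult_ind_sum_inner[OF X Y]) (use space sets.top[of M] in \<open>simp_all add: indicator_cells\<close>)
    also have "mult_ind UNIV X = X" using X by (simp add: mult_ind_def)
    also have "L2_inner M X Y = L2_inner M (\<one>\<^bsub>op_algebra M\<^esub> X) Y" using X by simp
    finally show "L2_inner M (?S X) Y = L2_inner M (\<one>\<^bsub>op_algebra M\<^esub> X) Y" .
  qed
  moreover have "star (op_algebra M) (weighted_op i) \<otimes>\<^bsub>op_algebra M\<^esub> weighted_op i =
      (\<Oplus>\<^bsub>op_algebra M\<^esub>j\<in>UNIV. of_nat (A $ i $ j) \<odot>\<^bsub>op_algebra M\<^esub>
        (weighted_op j \<otimes>\<^bsub>op_algebra M\<^esub> star (op_algebra M) (weighted_op j)))" (is "_ = ?R") for i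
  proof (rule bounded_ops_eqI[where M = M])
    show "star (op_algebra M) (weighted_op i) \<otimes>\<^bsub>op_algebra M\<^esub> weighted_op i \<in> bounded_ops M"
      by (simp only: op_algebra_simps op_mult_in[OF s_in weighted_op_in])
    have "?R \<in> carrier (op_algebra M)"
    proof (rule finsum_closed, rule Pi_I)
      fix j
      show "of_nat (A $ i $ j) \<odot>\<^bsub>op_algebra M\<^esub> (weighted_op j \<otimes>\<^bsub>op_algebra M\<^esub> star (op_algebra M) (weighted_op j))
          \<in> carrier (op_algebra M)"
        unfolding op_algebra_simps by (rule cP_in)
    qed
    then show "?R \<in> bounded_ops M" by (simp only: op_algebra_simps(1))
    fix X Y assume X: "X \<in> L2 M" and Y: "Y \<in> L2 M"
    have "L2_inner M (?R X) Y = (\<Sum>j\<in>UNIV. L2_inner M ((\<lambda>X\<in>L2 M. L2_scale M (of_nat (A $ i $ j))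
        ((\<lambda>X\<in>L2 M. weighted_op j (s j X)) X)) X) Y)"
      unfolding op_algebra_simps(2,6,7) by (rule op_finsum_inner) (simp_all add: cP_in X Y del: restrict_apply)
    also have "\<dots> = (\<Sum>j\<in>UNIV. of_nat (A $ i $ j) * L2_inner M (mult_ind (a j) X) Y)"
      using X Y by (simp add: weighted_op_adjoint_op)
    also have "\<dots> = L2_inner M (mult_ind (\<theta> ` a i) X) Y"
      by (rule mult_ind_sum_inner[OF X Y cell_image incidence])
    also have "\<dots> = L2_inner M ((star (op_algebra M) (weighted_op i) \<otimes>\<^bsub>op_algebra M\<^esub> weighted_op i) X) Y"
      using X by (simp add: adjoint_weighted_op)
    finally show "L2_inner M ((star (op_algebra M) (weighted_op i) \<otimes>\<^bsub>op_algebra M\<^esub> weighted_op i) X) Y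
        = L2_inner M (?R X) Y" by (rule sym)
  qed
  ultimately show ?thesis by (simp add: cuntz_krieger_family_def del: op_algebra_simps)
qed

end

subsection \<open>Markov fibred systems\<close>

context markov_fibred_system
begin

lemma space_UNIV: "space m = UNIV"
  using sets_eq_imp_space_eq[OF borel_sets] by simp

lemma the_cell: "x \<in> a i \<Longrightarrow> (THE k. x \<in> a k) = i"
  using disjoint by (intro the_equality) (auto simp: disjoint_family_on_def)

lemma map_measurable [measurable]: "\<theta> \<in> m \<rightarrow>\<^sub>M m"
  using measurable_map by (simp add: measurable_cong_sets[OF borel_sets borel_sets])

lemma cell_measurable [measurable]: "a i \<in> sets m"
  using cell_borel by (simp add: borel_sets)

lemma image_measurable: "E \<in> sets m \<Longrightarrow> E \<subseteq> a i \<Longrightarrow> \<theta> ` E \<in> sets m"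
  using image_borel by (simp add: borel_sets)

lemma sets_cell_image [simp]: "sets (cell_image_measure m \<theta> c) = sets m"
  by (simp add: cell_image_measure_def)

text \<open>Injectivity on the cell keeps images of disjoint sets disjoint. Without countable
  additivity \<open>measure_of\<close> would return the zero measure.\<close>

lemma emeasure_cell_image:
  assumes "E \<in> sets m"
  shows "emeasure (cell_image_measure m \<theta> (a i)) E = emeasure m (\<theta> ` (E \<inter> a i))"
  unfolding cell_image_measure_def
proof (rule emeasure_measure_of_sigma)
  show "positive (sets m) (\<lambda>E. emeasure m (\<theta> ` (E \<inter> a i)))" by (simp add: positive_def)
  show "countably_additive (sets m) (\<lambda>E. emeasure m (\<theta> ` (E \<inter> a i)))"
  proof (rule countably_additiveI)
    fix F :: "nat \<Rightarrow> 'a set"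
    assume F: "range F \<subseteq> sets m" "disjoint_family F"
    have sets: "range (\<lambda>n. \<theta> ` (F n \<inter> a i)) \<subseteq> sets m"
      using F by (auto intro!: image_measurable[of _ i])
    have "\<theta> ` (F k \<inter> a i) \<inter> \<theta> ` (F l \<inter> a i) = {}" if "k \<noteq> l" for k l
    proof -
      have "\<theta> ` (F k \<inter> a i) \<inter> \<theta> ` (F l \<inter> a i) = \<theta> ` ((F k \<inter> a i) \<inter> (F l \<inter> a i))"
        by (rule inj_on_image_Int[symmetric, OF injective[of i]]) auto
      moreover have "F k \<inter> F l = {}" using F(2) that by (auto simp: disjoint_family_on_def)
      ultimately show ?thesis by auto
    qed
    then have "(\<Sum>n. emeasure m (\<theta> ` (F n \<inter> a i))) = emeasure m (\<Union>n. \<theta> ` (F n \<inter> a i))"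
      by (intro suminf_emeasure sets) (auto simp: disjoint_family_on_def)
    also have "(\<Union>n. \<theta> ` (F n \<inter> a i)) = \<theta> ` ((\<Union>n. F n) \<inter> a i)" by auto
    finally show "(\<Sum>n. emeasure m (\<theta> ` (F n \<inter> a i))) = emeasure m (\<theta> ` ((\<Union>n. F n) \<inter> a i))" .
  qed
qed (use assms sets.sigma_algebra_axioms in auto)

lemma absolutely_continuous_cell_image: "absolutely_continuous m (cell_image_measure m \<theta> (a i))"
  unfolding absolutely_continuous_def
proof
  fix E assume E: "E \<in> null_sets m"
  then have sets: "E \<in> sets m" by auto
  have "E \<inter> a i \<in> null_sets m" using E by (rule null_set_Int2) simp
  then have "emeasure m (E \<inter> a i) = 0" by (rule null_setsD1)
  then have "emeasure m (\<theta> ` (E \<inter> a i)) = 0"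
    using sets.Int[OF sets cell_measurable[of i]] by (intro image_null[of _ i]) (auto simp: borel_sets)
  then show "E \<in> null_sets (cell_image_measure m \<theta> (a i))"
    using sets by (intro null_setsI) (simp_all add: emeasure_cell_image)
qed

lemma density_cell_image:
  "density m (RN_deriv m (cell_image_measure m \<theta> (a i))) = cell_image_measure m \<theta> (a i)"
  by (rule density_RN_deriv[OF absolutely_continuous_cell_image sets_cell_image])

text \<open>The image measure is finite, so \<open>enn2real\<close> in \<open>rn_derivative\<close>
  loses nothing almost everywhere.\<close>

lemma RN_deriv_cell_finite: "AE x in m. RN_deriv m (cell_image_measure m \<theta> (a i)) x \<noteq> \<infinity>"
proof -
  let ?\<nu> = "cell_image_measure m \<theta> (a i)"
  have "emeasure ?\<nu> (space ?\<nu>) \<noteq> \<infinity>"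
    using emeasure_cell_image[of UNIV i] sets_eq_imp_space_eq[OF sets_cell_image, of "a i"]
      sets.top[of m] emeasure_finite by (simp add: space_UNIV)
  then interpret \<nu>: finite_measure ?\<nu> by (intro finite_measureI)
  show ?thesis
    by (rule RN_deriv_finite[OF \<nu>.sigma_finite_measure_axioms absolutely_continuous_cell_image sets_cell_image])
qed

end

text \<open>The inverse branch is given a constant value off the image, where its measurability is
  then evident.\<close>

lemma weighted_composition_markov:
  fixes m :: "'a::polish_space measure" and a :: "'i::finite \<Rightarrow> 'a set"
  assumes "markov_fibred_system m \<theta> a"
  shows "weighted_composition m \<theta> a (rn_derivative m \<theta> a)
    (\<lambda>i y. if y \<in> \<theta> ` a i then inv_into (a i) \<theta> y else undefined) (incidence_matrix m \<theta> a)"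
proof -
  interpret markov_fibred_system m \<theta> a by fact
  let ?J = "rn_derivative m \<theta> a"
  define \<nu> where "\<nu> i = cell_image_measure m \<theta> (a i)" for i
  have J: "?J x = enn2real (RN_deriv m (\<nu> i) x)" if "x \<in> a i" for x i
    using the_cell[OF that] by (simp add: rn_derivative_def \<nu>_def)
  \<comment> \<open>A finite sum over the cells replaces the choice of the cell inside the
    definition, which makes measurability visible.\<close>
  have J_sum: "?J x = (\<Sum>i\<in>UNIV. indicator (a i) x * enn2real (RN_deriv m (\<nu> i) x))" for x
  proof -
    obtain k where k: "x \<in> a k" using covers by blast
    have "indicator (a i) x * enn2real (RN_deriv m (\<nu> i) x) = (if i = k then ?J x else 0)" for i
      using k J[OF k] disjoint by (auto simp: disjoint_family_on_def indicator_def)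
    then show ?thesis by simp
  qed
  have J_meas [measurable]: "?J \<in> borel_measurable m"
    unfolding J_sum[abs_def] by measurable
  have im: "\<theta> ` a i \<in> sets m" for i by (rule image_measurable[of _ i]) auto
  have change: "(\<integral>\<^sup>+x. ennreal (?J x) * indicator (a i \<inter> \<theta> -` E) x \<partial>m) = emeasure m (E \<inter> \<theta> ` a i)"
    if E [measurable]: "E \<in> sets m" for E i
  proof -
    have "\<theta> -` E \<inter> space m \<in> sets m" by measurable
    then have S [measurable]: "a i \<inter> \<theta> -` E \<in> sets m" by (simp add: space_UNIV sets.Int)
    have "(\<integral>\<^sup>+x. ennreal (?J x) * indicator (a i \<inter> \<theta> -` E) x \<partial>m)
        = (\<integral>\<^sup>+x. RN_deriv m (\<nu> i) x * indicator (a i \<inter> \<theta> -` E) x \<partial>m)"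
    proof (rule nn_integral_cong_AE)
      show "AE x in m. ennreal (?J x) * indicator (a i \<inter> \<theta> -` E) x = RN_deriv m (\<nu> i) x * indicator (a i \<inter> \<theta> -` E) x"
        using RN_deriv_cell_finite[of i]
        by eventually_elim (auto simp: indicator_def J \<nu>_def less_top)
    qed
    also have "\<dots> = emeasure (\<nu> i) (a i \<inter> \<theta> -` E)"
      by (subst (2) \<nu>_def, subst density_cell_image[symmetric]) (simp add: emeasure_density \<nu>_def)
    also have "\<dots> = emeasure m (\<theta> ` ((a i \<inter> \<theta> -` E) \<inter> a i))"
      unfolding \<nu>_def by (rule emeasure_cell_image[OF S])
    also have "\<theta> ` ((a i \<inter> \<theta> -` E) \<inter> a i) = E \<inter> \<theta> ` a i" by auto
    finally show ?thesis .
  qed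
  have pos: "AE x in m. 0 < ?J x"
  proof -
    \<comment> \<open>By injectivity the points of the cell mapped into the image of the zero set
      are those of the zero set, so that image is null by \<open>change\<close>. Nonsingularity
      makes its preimage null, and this contains the zero set.\<close>
    have "AE x in m. x \<notin> {x \<in> a i. ?J x = 0}" for i
    proof -
      let ?Z = "{x \<in> a i. ?J x = 0}"
      have "?Z = a i \<inter> {x \<in> space m. ?J x = 0}" by (auto simp: space_UNIV)
      also have "\<dots> \<in> sets m" by measurable
      finally have Z: "?Z \<in> sets m" .
      have \<theta>Z: "\<theta> ` ?Z \<in> sets m" by (rule image_measurable[OF Z, of i]) auto
      have "emeasure m (\<theta> ` ?Z) = emeasure m (\<theta> ` ?Z \<inter> \<theta> ` a i)"
        by (intro arg_cong[of _ _ "emeasure m"]) auto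
      also have "\<dots> = (\<integral>\<^sup>+x. ennreal (?J x) * indicator (a i \<inter> \<theta> -` (\<theta> ` ?Z)) x \<partial>m)"
        by (rule change[OF \<theta>Z, symmetric])
      also have "\<dots> = (\<integral>\<^sup>+x. 0 \<partial>m)"
      proof (rule nn_integral_cong)
        fix x
        have "?J x = 0" if x: "x \<in> a i" "\<theta> x \<in> \<theta> ` ?Z"
        proof -
          obtain z where z: "z \<in> ?Z" "\<theta> x = \<theta> z" using x(2) by (rule imageE) auto
          then have "x = z" by (intro inj_onD[OF injective[of i] z(2) x(1)]) simp
          then show ?thesis using z(1) by simp
        qed
        then show "ennreal (?J x) * indicator (a i \<inter> \<theta> -` (\<theta> ` ?Z)) x = 0"
          by (cases "x \<in> a i \<inter> \<theta> -` (\<theta> ` ?Z)") simp_all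
      qed
      finally have "emeasure m (\<theta> -` (\<theta> ` ?Z)) = 0"
        using nonsingular[of "\<theta> ` ?Z"] \<theta>Z by (simp add: borel_sets)
      moreover have "\<theta> -` (\<theta> ` ?Z) \<in> sets m"
        using measurable_sets[OF map_measurable \<theta>Z] by (simp add: space_UNIV)
      ultimately show ?thesis by (intro AE_I[of _ _ "\<theta> -` (\<theta> ` ?Z)"]) auto
    qed
    then have "AE x in m. \<forall>i\<in>UNIV. x \<notin> {x \<in> a i. ?J x = 0}"
      by (intro AE_finite_allI) auto
    then show ?thesis
    proof eventually_elim
      case (elim x)
      obtain i where "x \<in> a i" using covers by blast
      moreover have "?J x \<ge> 0" by (simp add: rn_derivative_def)
      ultimately show ?case using elim by (auto simp: less_le)
    qed
  qed
  have inv: "(\<lambda>y. if y \<in> \<theta> ` a i then inv_into (a i) \<theta> y else undefined) \<in> m \<rightarrow>\<^sub>M m" (is "?\<psi> \<in> _") for i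
  proof (rule measurableI)
    fix E assume E: "E \<in> sets m"
    have "?\<psi> -` E \<inter> space m = \<theta> ` (E \<inter> a i) \<union> (if undefined \<in> E then - \<theta> ` a i else {})"
      using injective[of i] by (auto simp: space_UNIV split: if_splits)
    moreover have "\<theta> ` (E \<inter> a i) \<in> sets m" using E by (intro image_measurable[of _ i]) auto
    moreover have "- \<theta> ` a i \<in> sets m" using sets.compl_sets[OF im[of i]] by (simp add: space_UNIV Compl_eq_Diff_UNIV)
    ultimately show "?\<psi> -` E \<inter> space m \<in> sets m" by (simp add: sets.Un)
  qed (simp add: space_UNIV)
  have inc: "AE x in m. indicator (\<theta> ` a i) x
      = (\<Sum>j\<in>UNIV. of_nat (incidence_matrix m \<theta> a $ i $ j) * indicator (a j) x :: complex)" for i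
  proof -
    obtain B where B: "B \<in> sigma_sets UNIV (range a)" "AE x in m. x \<in> \<theta> ` a i \<longleftrightarrow> x \<in> B"
      using markov by blast
    \<comment> \<open>Sets generated by a partition are unions of its members.\<close>
    have dich: "a j \<subseteq> B \<or> a j \<inter> B = {}" for j
      using B(1)
    proof induction
      case (Basic b)
      then obtain k where "b = a k" by auto
      then show ?case using disjoint by (cases "j = k") (auto simp: disjoint_family_on_def)
    qed auto
    have "AE x in m. x \<in> a j \<longrightarrow> (x \<in> B \<longleftrightarrow> incidence_matrix m \<theta> a $ i $ j = 1)" for j
    proof (cases "a j \<subseteq> B")
      case True
      have "AE x in m. x \<in> a j \<longrightarrow> x \<in> \<theta> ` a i" using B(2) True by (auto elim!: eventually_mono)
      then show ?thesis using True by (auto simp: incidence_matrix_def)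
    next
      case False
      then have j: "a j \<inter> B = {}" using dich by auto
      show ?thesis
      proof (cases "AE x in m. x \<in> a j \<longrightarrow> x \<in> \<theta> ` a i")
        \<comment> \<open>The entry is 1 although the cell misses \<open>B\<close>. This happens
          only for a null cell, so the equivalence holds almost everywhere.\<close>
        case True
        then have "AE x in m. x \<notin> a j" using B(2) by eventually_elim (use j in auto)
        then show ?thesis by (auto elim!: eventually_mono)
      next
        case False
        then show ?thesis using j by (auto simp: incidence_matrix_def)
      qed
    qed
    then have "AE x in m. \<forall>j\<in>UNIV. x \<in> a j \<longrightarrow> (x \<in> B \<longleftrightarrow> incidence_matrix m \<theta> a $ i $ j = 1)"
      by (intro AE_finite_allI) auto
    then show ?thesis using B(2)
    proof eventually_elim
      case (elim x)
      obtain k where k: "x \<in> a k" using covers by blast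
      have "of_nat (incidence_matrix m \<theta> a $ i $ j) * indicator (a j) x
          = (if j = k then of_nat (incidence_matrix m \<theta> a $ i $ k) else 0 :: complex)" for j
        using k disjoint by (auto simp: disjoint_family_on_def indicator_def)
      moreover have "incidence_matrix m \<theta> a $ i $ k = (if x \<in> \<theta> ` a i then 1 else 0)"
        using elim k by (auto simp: incidence_matrix_def split: if_splits)
      ultimately show ?case by (simp add: indicator_def)
    qed
  qed
  show ?thesis
    by unfold_locales
      (use change pos inv inc im injective disjoint covers in \<open>auto simp: space_UNIV rn_derivative_def\<close>)
qed

lemma rn_operator_eq:
  assumes "weighted_composition m \<theta> a (rn_derivative m \<theta> a) \<psi> A"
  shows "rn_operator m \<theta> a = weighted_composition.weighted_op m \<theta> a (rn_derivative m \<theta> a)"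
proof -
  interpret weighted_composition m \<theta> a "rn_derivative m \<theta> a" \<psi> A by fact
  show ?thesis by (simp add: fun_eq_iff rn_operator_def weighted_op_def)
qed

subsection \<open>A family on the sequence space\<close>

lemma bij_betw_infinite_nat_sets:
  fixes X Y :: "nat set"
  assumes "infinite X" "infinite Y"
  shows "\<exists>f. bij_betw f X Y"
proof -
  obtain e e' where "bij_betw e X (UNIV :: nat set)" "bij_betw e' Y (UNIV :: nat set)"
    using countableE_infinite[of X] countableE_infinite[of Y] assms by (metis countable_subset countableI_type subset_UNIV)
  then show ?thesis using bij_betw_trans bij_betw_inv_into by blast
qed

text \<open>The natural numbers are cut into infinite cells, and each is mapped bijectively onto the
  union of its successor cells, which is infinite because no row of the matrix is zero. Counting
  measure makes the weight 1.\<close>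

lemma weighted_composition_nat:
  fixes A :: "nat^'i::finite^'i"
  assumes A: "zero_one_matrix A"
  shows "\<exists>\<theta> N. weighted_composition (count_space (UNIV :: nat set)) \<theta> N (\<lambda>_. 1) (\<lambda>i. inv_into (N i) \<theta>) A"
proof -
  obtain e :: "'i \<times> nat \<Rightarrow> nat" where e: "bij_betw e UNIV UNIV"
    using countableE_infinite[of "UNIV :: ('i \<times> nat) set"] by (auto simp: finite_prod)
  define b where "b = inv_into UNIV e"
  have b: "bij b" unfolding b_def using e by (rule bij_imp_bij_inv)
  \<comment> \<open>The fibres of a bijection onto \<open>'i \<times> nat\<close>, hence all
    infinite.\<close>
  define N where "N i = {n. fst (b n) = i}" for i
  have inf: "infinite (N i)" for i
  proof
    assume "finite (N i)"
    then have "finite (b ` N i)" by simp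
    moreover have "range (\<lambda>k. (i, k)) \<subseteq> b ` N i"
    proof (rule image_subsetI)
      fix k
      have "b (inv_into UNIV b (i, k)) = (i, k)" using b by (simp add: bij_is_surj surj_f_inv_f)
      then show "(i, k) \<in> b ` N i"
        by (intro image_eqI[of _ _ "inv_into UNIV b (i, k)"]) (simp_all add: N_def)
    qed
    moreover have "infinite (range (\<lambda>k :: nat. (i, k)))"
      by (rule range_inj_infinite) (auto simp: inj_def)
    ultimately show False using finite_subset by blast
  qed
  have "\<exists>f. bij_betw f (N i) (\<Union>j\<in>{j. A $ i $ j = 1}. N j)" for i
  proof (rule bij_betw_infinite_nat_sets[OF inf])
    obtain j where "A $ i $ j = 1" using A unfolding zero_one_matrix_def by blast
    then show "infinite (\<Union>j\<in>{j. A $ i $ j = 1}. N j)"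
      using inf[of j] by (meson UN_upper finite_subset mem_Collect_eq)
  qed
  then obtain \<beta> where \<beta>: "\<And>i. bij_betw (\<beta> i) (N i) (\<Union>j\<in>{j. A $ i $ j = 1}. N j)" by metis
  define \<theta> where "\<theta> n = \<beta> (fst (b n)) n" for n
  have \<theta>: "bij_betw \<theta> (N i) (\<Union>j\<in>{j. A $ i $ j = 1}. N j)" for i
    using \<beta>[of i] by (subst bij_betw_cong[of _ _ "\<beta> i"]) (auto simp: \<theta>_def N_def)
  have inj: "inj_on \<theta> (N i)" and img: "\<theta> ` N i = (\<Union>j\<in>{j. A $ i $ j = 1}. N j)" for i
    using \<theta>[of i] by (auto simp: bij_betw_def)
  have change: "emeasure (count_space UNIV) (N i \<inter> \<theta> -` E) = emeasure (count_space UNIV) (E \<inter> \<theta> ` N i)" for i E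
  proof -
    have "bij_betw \<theta> (N i \<inter> \<theta> -` E) (E \<inter> \<theta> ` N i)"
      using inj[of i] by (auto simp: bij_betw_def inj_on_def)
    then show ?thesis by (simp add: emeasure_count_space bij_betw_finite bij_betw_same_card)
  qed
  have inc: "indicator (\<theta> ` N i) n = (\<Sum>j\<in>UNIV. of_nat (A $ i $ j) * indicator (N j) n :: complex)" for i n
  proof -
    have "of_nat (A $ i $ j) * indicator (N j) n = (if j = fst (b n) then of_nat (A $ i $ j) else 0 :: complex)" for j
      by (auto simp: N_def indicator_def)
    then have "(\<Sum>j\<in>UNIV. of_nat (A $ i $ j) * indicator (N j) n :: complex) = of_nat (A $ i $ fst (b n))"
      by simp
    also have "\<dots> = indicator (\<theta> ` N i) n"
    proof -
      have "n \<in> \<theta> ` N i \<longleftrightarrow> A $ i $ fst (b n) = 1" unfolding img by (auto simp: N_def)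
      then show ?thesis using zero_one_cases[OF A, of i "fst (b n)"] by (simp add: indicator_def) linarith
    qed
    finally show ?thesis by simp
  qed
  have "weighted_composition (count_space (UNIV :: nat set)) \<theta> N (\<lambda>_. 1) (\<lambda>i. inv_into (N i) \<theta>) A"
    by unfold_locales (use inj inc change in \<open>auto simp: disjoint_family_on_def N_def[of "fst (b _)"] N_def AE_count_space\<close>)
  then show ?thesis by blast
qed

section \<open>The isomorphism\<close>

text \<open>A bound that does not depend on the family, so that the tuple of all families is an
  element of the bounded product.\<close>

lemma (in ck_family) generator_norm: "op_norm M (t i) \<le> 1"
proof (rule op_norm_le)
  fix X assume X: "X \<in> L2 M"
  have "L2_inner M (t i X) (t i X) = (\<Sum>j\<in>UNIV. of_nat (A $ i $ j) * L2_inner M (s j X) (s j X))"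
    by (rule relation[OF X X])
  also have "\<dots> = of_real (\<Sum>j\<in>UNIV. real (A $ i $ j) * (L2_norm M (s j X))\<^sup>2)"
    by (simp only: L2_inner_self_norm of_real_sum of_real_mult of_real_of_nat_eq)
  finally have "(L2_norm M (t i X))\<^sup>2 = (\<Sum>j\<in>UNIV. real (A $ i $ j) * (L2_norm M (s j X))\<^sup>2)"
    by (rule L2_norm_sqI)
  also have "\<dots> \<le> (\<Sum>j\<in>UNIV. (L2_norm M (s j X))\<^sup>2)"
  proof (rule sum_mono)
    show "real (A $ i $ j) * (L2_norm M (s j X))\<^sup>2 \<le> (L2_norm M (s j X))\<^sup>2" for j
      using zero_one_cases[OF zero_one, of i j] by auto
  qed
  also have "\<dots> = (L2_norm M X)\<^sup>2"
    using total_words_norm[OF X, of 1] by (simp add: sum_words_Suc)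
  finally have "L2_norm M (t i X) \<le> L2_norm M X" by (rule power2_le_imp_le) simp
  then show "L2_norm M (t i X) \<le> 1 * L2_norm M X" by simp
qed simp

text \<open>The sum of the range projections of the listed generators. Over all indices, each listed
  once, the Cuntz-Krieger relations make it the unit.\<close>

primrec unit_npoly :: "'i list \<Rightarrow> 'i npoly" where
  "unit_npoly [] = PZero"
| "unit_npoly (j # js) = PAdd (PMul (PGen j) (PStar (PGen j))) (unit_npoly js)"

lemma (in ck_family) unit_npoly_eval:
  assumes "distinct js" "set js = UNIV"
  shows "npoly_eval (op_algebra M) t (unit_npoly js) = \<one>\<^bsub>op_algebra M\<^esub>"
proof (rule bounded_ops_eqI[where M = M])
  interpret banach_star_algebra "op_algebra M" by (rule banach_star_op_algebra)
  show "npoly_eval (op_algebra M) t (unit_npoly js) \<in> bounded_ops M"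
    using npoly_eval_closed[of t] by simp
  show "\<one>\<^bsub>op_algebra M\<^esub> \<in> bounded_ops M" using one_closed by simp
  fix X Y assume X: "X \<in> L2 M" and Y: "Y \<in> L2 M"
  have closed: "npoly_eval (op_algebra M) t p X \<in> L2 M" for p
    using poly_flat_eval[OF X, of p] X by simp
  have "L2_inner M (npoly_eval (op_algebra M) t (unit_npoly js) X) Y = (\<Sum>j\<leftarrow>js. L2_inner M (s j X) (s j Y))" for js
    using X Y closed by (induction js) (auto simp: t_adjoint)
  also have "(\<Sum>j\<leftarrow>js. L2_inner M (s j X) (s j Y)) = (\<Sum>j\<in>UNIV. L2_inner M (s j X) (s j Y))"
    using assms by (simp add: sum_list_distinct_conv_sum_set)
  also have "\<dots> = L2_inner M X Y" by (rule total[OF X Y])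
  finally show "L2_inner M (npoly_eval (op_algebra M) t (unit_npoly js) X) Y
      = L2_inner M (\<one>\<^bsub>op_algebra M\<^esub> X) Y" using X by simp
qed

lemma L2_nontrivial:
  assumes "E \<in> sets M" "emeasure M E \<noteq> 0" "emeasure M E \<noteq> \<infinity>"
  shows "L2 M \<noteq> {L2_zero M}"
proof -
  have [measurable]: "E \<in> sets M" by fact
  have f: "indicator E \<in> sq_int M"
  proof (rule sq_int_dominated)
    show "integrable M (indicator E :: _ \<Rightarrow> real)" using assms by (simp add: less_top)
  qed (auto simp: indicator_def)
  moreover have "L2_class M (indicator E) \<noteq> L2_zero M"
  proof
    assume "L2_class M (indicator E) = L2_zero M"
    then have "AE x in M. indicator E x = (0 :: complex)"
      by (subst (asm) L2_class_eq_iff) auto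
    then have "AE x in M. x \<notin> E" by eventually_elim (auto simp: indicator_def split: if_splits)
    then show False using assms(1,2) by (simp flip: AE_iff_null_sets add: null_sets_def)
  qed
  ultimately show ?thesis using L2_class_in by blast
qed

theorem theorem3p4:
  fixes m :: "'a::polish_space measure" and \<theta> :: "'a \<Rightarrow> 'a"
    and a :: "'i::finite \<Rightarrow> 'a set" and A :: "nat^'i^'i"
  assumes "CARD('i) \<ge> 2"
    and "markov_fibred_system m \<theta> a"
    and "\<exists>h. continuous_on (measure_support m) h \<and> (AE x in m. h x = rn_derivative m \<theta> a x)"
    and "A = incidence_matrix m \<theta> a"
    and "zero_one_matrix A"
    and "irreducible_matrix A"
    and "\<not> permutation_matrix A"
  shows "star_isomorphic (cuntz_krieger_algebra A) (rn_representation m \<theta> a)"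
proof -
  interpret markov_fibred_system m \<theta> a by fact
  note w = weighted_composition_markov[OF assms(2), folded assms(4)]
  interpret T: ck_family m A "rn_operator m \<theta> a"
    unfolding rn_operator_eq[OF w]
    by unfold_locales (rule weighted_composition.cuntz_krieger_family[OF w], rule assms(5))
  let ?N = "count_space (UNIV :: nat set)"
  let ?K = "ck_families A"
  let ?B = "bounded_product ?K ell2_ops"
  have ck: "ck_family ?N A t" if "t \<in> ?K" for t
    using that assms(5) by (auto simp: ck_families_def intro!: ck_family.intro)
  \<comment> \<open>The model on the sequence space is a member of the product's index set, so the
    supremum norm is meaningful.\<close>
  have K: "?K \<noteq> {}"
    using weighted_composition_nat[OF assms(5)] weighted_composition.cuntz_krieger_family
    by (fastforce simp: ck_families_def)
  have L2_m: "L2 m \<noteq> {L2_zero m}"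
    using nonzero by (intro L2_nontrivial[of UNIV]) (simp_all add: borel_sets)
  have L2_N: "L2 ?N \<noteq> {L2_zero ?N}"
    by (intro L2_nontrivial[of "{0}"]) simp_all
  interpret B: banach_star_algebra ?B
    by (rule banach_star_bounded_product[OF banach_star_op_algebra K])
  interpret C: banach_star_algebra "op_algebra m" by (rule banach_star_op_algebra)
  have gen_in: "ck_generator A i \<in> carrier ?B" for i
  proof (rule bounded_product_carrierI[where L = 1])
    fix t assume t: "t \<in> ?K"
    interpret ck_family ?N A t by (rule ck[OF t])
    show "ck_generator A i t \<in> carrier ell2_ops" "cnorm ell2_ops (ck_generator A i t) \<le> 1"
      using t generator_norm by (simp_all add: ck_generator_def)
  qed (simp add: ck_generator_def)
  have eval: "npoly_eval ?B (ck_generator A) p t = npoly_eval ell2_ops t p" if "t \<in> ?K" for p t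
    unfolding npoly_eval_bounded_product[OF that] using that by (simp add: ck_generator_def)
  interpret isometric_generators ?B "op_algebra m" "ck_generator A" "rn_operator m \<theta> a"
  proof unfold_locales
    fix p
    \<comment> \<open>The comparison is used in both directions, with both Hilbert spaces nonzero.
      All coordinates then have the same norm, and the supremum over them is that of a
      constant.\<close>
    have "op_norm ?N (npoly_eval ell2_ops t p) = op_norm m (npoly_eval (op_algebra m) (rn_operator m \<theta> a) p)"
      if "t \<in> ?K" for t
      by (intro antisym op_norm_transfer[OF ck[OF that] T.ck_family_axioms assms(6,7) L2_m]
          op_norm_transfer[OF T.ck_family_axioms ck[OF that] assms(6,7) L2_N])
    then show "cnorm ?B (npoly_eval ?B (ck_generator A) p)
        = cnorm (op_algebra m) (npoly_eval (op_algebra m) (rn_operator m \<theta> a) p)"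
      using K by (simp add: eval cong: SUP_cong)
    show "ck_generator A i \<in> carrier ?B" for i by (rule gen_in)
    show "rn_operator m \<theta> a i \<in> carrier (op_algebra m)" for i
      unfolding op_algebra_simps by (rule T.t_in)
  qed
  obtain js :: "'i list" where js: "distinct js" "set js = UNIV"
    using finite_distinct_list[of "UNIV :: 'i set"] by auto
  have one: "npoly_eval ?B (ck_generator A) (unit_npoly js) = \<one>\<^bsub>?B\<^esub>"
  proof (rule bounded_product_eqI)
    fix t assume t: "t \<in> ?K"
    show "npoly_eval ?B (ck_generator A) (unit_npoly js) t = \<one>\<^bsub>?B\<^esub> t"
      unfolding eval[OF t] ck_family.unit_npoly_eval[OF ck[OF t] js] using t by simp
  qed (rule B.npoly_eval_closed[OF gen_in] B.one_closed)+
  show ?thesis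
    using star_isomorphic_generated[OF isometric_generators_axioms one T.unit_npoly_eval[OF js]]
    unfolding cuntz_krieger_algebra_def rn_representation_def .
qed

end
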